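(* Let $(G,\cdot)$ be an arithmetical semigroup whose norm $|\cdot|$ takes only positive integer values, and suppose $G$ satisfies Axiom A with some $\delta>0$, i.e. there is $0\le\eta<\delta$ with $N_G(x):=\#\{g\in G:\ |g|\le x\}=x^{\delta}+O(x^{\eta})$ as $x\to\infty$. Fix constants $a,b,C>0$ and $\epsilon>0$. For $k\in G$ write $K:=|k|$. Consider the elements $k\in G$ with $K\ge 2$ for which there exist positive integers $\beta,\gamma,\iota$ such that (1) $\beta\le C\,K\log^{a}K$ and $\iota\le C\log^{b}K$; (2) if $\delta>1$, additionally $|\beta-mK|\le K^{1-\epsilon}$ for some integer $m$; (3) $k$ is a $P(1,\beta,\gamma,\iota)$-integer. Then there are only finitely many such $k\in G$.
   Context: An arithmetical semigroup (in the sense of Knopfmacher) is a commutative semigroup $G$ with identity $1$ containing a countable subset of "primes" such that every element other than $1$ factors uniquely (up to order) as a finite product of primes, together with a real-valued norm $|\cdot|$ satisfying $|1|=1$, $|p|>1$ for every prime $p$, $|gh|=|g||h|$ for all $g,h\in G$, and such that $\#\{g\in G:|g|\le x\}$ is finite for every $x>0$. Here the norm takes positive integer values. For integers $\alpha,\beta,\gamma,\iota>0$ and $k\in G$ with $K=|k|$, let $M$ be the set of primes $p$ of $G$ with $\alpha\le|p|\le\beta$. Then $k$ is called a $P(\alpha,\beta,\gamma,\iota)$-integer if for every residue class $r$ modulo $K$ with $\gcd(r,K)=1$, at least $\gamma$ elements $p\in M$ satisfy $|p|\equiv r \pmod K$, and $|M|=\gamma\varphi(K)+\iota$, where $\varphi$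 is Euler's totient function. *)

theory Defs
  imports
    Complex_Main
    "HOL-Library.Multiset"
    "HOL-Library.Countable_Set"
    "HOL-Library.Landau_Symbols"
    "HOL-Number_Theory.Number_Theory"
begin

(* The ambient type is the semigroup G itself. A multiset of primes is a factorization up to
   order; for g = 1 uniqueness of the empty factorization follows from the norm axioms. *)
locale arithmetical_semigroup =
  fixes P :: "'a::comm_monoid_mult set"
    and N :: "'a \<Rightarrow> real"
  assumes countable_primes: "countable P"
    and unique_factorization:
      "g \<noteq> 1 \<Longrightarrow> \<exists>!A. set_mset A \<subseteq> P \<and> prod_mset A = g"
    and norm_one: "N 1 = 1"
    and norm_prime: "p \<in> P \<Longrightarrow> N p > 1"
    and norm_mult: "N (g * h) = N g * N h"
    and finite_norm_le: "x > 0 \<Longrightarrow> finite {g. N g \<le> x}"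

definition count_upto :: "('a \<Rightarrow> real) \<Rightarrow> real \<Rightarrow> nat" where
  "count_upto N x = card {g. N g \<le> x}"

(* The leading coefficient is 1, not an arbitrary positive constant. *)
definition axiom_A :: "('a \<Rightarrow> real) \<Rightarrow> real \<Rightarrow> bool" where
  "axiom_A N \<delta> \<longleftrightarrow>
     (\<exists>\<eta>. 0 \<le> \<eta> \<and> \<eta> < \<delta> \<and>
        (\<lambda>x. real (count_upto N x) - x powr \<delta>) \<in> O[at_top](\<lambda>x. x powr \<eta>))"

definition primes_between :: "'a set \<Rightarrow> ('a \<Rightarrow> nat) \<Rightarrow> nat \<Rightarrow> nat \<Rightarrow> 'a set" where
  "primes_between P N \<alpha> \<beta> = {p \<in> P. \<alpha> \<le> N p \<and> N p \<le> \<beta>}"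

definition P_integer ::
    "'a set \<Rightarrow> ('a \<Rightarrow> nat) \<Rightarrow> nat \<Rightarrow> nat \<Rightarrow> nat \<Rightarrow> nat \<Rightarrow> 'a \<Rightarrow> bool" where
  "P_integer P N \<alpha> \<beta> \<gamma> \<iota> k \<longleftrightarrow>
     (\<forall>r. coprime r (N k) \<longrightarrow>
        \<gamma> \<le> card {p \<in> primes_between P N \<alpha> \<beta>. [N p = r] (mod N k)}) \<and>
     card (primes_between P N \<alpha> \<beta>) = \<gamma> * totient (N k) + \<iota>"

end

(* For K >= 3 the map r -> K - r exchanges the reduced residues below K/2 with those above K/2.
   So if k is a P(1,beta,gamma,iota)-integer, the numbers of primes p with |p| <= beta whose
   residues modulo K lie in the lower and in the upper half differ by at most iota, a power of log K.
   On the other hand the primes of norm about x have density x^(delta-1)/log x.  For delta <= 1 it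
   decreases, so in every block [jK,(j+1)K] the lower half gets more primes, and the block j = 0
   alone contributes an excess of order K^delta/log^2 K; for delta > 1 it is eventually increasing
   and the upper half gains K^delta/log K.  As there are only O(log^a K) blocks, a prime number theorem with error
   O(x^delta/log^j x) for every j makes this rigorous; for delta > 1 a block cut in the middle would
   spoil the sign, which is why beta has to be close to a multiple of K.

   The prime number theorem: axiom A continues the Dirichlet series Z(s) of G to the left of
   Re s = delta, apart from the pole at delta, with |Z(s)| = O(|t|^kappa) near that line for every
   kappa > 0.  The inequality 3 + 4 cos + cos 2 >= 0 turns this into |Z(s)| >> |t|^(-7 kappa) in the
   region Re s >= delta - c |t|^(-8 kappa), so by Cauchy's inequality the k-th derivative of
   Z'/Z + zeta(s-delta+1) is O(|t|^(1/2)) on the right of the line.  A Fourier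
   transform against a trapezoid then bounds the sums of (Lambda(n) - n^(delta-1)) n^(-delta) log^k n;
   removing the weight log^k n by partial summation gives the saving, since k is arbitrary. *)

theory Submission
  imports Defs "HOL-Complex_Analysis.Complex_Analysis" "HOL-Real_Asymp.Real_Asymp"
begin

text \<open>Axiom A says nothing about the norms of primes in a residue class modulo K, so no single
  class can be controlled. Within a block, however, each half of the residues is an interval of
  integers, and there the prime number theorem alone decides. Its error is paid once per block,
  which costs log^a K, and must still stay below K^\<delta>/log^2 K; hence the arbitrary power of
  the logarithm. No zero-free region of fixed quality is needed, because \<kappa> may depend on the
  order k of the derivative: with \<kappa> = 1/(16(k+1)) the k+1 losses of t^(8\<kappa>) amount to
  t^(1/2) for every k, and the kernel, which decays like 1/t^2, makes the integral converge. A
  trapezoid with a slope of length h costs 1/h in the transform and h log^k N in passing to a sharp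
  cut. The choice k = 2j, h = log^(-j) N balances the two and saves a factor log^j N over the
  trivial bound log^(2j+1) N.\<close>

section \<open>Dirichlet series\<close>

(* dpow s x is x^(-s) for x > 0.  As ln 0 = 0, dpow s 0 = 1, so Dirichlet series need a 0 = 0. *)
definition dpow :: "complex \<Rightarrow> real \<Rightarrow> complex" where
  "dpow s x = exp (- s * of_real (ln x))"

lemma dpow_1 [simp]: "dpow s 1 = 1"
  by (simp add: dpow_def)

lemma norm_dpow: "x > 0 \<Longrightarrow> norm (dpow s x) = x powr (- Re s)"
  by (simp add: dpow_def powr_def)

lemma dpow_mult: "x > 0 \<Longrightarrow> y > 0 \<Longrightarrow> dpow s (x * y) = dpow s x * dpow s y"
  by (simp add: dpow_def ln_mult exp_add [symmetric] algebra_simps)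

lemma dpow_add: "dpow (s + t) x = dpow s x * dpow t x"
  by (simp add: dpow_def exp_add [symmetric] algebra_simps)

lemma dpow_of_real: "x > 0 \<Longrightarrow> dpow (of_real \<sigma>) x = of_real (x powr (- \<sigma>))"
  by (simp add: dpow_def powr_def exp_of_real [symmetric])

lemma Re_dpow: "x > 0 \<Longrightarrow> Re (dpow (Complex \<sigma> t) x) = x powr (- \<sigma>) * cos (t * ln x)"
  by (simp add: dpow_def powr_def Re_exp)

lemma dpow_has_derivative [derivative_intros]:
  "((\<lambda>s. dpow s x) has_field_derivative - of_real (ln x) * dpow s x) (at s within A)"
  unfolding dpow_def by (auto intro!: derivative_eq_intros)

lemma dpow_has_vector_derivative:
  assumes "x > 0"
  shows "((\<lambda>x. dpow s x) has_vector_derivative - s * dpow (s + 1) x) (at x within A)"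
proof -
  have e: "exp (- complex_of_real (ln x)) = 1 / of_real x"
    using assms by (metis exp_ln exp_minus exp_of_real inverse_eq_divide of_real_minus of_real_inverse)
  have "((\<lambda>x. complex_of_real (ln x)) has_vector_derivative of_real (1 / x)) (at x within A)"
    by (rule has_vector_derivative_of_real) (use assms in \<open>auto intro!: derivative_eq_intros\<close>)
  moreover have "((\<lambda>z. exp (- s * z)) has_field_derivative - s * exp (- s * of_real (ln x)))
      (at (of_real (ln x)) within (\<lambda>x. complex_of_real (ln x)) ` A)"
    by (auto intro!: derivative_eq_intros)
  ultimately have "((\<lambda>x. dpow s x) has_vector_derivative of_real (1 / x) * (- s * exp (- s * of_real (ln x))))
      (at x within A)"
    unfolding dpow_def by (rule field_vector_diff_chain_within[unfolded o_def])
  moreover have "dpow (s + 1) x = of_real (1 / x) * exp (- s * of_real (ln x))"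
    unfolding dpow_add using e by (simp add: dpow_def)
  ultimately show ?thesis by (simp add: mult_ac)
qed

definition dirichlet :: "(nat \<Rightarrow> real) \<Rightarrow> complex \<Rightarrow> complex" where
  "dirichlet a s = (\<Sum>n. of_real (a n) * dpow s (real n))"

(* Absolute convergence of the Dirichlet series of a in the open half-plane Re s > \<delta>. *)
definition abs_conv :: "(nat \<Rightarrow> real) \<Rightarrow> real \<Rightarrow> bool" where
  "abs_conv a \<delta> \<longleftrightarrow> a 0 = 0 \<and> (\<forall>\<sigma>>\<delta>. summable (\<lambda>n. \<bar>a n\<bar> * real n powr (- \<sigma>)))"

lemma abs_convD: "abs_conv a \<delta> \<Longrightarrow> \<sigma> > \<delta> \<Longrightarrow> summable (\<lambda>n. \<bar>a n\<bar> * real n powr (- \<sigma>))"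
  by (simp add: abs_conv_def)

text \<open>At n = 0 the two sides agree only because \<open>a 0 = 0\<close>:
  \<open>dpow s 0 = 1\<close>, whereas \<open>0 powr x = 0\<close>.\<close>

lemma norm_dirichlet_term:
  assumes "a 0 = 0"
  shows "norm (of_real (a n) * dpow s (real n)) = \<bar>a n\<bar> * real n powr (- Re s)"
  using assms by (cases "n = 0") (auto simp: norm_mult norm_dpow)

lemma dirichlet_summable_norm:
  assumes "abs_conv a \<delta>" "Re s > \<delta>"
  shows "summable (\<lambda>n. norm (of_real (a n) * dpow s (real n)))"
proof -
  have "a 0 = 0" "summable (\<lambda>n. \<bar>a n\<bar> * real n powr (- Re s))"
    using assms by (auto simp: abs_conv_def)
  thus ?thesis by (simp only: norm_dirichlet_term[of a])
qed

lemma dirichlet_sums: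
  assumes "abs_conv a \<delta>" "Re s > \<delta>"
  shows "(\<lambda>n. of_real (a n) * dpow s (real n)) sums dirichlet a s"
  unfolding dirichlet_def by (rule summable_sums[OF summable_norm_cancel[OF dirichlet_summable_norm[OF assms]]])

lemma norm_dirichlet_le:
  assumes "abs_conv a \<delta>" "\<sigma> > \<delta>" "Re s \<ge> \<sigma>"
  shows "norm (dirichlet a s) \<le> (\<Sum>n. \<bar>a n\<bar> * real n powr (- \<sigma>))"
proof -
  have a0: "a 0 = 0" using assms by (simp add: abs_conv_def)
  have "norm (dirichlet a s) \<le> (\<Sum>n. norm (of_real (a n) * dpow s (real n)))"
    unfolding dirichlet_def by (rule summable_norm[OF dirichlet_summable_norm[OF assms(1)]]) (use assms in auto)
  also have "\<dots> \<le> (\<Sum>n. \<bar>a n\<bar> * real n powr (- \<sigma>))"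
  proof (rule suminf_le)
    fix n
    have "real n powr (- Re s) \<le> real n powr (- \<sigma>)"
      using assms(3) by (cases "n = 0") (auto intro: powr_mono)
    thus "norm (of_real (a n) * dpow s (real n)) \<le> \<bar>a n\<bar> * real n powr (- \<sigma>)"
      unfolding norm_dirichlet_term[of a, OF a0] by (intro mult_left_mono) auto
  qed (use assms in \<open>auto intro!: dirichlet_summable_norm[OF assms(1)] simp: abs_convD[OF assms(1)]\<close>)
  finally show ?thesis .
qed

lemma abs_conv_mult_ln:
  assumes "abs_conv a \<delta>"
  shows "abs_conv (\<lambda>n. a n * ln (real n)) \<delta>"
  unfolding abs_conv_def
proof (intro conjI allI impI)
  show "a 0 * ln (real 0) = 0" by simp
  fix \<sigma> assume \<sigma>: "\<sigma> > \<delta>"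
  \<comment> \<open>Half of the distance from \<sigma> to \<delta> is spent on the logarithm, by ln
    n \<le> n^e / e.\<close>
  define e where "e = (\<sigma> - \<delta>) / 2"
  have e: "e > 0" "\<sigma> - e > \<delta>" using \<sigma> by (auto simp: e_def field_simps)
  show "summable (\<lambda>n. \<bar>a n * ln (real n)\<bar> * real n powr (- \<sigma>))"
  proof (rule summable_comparison_test')
    show "summable (\<lambda>n. (1/e) * (\<bar>a n\<bar> * real n powr (- (\<sigma> - e))))"
      by (intro summable_mult abs_convD[OF assms] e)
    fix n :: nat assume n: "n \<ge> 1"
    have "ln (real n) \<le> real n powr e / e" using n e by (intro ln_powr_bound) auto
    hence "\<bar>a n\<bar> * \<bar>ln (real n)\<bar> * real n powr (- \<sigma>) \<le> \<bar>a n\<bar> * (real n powr e / e) * real n powr (- \<sigma>)"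
      using n by (intro mult_right_mono mult_left_mono) auto
    also have "\<dots> = (1/e) * (\<bar>a n\<bar> * (real n powr e * real n powr (- \<sigma>)))" by simp
    also have "real n powr e * real n powr (- \<sigma>) = real n powr (- (\<sigma> - e))"
      by (subst powr_add[symmetric]) simp
    finally show "norm (\<bar>a n * ln (real n)\<bar> * real n powr (- \<sigma>)) \<le> (1/e) * (\<bar>a n\<bar> * real n powr (- (\<sigma> - e)))"
      by (simp add: abs_mult)
  qed
qed

lemma abs_conv_mult_ln_power:
  assumes "abs_conv a \<delta>"
  shows "abs_conv (\<lambda>n. a n * ln (real n) ^ k) \<delta>"
proof (induction k)
  case 0 thus ?case using assms by simp
next
  case (Suc k)
  from abs_conv_mult_ln[OF this] show ?case by (simp add: mult_ac)
qed

lemma abs_conv_mono: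
  assumes "abs_conv a \<delta>" "\<And>n. \<bar>b n\<bar> \<le> \<bar>a n\<bar>"
  shows "abs_conv b \<delta>"
  unfolding abs_conv_def
proof (intro conjI allI impI)
  show "b 0 = 0" using assms(2)[of 0] assms(1) by (simp add: abs_conv_def)
  fix \<sigma> assume "\<sigma> > \<delta>"
  thus "summable (\<lambda>n. \<bar>b n\<bar> * real n powr (- \<sigma>))"
    by (intro summable_comparison_test'[OF abs_convD[OF assms(1)]]) (auto intro!: mult_right_mono assms(2))
qed

lemma abs_conv_diff:
  assumes "abs_conv a \<delta>" "abs_conv b \<delta>"
  shows "abs_conv (\<lambda>n. a n - b n) \<delta>"
  unfolding abs_conv_def
proof (intro conjI allI impI)
  show "a 0 - b 0 = 0" using assms by (simp add: abs_conv_def)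
  fix \<sigma> assume \<sigma>: "\<sigma> > \<delta>"
  show "summable (\<lambda>n. \<bar>a n - b n\<bar> * real n powr (- \<sigma>))"
  proof (rule summable_comparison_test')
    show "summable (\<lambda>n. \<bar>a n\<bar> * real n powr (- \<sigma>) + \<bar>b n\<bar> * real n powr (- \<sigma>))"
      using assms \<sigma> by (intro summable_add abs_convD)
    show "norm (\<bar>a n - b n\<bar> * real n powr (- \<sigma>)) \<le> \<bar>a n\<bar> * real n powr (- \<sigma>) + \<bar>b n\<bar> * real n powr (- \<sigma>)"
      for n unfolding distrib_right[symmetric] by (auto intro!: mult_right_mono)
  qed
qed

lemma dirichlet_diff:
  assumes "abs_conv a \<delta>" "abs_conv b \<delta>" "Re s > \<delta>"
  shows "dirichlet (\<lambda>n. a n - b n) s = dirichlet a s - dirichlet b s"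
proof -
  have "(\<lambda>n. of_real (a n) * dpow s (real n) - of_real (b n) * dpow s (real n)) sums (dirichlet a s - dirichlet b s)"
    by (rule sums_diff[OF dirichlet_sums[OF assms(1,3)] dirichlet_sums[OF assms(2,3)]])
  hence "(\<lambda>n. of_real (a n - b n) * dpow s (real n)) sums (dirichlet a s - dirichlet b s)"
    by (simp only: of_real_diff left_diff_distrib)
  thus ?thesis unfolding dirichlet_def by (rule sums_unique[symmetric])
qed

lemma dirichlet_has_derivative:
  assumes a: "abs_conv a \<delta>" and s: "Re s > \<delta>"
  shows "(dirichlet a has_field_derivative - dirichlet (\<lambda>n. a n * ln (real n)) s) (at s)"
proof -
  \<comment> \<open>The line Re z = \<sigma> lies strictly between \<delta> and s; to the right of
    it the differentiated series converges uniformly.\<close>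
  define \<sigma> where "\<sigma> = (\<delta> + Re s) / 2"
  have \<sigma>: "\<sigma> > \<delta>" "Re s > \<sigma>" using s by (auto simp: \<sigma>_def field_simps)
  let ?S = "{z. Re z > \<sigma>}"
  let ?f = "\<lambda>n z. of_real (a n) * dpow z (real n)"
  let ?f' = "\<lambda>n z. - (of_real (a n * ln (real n)) * dpow z (real n))"
  have op: "open ?S" by (rule open_halfspace_Re_gt)
  have al: "abs_conv (\<lambda>n. a n * ln (real n)) \<delta>" by (rule abs_conv_mult_ln[OF a])
  have "((\<lambda>x. \<Sum>n. ?f n x) has_field_derivative (\<Sum>n. ?f' n s)) (at s)"
  proof (rule has_field_derivative_series'(2)[of ?S])
    show "convex ?S" by (rule convex_halfspace_Re_gt)
    show "(?f n has_field_derivative ?f' n z) (at z within ?S)" for n z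
      by (auto intro!: derivative_eq_intros)
    show "uniformly_convergent_on ?S (\<lambda>n x. \<Sum>i<n. ?f' i x)"
    proof (rule Weierstrass_m_test')
      show "summable (\<lambda>n. \<bar>a n * ln (real n)\<bar> * real n powr (- \<sigma>))" by (rule abs_convD[OF al \<sigma>(1)])
      fix n z assume z: "z \<in> ?S"
      have "real n powr (- Re z) \<le> real n powr (- \<sigma>)"
        using z by (cases "n = 0") (auto intro: powr_mono)
      hence "\<bar>a n * ln (real n)\<bar> * real n powr (- Re z) \<le> \<bar>a n * ln (real n)\<bar> * real n powr (- \<sigma>)"
        by (intro mult_left_mono) auto
      thus "norm (?f' n z) \<le> \<bar>a n * ln (real n)\<bar> * real n powr (- \<sigma>)"
        unfolding norm_minus_cancel by (subst norm_dirichlet_term[of "\<lambda>n. a n * ln (real n)"]) auto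
    qed
    show "s \<in> ?S" using \<sigma> by simp
    show "summable (\<lambda>n. ?f n s)" using dirichlet_sums[OF a s] by (simp add: sums_iff)
    show "s \<in> interior ?S" using \<sigma> op by (simp add: interior_open)
  qed
  moreover have "(\<Sum>n. ?f' n s) = - dirichlet (\<lambda>n. a n * ln (real n)) s"
    using dirichlet_sums[OF al s] by (simp add: sums_iff suminf_minus dirichlet_def)
  ultimately show ?thesis by (simp add: dirichlet_def[abs_def])
qed

lemma dirichlet_holomorphic:
  "abs_conv a \<delta> \<Longrightarrow> dirichlet a holomorphic_on {s. Re s > \<delta>}"
  by (auto simp: holomorphic_on_open open_halfspace_Re_gt intro: dirichlet_has_derivative)

lemma higher_deriv_dirichlet:
  assumes a: "abs_conv a \<delta>" and s: "Re s > \<delta>"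
  shows "(deriv ^^ k) (dirichlet a) s = (- 1) ^ k * dirichlet (\<lambda>n. a n * ln (real n) ^ k) s"
  using s
proof (induction k arbitrary: s)
  case 0 show ?case by simp
next
  case (Suc k)
  have ev: "\<forall>\<^sub>F z in nhds s. z \<in> {s. Re s > \<delta>}"
    by (rule eventually_nhds_in_open) (use Suc.prems in \<open>auto simp: open_halfspace_Re_gt\<close>)
  have "(deriv ^^ Suc k) (dirichlet a) s = deriv ((deriv ^^ k) (dirichlet a)) s" by simp
  also have "\<dots> = deriv (\<lambda>s. (- 1) ^ k * dirichlet (\<lambda>n. a n * ln (real n) ^ k) s) s"
    by (rule deriv_cong_ev[OF eventually_mono[OF ev]]) (auto simp: Suc.IH)
  also have "\<dots> = (- 1) ^ k * (- dirichlet (\<lambda>n. a n * ln (real n) ^ k * ln (real n)) s)"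
    by (intro DERIV_imp_deriv DERIV_cmult dirichlet_has_derivative[OF abs_conv_mult_ln_power[OF a] Suc.prems])
  finally show ?case by (simp add: mult_ac)
qed

section \<open>Analytic continuation and growth\<close>

(* c n stands for the number of elements of norm n; c = 1, \<delta> = 1, \<eta> = 0 gives the zeta function. *)
locale counting_seq =
  fixes c :: "nat \<Rightarrow> real" and \<delta> \<eta> C :: real
  assumes c_nonneg: "c n \<ge> 0" and c_0: "c 0 = 0"
    and eta_nonneg: "0 \<le> \<eta>" and eta_less: "\<eta> < \<delta>"
    and count_bound: "x \<ge> 1 \<Longrightarrow> \<bar>(\<Sum>m\<le>nat \<lfloor>x\<rfloor>. c m) - x powr \<delta>\<bar> \<le> C * x powr \<eta>"
begin

definition A :: "nat \<Rightarrow> real" where "A n = (\<Sum>m\<le>n. c m)"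

(* Y s = (s - \<delta>) Z s is free of the pole.  Abel summation writes Z and s / (s - \<delta>) as sums over n of
   s times the integrals of A(x) x^(-s-1) and x^(\<delta>-s-1) over [n, n+1]; y collects (s - \<delta>) times the
   difference, which axiom A makes small. *)
definition y :: "nat \<Rightarrow> complex \<Rightarrow> complex" where
  "y n s = (s - \<delta>) * A n * (dpow s n - dpow s (real n + 1))
         - s * (dpow (s - \<delta>) n - dpow (s - \<delta>) (real n + 1))"

definition Y :: "complex \<Rightarrow> complex" where
  "Y s = s + (\<Sum>n. y (Suc n) s)"

definition Z :: "complex \<Rightarrow> complex" where
  "Z s = Y s / (s - \<delta>)"

lemma delta_pos: "\<delta> > 0" using eta_nonneg eta_less by simp

lemma C_nonneg: "C \<ge> 0"
  using count_bound[of 1] by simp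

lemma A_bound: "n \<ge> 1 \<Longrightarrow> A n \<le> (1 + C) * real n powr \<delta>" and A_nonneg: "A n \<ge> 0"
proof -
  show "A n \<ge> 0" unfolding A_def by (intro sum_nonneg c_nonneg)
  assume n: "n \<ge> 1"
  have "real n powr \<eta> \<le> real n powr \<delta>" using n eta_less by (intro powr_mono) auto
  hence "C * real n powr \<eta> \<le> C * real n powr \<delta>" by (intro mult_left_mono C_nonneg)
  with count_bound[of n] n show "A n \<le> (1 + C) * real n powr \<delta>"
    by (simp add: A_def algebra_simps)
qed

text \<open>On [n, n + 1) the counting function A(x) is the constant \<open>A n\<close>, so
  \<open>y n s\<close> is minus the increment of a function whose derivative -s (s - \<delta>)
  x^(-s-1) (A(x) - x^\<delta>) contains exactly the error term of axiom A. The mean value inequality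
  gives the bound.\<close>

lemma norm_y:
  assumes n: "n \<ge> 1" and s: "Re s > \<eta> - 1"
  shows "norm (y n s) \<le> norm s * norm (s - \<delta>) * C * real n powr (\<eta> - Re s - 1)"
proof -
  define f where "f = (\<lambda>x. (s - \<delta>) * A n * dpow s x - s * dpow (s - \<delta>) x)"
  define f' where "f' = (\<lambda>x. (s - \<delta>) * A n * (- s * dpow (s + 1) x) - s * (- (s - \<delta>) * dpow (s - \<delta> + 1) x))"
  have der: "(f has_vector_derivative f' x) (at x within S)" if "x > 0" for x S
    unfolding f_def f'_def
    by (intro has_vector_derivative_diff has_vector_derivative_mult_right dpow_has_vector_derivative that)
  have "\<exists>x\<in>{real n<..<real n + 1}. norm (f (real n + 1) - f (real n)) \<le> norm (((real n + 1) - real n) *\<^sub>R f' x)"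
  proof (rule mvt_general)
    show "continuous_on {real n..real n + 1} f"
      using n by (intro continuous_on_vector_derivative[of _ f f'] der) auto
    show "(f has_derivative (\<lambda>z. z *\<^sub>R f' x)) (at x)" if "real n < x" "x < real n + 1" for x
      using der[of x UNIV] that by (auto simp: has_vector_derivative_def)
  qed auto
  then obtain x where x: "real n < x" "x < real n + 1" "norm (f (real n + 1) - f (real n)) \<le> norm (f' x)"
    by auto
  have x0: "x > 0" using x by linarith
  have "dpow (s - \<delta> + 1) x = dpow (s + 1) x * (x powr \<delta>)"
    using dpow_add[of "s + 1" "of_real (- \<delta>)" x] dpow_of_real[OF x0, of "- \<delta>"] by (simp add: algebra_simps)
  hence f'_eq: "f' x = - s * (s - \<delta>) * dpow (s + 1) x * of_real (A n - x powr \<delta>)"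
    by (simp add: f'_def algebra_simps)
  have fl: "nat \<lfloor>x\<rfloor> = n" using x by linarith
  have "\<bar>A n - x powr \<delta>\<bar> \<le> C * x powr \<eta>" using count_bound[of x] x n by (simp add: fl A_def)
  hence "norm (f' x) \<le> norm s * norm (s - \<delta>) * x powr (- Re s - 1) * (C * x powr \<eta>)"
    unfolding f'_eq norm_mult norm_minus_cancel norm_of_real
    by (subst norm_dpow[OF x0]) (auto intro!: mult_left_mono)
  also have "\<dots> = norm s * norm (s - \<delta>) * C * (x powr (- Re s - 1) * x powr \<eta>)" by simp
  also have "x powr (- Re s - 1) * x powr \<eta> = x powr (\<eta> - Re s - 1)"
    by (subst powr_add[symmetric]) (simp add: algebra_simps)
  also have "norm s * norm (s - \<delta>) * C * x powr (\<eta> - Re s - 1) \<le> norm s * norm (s - \<delta>) * C * real n powr (\<eta> - Re s - 1)"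
    using x n s C_nonneg by (intro mult_left_mono powr_mono2') auto
  finally have "norm (f (real n + 1) - f (real n)) \<le> norm s * norm (s - \<delta>) * C * real n powr (\<eta> - Re s - 1)"
    using x by linarith
  moreover have "y n s = - (f (real n + 1) - f (real n))"
    by (simp add: y_def f_def algebra_simps)
  ultimately show ?thesis by (simp only: norm_minus_cancel)
qed

lemma summable_Suc_powr: "a > 1 \<Longrightarrow> summable (\<lambda>n. real (Suc n) powr (- a))"
  using summable_real_powr_iff[of "- a"] by (subst summable_Suc_iff) auto

lemma norm_y_summable:
  assumes s: "Re s > \<eta>"
  shows "summable (\<lambda>n. norm (y (Suc n) s))"
proof (rule summable_comparison_test')
  show "summable (\<lambda>n. norm s * norm (s - \<delta>) * C * real (Suc n) powr (- (1 + Re s - \<eta>)))"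
    by (intro summable_mult summable_Suc_powr) (use s in auto)
  show "norm (norm (y (Suc n) s)) \<le> norm s * norm (s - \<delta>) * C * real (Suc n) powr (- (1 + Re s - \<eta>))" for n
    using norm_y[of "Suc n" s] s by (simp add: algebra_simps)
qed

lemma Y_sums:
  assumes s: "Re s > \<eta>"
  shows "(\<lambda>n. y (Suc n) s) sums (Y s - s)"
  using summable_sums[OF summable_norm_cancel[OF norm_y_summable[OF s]]] by (simp add: Y_def)

lemma Y_holomorphic: "Y holomorphic_on {s. Re s > \<eta>}"
proof (rule holomorphic_uniform_sequence)
  show "open {s. Re s > \<eta>}" by (rule open_halfspace_Re_gt)
  show "(\<lambda>s. s + (\<Sum>n<N. y (Suc n) s)) holomorphic_on {s. Re s > \<eta>}" for N
    unfolding y_def dpow_def by (intro holomorphic_intros)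
  fix w assume "w \<in> {s. Re s > \<eta>}"
  hence w: "Re w > \<eta>" by simp
  define d where "d = (Re w - \<eta>) / 2"
  have d: "d > 0" using w by (simp add: d_def)
  have Re_ge: "Re z \<ge> \<eta> + d" if "z \<in> cball w d" for z
  proof -
    have "\<bar>Re (w - z)\<bar> \<le> norm (w - z)" by (rule abs_Re_le_cmod)
    also have "\<dots> \<le> d" using that by (simp add: dist_norm)
    finally have "Re z \<ge> Re w - d" by simp
    moreover have "Re w = \<eta> + 2 * d" by (simp add: d_def field_simps)
    ultimately show ?thesis by simp
  qed
  have "uniform_limit (cball w d) (\<lambda>N s. \<Sum>n<N. y (Suc n) s) (\<lambda>s. \<Sum>n. y (Suc n) s) sequentially"
  proof (rule Weierstrass_m_test)
    show "summable (\<lambda>n. (norm w + d) * (norm w + d + \<delta>) * C * real (Suc n) powr (- (1 + d)))"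
      by (intro summable_mult summable_Suc_powr) (use d in auto)
    fix n z assume z: "z \<in> cball w d"
    have nz: "norm z \<le> norm w + d"
      using z norm_triangle_ineq2[of z w] by (simp add: dist_norm norm_minus_commute)
    have nz2: "norm (z - \<delta>) \<le> norm w + d + \<delta>"
      using nz norm_triangle_ineq4[of z "of_real \<delta>"] delta_pos by simp
    have "norm (y (Suc n) z) \<le> norm z * norm (z - \<delta>) * C * real (Suc n) powr (\<eta> - Re z - 1)"
      using Re_ge[OF z] d by (intro norm_y) auto
    also have "\<dots> \<le> (norm w + d) * (norm w + d + \<delta>) * C * real (Suc n) powr (- (1 + d))"
      using nz nz2 Re_ge[OF z] d C_nonneg delta_pos
      by (intro mult_mono powr_mono mult_nonneg_nonneg add_nonneg_nonneg) auto
    finally show "norm (y (Suc n) z) \<le> (norm w + d) * (norm w + d + \<delta>) * C * real (Suc n) powr (- (1 + d))" .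
  qed
  hence "uniform_limit (cball w d) (\<lambda>N s. s + (\<Sum>n<N. y (Suc n) s)) Y sequentially"
    unfolding Y_def by (intro uniform_limit_add uniform_limit_const)
  moreover have "cball w d \<subseteq> {s. Re s > \<eta>}" using Re_ge d by force
  ultimately show "\<exists>d>0. cball w d \<subseteq> {s. Re s > \<eta>} \<and>
      uniform_limit (cball w d) (\<lambda>N s. s + (\<Sum>n<N. y (Suc n) s)) Y sequentially"
    using d by blast
qed

text \<open>Every \<open>y n\<close> vanishes at \<delta>. So Z has a simple pole there with residue
  \<delta>, and Y does not vanish at that point.\<close>

lemma Y_delta: "Y \<delta> = \<delta>"
  by (simp add: Y_def y_def dpow_def)

lemma Z_holomorphic: "Z holomorphic_on {s. Re s > \<eta>} - {of_real \<delta>}"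
  unfolding Z_def[abs_def] by (intro holomorphic_intros holomorphic_on_subset[OF Y_holomorphic]) auto

text \<open>Abel summation with remainder. Letting M tend to infinity gives the Dirichlet series;
  stopping at M gives the approximate formula behind \<open>Z_growth_aux\<close>.\<close>

lemma sum_y:
  fixes s :: complex
  shows "(\<Sum>n<M. y (Suc n) s) = (s - \<delta>) * ((\<Sum>n\<le>Suc M. c n * dpow s n) - A (Suc M) * dpow s (Suc M))
     - s * (1 - dpow (s - \<delta>) (Suc M))"
proof (induction M)
  case 0
  show ?case by (simp add: A_def c_0 )
next
  case (Suc M)
  define u v w z where "u = dpow s (Suc M)" and "v = dpow s (Suc (Suc M))"
    and "w = dpow (s - \<delta>) (Suc M)" and "z = dpow (s - \<delta>) (Suc (Suc M))"
  have "of_real (A (Suc (Suc M))) = complex_of_real (A (Suc M)) + of_real (c (Suc (Suc M)))"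
    by (simp add: A_def)
  moreover have "y (Suc M) s = (s - \<delta>) * A (Suc M) * (u - v) - s * (w - z)"
    by (simp add: y_def u_def v_def w_def z_def add_ac)
  moreover have "(\<Sum>n\<le>Suc (Suc M). c n * dpow s n) = (\<Sum>n\<le>Suc M. c n * dpow s n) + c (Suc (Suc M)) * v"
    by (simp add: v_def)
  ultimately show ?case
    using Suc.IH unfolding u_def[symmetric] v_def[symmetric] w_def[symmetric] z_def[symmetric] sum.lessThan_Suc
    by (simp only:) (simp only: ring_distribs mult_ac, simp)
qed

lemma powr_neg_tendsto_0: "a > 0 \<Longrightarrow> (\<lambda>M. real (Suc M) powr (- a)) \<longlonglongrightarrow> 0"
  by real_asymp

lemma dpow_tendsto_0:
  assumes "Re w > 0" shows "(\<lambda>M. dpow w (Suc M)) \<longlonglongrightarrow> 0"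
proof (rule tendsto_norm_zero_cancel)
  have "norm (dpow w (Suc M)) = real (Suc M) powr (- Re w)" for M by (rule norm_dpow) simp
  thus "(\<lambda>M. norm (dpow w (Suc M))) \<longlonglongrightarrow> 0" using powr_neg_tendsto_0[OF assms] by simp
qed

text \<open>To the right of \<delta> both boundary terms of \<open>sum_y\<close> tend to 0, the one
  with A because A(n) = O(n^\<delta>).\<close>

lemma Z_sums:
  assumes s: "Re s > \<delta>"
  shows "(\<lambda>n. c n * dpow s n) sums Z s"
proof -
  have s\<delta>: "s \<noteq> \<delta>" using s by auto
  have t1: "(\<lambda>M. dpow (s - \<delta>) (Suc M)) \<longlonglongrightarrow> 0" by (rule dpow_tendsto_0) (use s in auto)
  have t2: "(\<lambda>M. A (Suc M) * dpow s (Suc M)) \<longlonglongrightarrow> 0"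
  proof (rule Lim_null_comparison)
    show "\<forall>\<^sub>F M in sequentially. norm (A (Suc M) * dpow s (Suc M)) \<le> (1 + C) * real (Suc M) powr (- (Re s - \<delta>))"
    proof (rule always_eventually, rule allI)
      fix M
      have "norm (A (Suc M) * dpow s (Suc M)) = A (Suc M) * real (Suc M) powr (- Re s)"
        using A_nonneg[of "Suc M"] by (simp add: norm_mult norm_dpow)
      also have "\<dots> \<le> (1 + C) * real (Suc M) powr \<delta> * real (Suc M) powr (- Re s)"
        using A_bound[of "Suc M"] by (intro mult_right_mono) auto
      also have "\<dots> = (1 + C) * (real (Suc M) powr \<delta> * real (Suc M) powr (- Re s))" by simp
      also have "real (Suc M) powr \<delta> * real (Suc M) powr (- Re s) = real (Suc M) powr (- (Re s - \<delta>))"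
        by (subst powr_add[symmetric]) simp
      finally show "norm (A (Suc M) * dpow s (Suc M)) \<le> (1 + C) * real (Suc M) powr (- (Re s - \<delta>))" .
    qed
    show "(\<lambda>M. (1 + C) * real (Suc M) powr (- (Re s - \<delta>))) \<longlonglongrightarrow> 0"
      by (rule tendsto_mult_right_zero, rule powr_neg_tendsto_0) (use s in auto)
  qed
  have t3: "(\<lambda>M. \<Sum>n<M. y (Suc n) s) \<longlonglongrightarrow> Y s - s"
    using Y_sums[of s] s eta_less by (simp add: sums_def)
  have eq: "(\<Sum>n\<le>Suc M. c n * dpow s n) = ((\<Sum>n<M. y (Suc n) s) + s * (1 - dpow (s - \<delta>) (Suc M))) / (s - \<delta>)
      + A (Suc M) * dpow s (Suc M)" for M
  proof -
    have "X = (T + b) / (s - \<delta>) + a" if "T = (s - \<delta>) * (X - a) - b" for X T a b :: complex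
      using s\<delta> that by (simp add: field_simps)
    from this[OF sum_y] show ?thesis .
  qed
  have "(\<lambda>M. \<Sum>n\<le>Suc M. c n * dpow s n) \<longlonglongrightarrow> ((Y s - s) + s * (1 - 0)) / (s - \<delta>) + 0"
    unfolding eq by (intro tendsto_intros t1 t2 t3) (use s\<delta> in auto)
  hence "(\<lambda>M. \<Sum>n\<le>Suc M. c n * dpow s n) \<longlonglongrightarrow> Z s" by (simp add: Z_def)
  thus ?thesis unfolding sums_def_le by (rule LIMSEQ_imp_Suc)
qed

text \<open>The coefficients are nonnegative, so convergence at real \<sigma> is already absolute
  convergence.\<close>

lemma abs_conv_c: "abs_conv c \<delta>"
  unfolding abs_conv_def
proof (intro conjI allI impI c_0)
  fix \<sigma> assume \<sigma>: "\<sigma> > \<delta>"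
  have "(\<lambda>n. c n * dpow (of_real \<sigma>) n) sums Z (of_real \<sigma>)" by (rule Z_sums) (use \<sigma> in auto)
  hence "(\<lambda>n. Re (c n * dpow (of_real \<sigma>) n)) sums Re (Z (of_real \<sigma>))" by (rule sums_Re)
  moreover have "Re (c n * dpow (of_real \<sigma>) n) = \<bar>c n\<bar> * real n powr (- \<sigma>)" for n
    using c_nonneg[of n] c_0 by (cases "n = 0") (auto simp: dpow_of_real)
  ultimately show "summable (\<lambda>n. \<bar>c n\<bar> * real n powr (- \<sigma>))" by (simp add: sums_iff)
qed

lemma Z_eq_dirichlet: "Re s > \<delta> \<Longrightarrow> Z s = dirichlet c s"
  using sums_unique2[OF Z_sums dirichlet_sums[OF abs_conv_c]] by blast

text \<open>Z is approximated by its partial sum up to X, a fixed power of t. The partial sum and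
  the boundary terms are O(X^(2e)), which is O(t^\<kappa>) if e is small; the tail of the
  \<open>y\<close> converges left of \<delta> and is O(1) after division by s - \<delta>.\<close>

lemma Z_growth_aux:
  assumes "\<kappa> > 0"
  shows "\<exists>e B. e > 0 \<and> e \<le> (\<delta> - \<eta>) / 2 \<and> B > 0 \<and> (\<forall>s. Im s \<ge> 1 \<longrightarrow> Re s \<ge> \<delta> - e \<longrightarrow> Re s \<le> \<delta> + 1 \<longrightarrow>
    norm (Z s) \<le> B * Im s powr \<kappa>)"
proof -
  define \<theta> where "\<theta> = (\<delta> - \<eta>) / 2"
  have \<theta>: "\<theta> > 0" using eta_less by (simp add: \<theta>_def)
  \<comment> \<open>X will have size t^(2/\<theta>), so X^(2e) is of order t^(4e/\<theta>); this
    must not exceed t^\<kappa>.\<close>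
  define e where "e = min \<theta> (\<kappa> * \<theta> / 4)"
  have e: "e > 0" "e \<le> \<theta>" "4 * e / \<theta> \<le> \<kappa>" using \<theta> assms by (auto simp: e_def min_def field_simps)
  define S1 where "S1 = (\<Sum>n. \<bar>c n\<bar> * real n powr (- (\<delta> + e)))"
  define S2 where "S2 = (\<Sum>n. real (Suc n) powr (- (1 + \<theta> / 2)))"
  have sm1: "summable (\<lambda>n. \<bar>c n\<bar> * real n powr (- (\<delta> + e)))" by (rule abs_convD[OF abs_conv_c]) (use e in auto)
  have sm2: "summable (\<lambda>n. real (Suc n) powr (- (1 + \<theta> / 2)))" by (rule summable_Suc_powr) (use \<theta> in auto)
  have S1: "S1 \<ge> 0" unfolding S1_def by (rule suminf_nonneg[OF sm1]) auto
  have S2: "S2 \<ge> 0" unfolding S2_def by (rule suminf_nonneg[OF sm2]) auto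
  define B where "B = 3 powr (2 * e) * (S1 + (1 + C) + (1 + \<delta>)) + C * (\<delta> + 2) * S2"
  have "S1 + (1 + C) + (1 + \<delta>) > 0" using S1 C_nonneg delta_pos by linarith
  hence "3 powr (2 * e) * (S1 + (1 + C) + (1 + \<delta>)) > 0" by (intro mult_pos_pos) auto
  moreover have "C * (\<delta> + 2) * S2 \<ge> 0" using S2 C_nonneg delta_pos by simp
  ultimately have B: "B > 0" unfolding B_def by linarith
  have "norm (Z s) \<le> B * Im s powr \<kappa>" if s: "Im s \<ge> 1" "Re s \<ge> \<delta> - e" "Re s \<le> \<delta> + 1" for s
  proof -
    define t where "t = Im s"
    have t: "t \<ge> 1" using s by (simp add: t_def)
    \<comment> \<open>Cut at X of size t^(2/\<theta>): beyond it k^(-\<theta>/2) \<le> 1/t, which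
      makes up for the factor |s| in the bound for the tail.\<close>
    define M where "M = nat \<lceil>t powr (2 / \<theta>)\<rceil>"
    define X where "X = real (Suc M)"
    have tp: "t powr (2 / \<theta>) \<ge> 1" using t \<theta> by (intro ge_one_powr_ge_zero) auto
    have X: "X \<ge> t powr (2 / \<theta>)" "X \<le> 3 * t powr (2 / \<theta>)" "X \<ge> 1"
      using tp unfolding X_def M_def by linarith+
    have Xe: "X powr (2 * e) \<le> 3 powr (2 * e) * t powr \<kappa>"
    proof -
      have "X powr (2 * e) \<le> (3 * t powr (2 / \<theta>)) powr (2 * e)"
        using X e by (intro powr_mono2) auto
      also have "\<dots> = 3 powr (2 * e) * t powr (4 * e / \<theta>)"
        using t by (simp add: powr_mult powr_powr)
      also have "\<dots> \<le> 3 powr (2 * e) * t powr \<kappa>"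
        using e t by (intro mult_left_mono powr_mono) auto
      finally show ?thesis .
    qed
    have s_eta: "Re s > \<eta>" "Re s - \<eta> \<ge> \<theta>"
      using s e \<theta> by (auto simp: \<theta>_def field_simps)
    have sd: "norm (s - \<delta>) \<ge> 1" using abs_Im_le_cmod[of "s - \<delta>"] s by simp
    hence sd0: "s - \<delta> \<noteq> 0" by auto
    have T1: "norm (\<Sum>n\<le>Suc M. c n * dpow s n) \<le> X powr (2 * e) * S1"
    proof -
      have "norm (\<Sum>n\<le>Suc M. c n * dpow s n) \<le> (\<Sum>n\<le>Suc M. norm (c n * dpow s n))" by (rule norm_sum)
      also have "\<dots> \<le> (\<Sum>n\<le>Suc M. X powr (2 * e) * (\<bar>c n\<bar> * real n powr (- (\<delta> + e))))"
      proof (rule sum_mono)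
        fix n assume n: "n \<in> {..Suc M}"
        show "norm (c n * dpow s n) \<le> X powr (2 * e) * (\<bar>c n\<bar> * real n powr (- (\<delta> + e)))"
        proof (cases "n = 0")
          case True thus ?thesis by (simp add: c_0)
        next
          case False
          \<comment> \<open>Rankin's trick: for n \<le> X the exponent is moved to \<delta> + e,
            where the series converges absolutely, at the cost of a factor X^(2e).\<close>
          have "real n powr (- Re s) = real n powr (\<delta> + e - Re s) * real n powr (- (\<delta> + e))"
            by (subst powr_add[symmetric]) simp
          also have "real n powr (\<delta> + e - Re s) \<le> real n powr (2 * e)"
            using False s by (intro powr_mono) auto
          also have "\<dots> \<le> X powr (2 * e)" using n e unfolding X_def by (intro powr_mono2) auto
          finally have "real n powr (- Re s) \<le> X powr (2 * e) * real n powr (- (\<delta> + e))"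
            by (simp add: mult_right_mono)
          hence "\<bar>c n\<bar> * real n powr (- Re s) \<le> \<bar>c n\<bar> * (X powr (2 * e) * real n powr (- (\<delta> + e)))"
            by (intro mult_left_mono) auto
          moreover have "norm (c n * dpow s n) = \<bar>c n\<bar> * real n powr (- Re s)"
            using norm_dirichlet_term[of c, OF c_0] .
          ultimately show ?thesis by (simp only: mult_ac)
        qed
      qed
      also have "\<dots> = X powr (2 * e) * (\<Sum>n\<le>Suc M. \<bar>c n\<bar> * real n powr (- (\<delta> + e)))"
        by (simp only: sum_distrib_left)
      also have "\<dots> \<le> X powr (2 * e) * S1"
        unfolding S1_def by (intro mult_left_mono sum_le_suminf sm1) auto
      finally show ?thesis .
    qed
    have Xd: "X powr (\<delta> - Re s) \<le> X powr (2 * e)"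
      using X s e by (intro powr_mono) auto
    have T2: "norm (A (Suc M) * dpow s X) \<le> X powr (2 * e) * (1 + C)"
    proof -
      have "norm (A (Suc M) * dpow s X) = A (Suc M) * X powr (- Re s)"
        using A_nonneg[of "Suc M"] X by (simp add: norm_mult norm_dpow)
      also have "\<dots> \<le> (1 + C) * X powr \<delta> * X powr (- Re s)"
        using A_bound[of "Suc M"] unfolding X_def by (intro mult_right_mono) auto
      also have "\<dots> = (1 + C) * X powr (\<delta> - Re s)"
        by (simp add: powr_diff powr_minus divide_inverse)
      also have "\<dots> \<le> (1 + C) * X powr (2 * e)" using C_nonneg Xd by (intro mult_left_mono) auto
      finally show ?thesis by (simp add: mult_ac)
    qed
    have ns: "norm s \<le> (1 + \<delta>) * norm (s - \<delta>)"
    proof -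
      have "norm s \<le> norm (s - \<delta>) + norm (of_real \<delta> :: complex)"
        using norm_triangle_ineq[of "s - \<delta>" "of_real \<delta>"] by simp
      also have "\<dots> \<le> norm (s - \<delta>) + \<delta> * norm (s - \<delta>)"
        using sd delta_pos by (auto intro: mult_left_mono)
      finally show ?thesis by (simp add: algebra_simps)
    qed
    have T3: "norm (s * dpow (s - \<delta>) X / (s - \<delta>)) \<le> X powr (2 * e) * (1 + \<delta>)"
    proof -
      have "norm (s * dpow (s - \<delta>) X / (s - \<delta>)) = norm s * X powr (\<delta> - Re s) / norm (s - \<delta>)"
        using X by (simp add: norm_mult norm_divide norm_dpow)
      also have "\<dots> \<le> ((1 + \<delta>) * norm (s - \<delta>)) * X powr (2 * e) / norm (s - \<delta>)"
        using ns Xd delta_pos by (intro divide_right_mono mult_mono) auto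
      also have "\<dots> = X powr (2 * e) * (1 + \<delta>)" using sd0 by (simp add: field_simps)
      finally show ?thesis .
    qed
    have T4: "norm (\<Sum>n. y (Suc (n + M)) s) \<le> norm (s - \<delta>) * (C * (\<delta> + 2) * S2)"
    proof -
      have sm: "summable (\<lambda>n. norm (y (Suc (n + M)) s))"
        using norm_y_summable[OF s_eta(1)] by (subst summable_iff_shift)
      have "norm (\<Sum>n. y (Suc (n + M)) s) \<le> (\<Sum>n. norm (y (Suc (n + M)) s))" by (rule summable_norm[OF sm])
      also have "\<dots> \<le> (\<Sum>n. norm s * norm (s - \<delta>) * C * inverse t * real (Suc (n + M)) powr (- (1 + \<theta> / 2)))"
      proof (rule suminf_le[OF _ sm])
        show "summable (\<lambda>n. norm s * norm (s - \<delta>) * C * inverse t * real (Suc (n + M)) powr (- (1 + \<theta> / 2)))"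
          using sm2 by (intro summable_mult) (subst summable_iff_shift)
        fix n
        let ?k = "real (Suc (n + M))"
        have k: "?k \<ge> X" unfolding X_def by simp
        have "?k powr (\<eta> - Re s - 1) \<le> ?k powr (- (1 + \<theta>))"
          using s_eta by (intro powr_mono) auto
        also have "\<dots> = ?k powr (- \<theta> / 2) * ?k powr (- (1 + \<theta> / 2))" by (subst powr_add[symmetric]) (simp add: algebra_simps)
        also have "?k powr (- \<theta> / 2) \<le> X powr (- \<theta> / 2)"
          using k X \<theta> by (intro powr_mono2') auto
        also have "X powr (- \<theta> / 2) \<le> (t powr (2 / \<theta>)) powr (- \<theta> / 2)"
          using X(1) \<theta> t by (intro powr_mono2') auto
        also have "\<dots> = inverse t" using t \<theta> by (simp add: powr_powr powr_minus)
        finally have 1: "?k powr (\<eta> - Re s - 1) \<le> inverse t * ?k powr (- (1 + \<theta> / 2))"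
          by (simp add: mult_right_mono)
        have "norm (y (Suc (n + M)) s) \<le> norm s * norm (s - \<delta>) * C * ?k powr (\<eta> - Re s - 1)"
          using s_eta by (intro norm_y) auto
        also have "\<dots> \<le> norm s * norm (s - \<delta>) * C * (inverse t * ?k powr (- (1 + \<theta> / 2)))"
          using 1 C_nonneg by (intro mult_left_mono) auto
        finally show "norm (y (Suc (n + M)) s) \<le> norm s * norm (s - \<delta>) * C * inverse t * ?k powr (- (1 + \<theta> / 2))"
          by (simp only: mult_ac)
      qed
      also have "\<dots> = norm s * norm (s - \<delta>) * C * inverse t * (\<Sum>n. real (Suc (n + M)) powr (- (1 + \<theta> / 2)))"
        using sm2 by (intro suminf_mult) (subst summable_iff_shift)
      also have "\<dots> \<le> norm s * norm (s - \<delta>) * C * inverse t * S2"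
      proof (intro mult_left_mono)
        have "S2 = (\<Sum>n. real (Suc (n + M)) powr (- (1 + \<theta> / 2))) + (\<Sum>n<M. real (Suc n) powr (- (1 + \<theta> / 2)))"
          unfolding S2_def by (rule suminf_split_initial_segment[OF sm2])
        moreover have "(\<Sum>n<M. real (Suc n) powr (- (1 + \<theta> / 2))) \<ge> 0" by (intro sum_nonneg) auto
        ultimately show "(\<Sum>n. real (Suc (n + M)) powr (- (1 + \<theta> / 2))) \<le> S2" by simp
      qed (use t C_nonneg in auto)
      also have "norm s * norm (s - \<delta>) * C * inverse t * S2 \<le> (\<delta> + 2) * t * norm (s - \<delta>) * C * inverse t * S2"
      proof (intro mult_right_mono)
        have "norm s \<le> \<bar>Re s\<bar> + \<bar>Im s\<bar>" by (rule cmod_le)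
        also have "\<dots> \<le> (\<delta> + 1) * 1 + t" using s s_eta eta_nonneg by (simp add: t_def)
        also have "\<dots> \<le> (\<delta> + 1) * t + t" using t delta_pos by (intro add_right_mono mult_left_mono) auto
        finally show "norm s \<le> (\<delta> + 2) * t" by (simp add: algebra_simps)
      qed (use t C_nonneg S2 in auto)
      also have "\<dots> = norm (s - \<delta>) * (C * (\<delta> + 2) * S2)" using t by (simp add: field_simps)
      finally show ?thesis .
    qed
    \<comment> \<open>The identity \<open>sum_y\<close> with the tail kept: an approximate formula
      that remains valid to the left of \<delta>.\<close>
    have Zeq: "Z s = (\<Sum>n\<le>Suc M. c n * dpow s n) - A (Suc M) * dpow s X
        + s * dpow (s - \<delta>) X / (s - \<delta>) + (\<Sum>n. y (Suc (n + M)) s) / (s - \<delta>)"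
    proof -
      have "Y s = s + ((\<Sum>n. y (Suc (n + M)) s) + (\<Sum>n<M. y (Suc n) s))"
        unfolding Y_def using suminf_split_initial_segment[OF summable_norm_cancel[OF norm_y_summable[OF s_eta(1)]], of M]
        by simp
      moreover have "v / u = x - a + s * d / u + T / u"
        if "v = s + (T + (u * (x - a) - s * (1 - d)))" "u \<noteq> 0" for v x a d T u :: complex
      proof -
        have "v = u * (x - a) + s * d + T" using that by (simp add: algebra_simps)
        thus ?thesis using that(2) by (simp add: add_divide_distrib)
      qed
      ultimately show ?thesis using sd0 unfolding Z_def sum_y X_def by blast
    qed
    have tk: "t powr \<kappa> \<ge> 1" using t assms by (intro ge_one_powr_ge_zero) auto
    have T4': "norm ((\<Sum>n. y (Suc (n + M)) s) / (s - \<delta>)) \<le> C * (\<delta> + 2) * S2"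
      using T4 sd sd0 by (simp add: norm_divide divide_le_eq mult_ac)
    also have "\<dots> \<le> C * (\<delta> + 2) * S2 * t powr \<kappa>"
      using tk C_nonneg S2 delta_pos mult_left_mono[OF tk, of "C * (\<delta> + 2) * S2"] by simp
    finally have T5: "norm ((\<Sum>n. y (Suc (n + M)) s) / (s - \<delta>)) \<le> C * (\<delta> + 2) * S2 * t powr \<kappa>" .
    have "norm (Z s) \<le> X powr (2 * e) * S1 + X powr (2 * e) * (1 + C) + X powr (2 * e) * (1 + \<delta>) + C * (\<delta> + 2) * S2 * t powr \<kappa>"
      unfolding Zeq by (intro norm_triangle_le add_mono order_trans[OF norm_triangle_ineq4] T1 T2 T3 T5)
    also have "\<dots> = X powr (2 * e) * (S1 + (1 + C) + (1 + \<delta>)) + C * (\<delta> + 2) * S2 * t powr \<kappa>"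
      by (simp add: algebra_simps)
    also have "\<dots> \<le> 3 powr (2 * e) * t powr \<kappa> * (S1 + (1 + C) + (1 + \<delta>)) + C * (\<delta> + 2) * S2 * t powr \<kappa>"
      using Xe S1 C_nonneg delta_pos by (intro add_right_mono mult_right_mono) auto
    also have "\<dots> = B * t powr \<kappa>" by (simp add: B_def algebra_simps)
    finally show ?thesis by (simp add: t_def)
  qed
  thus ?thesis using e B unfolding \<theta>_def by blast
qed

text \<open>The derivative is bounded by Cauchy's inequality on discs of radius r. To keep these
  inside the region of \<open>Z_growth_aux\<close>, the width to the left of \<delta> is halved, the
  right end moves from \<delta> + 1 to \<delta> + 1/2, and Im s \<ge> 2 replaces Im s \<ge>
  1.\<close>

lemma Z_growth:
  assumes "\<kappa> > 0"
  shows "\<exists>e B. e > 0 \<and> e \<le> (\<delta> - \<eta>) / 2 \<and> B > 0 \<and>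
    (\<forall>s. Im s \<ge> 2 \<longrightarrow> Re s \<ge> \<delta> - e \<longrightarrow> Re s \<le> \<delta> + 1 / 2 \<longrightarrow>
      norm (Z s) \<le> B * Im s powr \<kappa> \<and> norm (deriv Z s) \<le> B * Im s powr \<kappa>)"
proof -
  obtain e B where e: "e > 0" "e \<le> (\<delta> - \<eta>) / 2" and B: "B > 0"
    and bd: "\<And>s. Im s \<ge> 1 \<Longrightarrow> Re s \<ge> \<delta> - e \<Longrightarrow> Re s \<le> \<delta> + 1 \<Longrightarrow> norm (Z s) \<le> B * Im s powr \<kappa>"
    using Z_growth_aux[OF assms] by blast
  define r where "r = min (e / 2) (1 / 2)"
  have r: "r > 0" "r \<le> e / 2" "r \<le> 1 / 2" using e by (auto simp: r_def)
  define B' where "B' = B + B * 2 powr \<kappa> / r"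
  have B': "B' \<ge> B" "B' \<ge> B * 2 powr \<kappa> / r" using B r by (auto simp: B'_def)
  have "norm (Z s) \<le> B' * Im s powr \<kappa> \<and> norm (deriv Z s) \<le> B' * Im s powr \<kappa>"
    if s: "Im s \<ge> 2" "Re s \<ge> \<delta> - e / 2" "Re s \<le> \<delta> + 1 / 2" for s
  proof
    have "norm (Z s) \<le> B * Im s powr \<kappa>" using s e by (intro bd) auto
    also have "\<dots> \<le> B' * Im s powr \<kappa>" using B' by (intro mult_right_mono) auto
    finally show "norm (Z s) \<le> B' * Im s powr \<kappa>" .
    have near: "\<bar>Re x - Re s\<bar> \<le> r" "\<bar>Im x - Im s\<bar> \<le> r" if "norm (s - x) \<le> r" for x
      using abs_Re_le_cmod[of "s - x"] abs_Im_le_cmod[of "s - x"] that by auto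
    have sub: "cball s r \<subseteq> {s. Re s > \<eta>} - {of_real \<delta>}"
    proof
      fix x assume "x \<in> cball s r"
      hence "norm (s - x) \<le> r" by (simp add: dist_norm)
      from near[OF this] have *: "Re x \<ge> Re s - r" "Im x \<ge> Im s - r" by auto
      have "Im x > 0" using * r s by linarith
      moreover have "Re x > \<eta>" using * r s e eta_less by (simp add: field_simps)
      ultimately show "x \<in> {s. Re s > \<eta>} - {of_real \<delta>}" by auto
    qed
    have "norm ((deriv ^^ 1) Z s) \<le> fact 1 * (B * (2 * Im s) powr \<kappa>) / r ^ 1"
    proof (rule Cauchy_inequality)
      show "Z holomorphic_on ball s r"
        by (rule holomorphic_on_subset[OF Z_holomorphic]) (use sub ball_subset_cball in blast)
      show "continuous_on (cball s r) Z"
        by (rule holomorphic_on_imp_continuous_on, rule holomorphic_on_subset[OF Z_holomorphic sub])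
      fix x assume "norm (s - x) = r"
      hence n: "\<bar>Re x - Re s\<bar> \<le> r" "\<bar>Im x - Im s\<bar> \<le> r" using near[of x] by auto
      have "norm (Z x) \<le> B * Im x powr \<kappa>" using n r s e by (intro bd) auto
      also have "\<dots> \<le> B * (2 * Im s) powr \<kappa>"
        using n r s B assms by (intro mult_left_mono powr_mono2) auto
      finally show "norm (Z x) \<le> B * (2 * Im s) powr \<kappa>" .
    qed (use r in auto)
    hence "norm (deriv Z s) \<le> (B * 2 powr \<kappa> / r) * Im s powr \<kappa>"
      using s by (simp add: powr_mult)
    also have "\<dots> \<le> B' * Im s powr \<kappa>" using B' by (intro mult_right_mono) auto
    finally show "norm (deriv Z s) \<le> B' * Im s powr \<kappa>" .
  qed
  moreover have "B' > 0" using B B' by linarith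
  moreover have "e / 2 > 0" "e / 2 \<le> (\<delta> - \<eta>) / 2" using e by auto
  ultimately show ?thesis by blast
qed

end

interpretation zeta: counting_seq "\<lambda>n. if n = 0 then 0 else 1" 1 0 1
proof
  fix x :: real assume x: "x \<ge> 1"
  have "(\<Sum>m\<le>nat \<lfloor>x\<rfloor>. if m = 0 then 0 else 1 :: real) = (\<Sum>m\<in>{1..nat \<lfloor>x\<rfloor>}. 1)"
    by (rule sum.mono_neutral_cong_right) auto
  also have "\<dots> = real_of_int \<lfloor>x\<rfloor>" using x by simp
  finally show "\<bar>(\<Sum>m\<le>nat \<lfloor>x\<rfloor>. if m = 0 then 0 else 1) - x powr 1\<bar> \<le> 1 * x powr 0"
    using x by simp linarith
qed auto

section \<open>Lower bounds for the Dirichlet series\<close>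

(* L plays the role of the von Mangoldt function. *)
locale euler_seq = counting_seq +
  fixes L :: "nat \<Rightarrow> real"
  assumes L_nonneg: "L n \<ge> 0" and L_0: "L 0 = 0" and c_1: "c 1 = 1"
    and conv: "n \<ge> 1 \<Longrightarrow> c n * ln (real n) = (\<Sum>d | d dvd n. L d * c (n div d))"
begin

text \<open>The term d = n of the convolution already gives this, since all terms are
  nonnegative.\<close>

lemma L_le: "L n \<le> c n * ln (real n)"
proof (cases "n = 0")
  case False
  have "L n * c (n div n) \<le> (\<Sum>d | d dvd n. L d * c (n div d))"
    by (rule member_le_sum) (use False L_nonneg c_nonneg in auto)
  thus ?thesis using False conv[of n] c_1 by simp
qed (simp add: L_0)

lemma L_1: "L 1 = 0"
  using L_le[of 1] L_nonneg[of 1] by simp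

lemma abs_conv_L: "abs_conv L \<delta>"
proof (rule abs_conv_mono[OF abs_conv_mult_ln[OF abs_conv_c]])
  show "\<bar>L n\<bar> \<le> \<bar>c n * ln (real n)\<bar>" for n using L_le[of n] L_nonneg[of n] by linarith
qed

(* The coefficients of the logarithm of Z. *)
definition M :: "nat \<Rightarrow> real" where "M n = L n / ln (real n)"

lemma M_nonneg: "M n \<ge> 0"
  unfolding M_def using L_nonneg by (cases "n = 0") auto

lemma M_ln: "M n * ln (real n) = L n"
  using L_1 L_0 by (cases "n = 0 \<or> n = 1") (auto simp: M_def)

lemma abs_conv_M: "abs_conv M \<delta>"
proof -
  have "abs_conv (\<lambda>n. 1 / ln 2 * L n) \<delta>"
    using abs_conv_L unfolding abs_conv_def by (auto simp: abs_mult mult.assoc intro!: summable_divide)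
  thus ?thesis
  proof (rule abs_conv_mono)
    fix n
    show "\<bar>M n\<bar> \<le> \<bar>1 / ln 2 * L n\<bar>"
    proof (cases "n \<le> 1")
      case True
      hence "n = 0 \<or> n = 1" by auto
      thus ?thesis using L_0 L_1 by (auto simp: M_def)
    next
      case False
      hence "ln (real n) \<ge> ln 2" by (subst ln_le_cancel_iff) auto
      hence "L n / ln (real n) \<le> L n / ln 2" using L_nonneg[of n] False by (intro divide_left_mono) auto
      thus ?thesis using M_nonneg[of n] L_nonneg[of n] by (simp add: M_def)
    qed
  qed
qed

text \<open>Absolute convergence allows the double sum over (d, e) to be regrouped by n = d e; the
  inner sums are then given by \<open>conv\<close>. This is the identity behind L being the
  coefficients of -Z'/Z.\<close>

lemma dirichlet_mult:
  assumes s: "Re s > \<delta>"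
  shows "dirichlet L s * dirichlet c s = dirichlet (\<lambda>n. c n * ln (real n)) s"
proof -
  define f where "f = (\<lambda>n. of_real (L n) * dpow s (real n))"
  define g where "g = (\<lambda>n. of_real (c n) * dpow s (real n))"
  have f: "(f has_sum dirichlet L s) UNIV" unfolding f_def
    by (rule norm_summable_imp_has_sum[OF dirichlet_summable_norm[OF abs_conv_L s] dirichlet_sums[OF abs_conv_L s]])
  have g: "(g has_sum dirichlet c s) UNIV" unfolding g_def
    by (rule norm_summable_imp_has_sum[OF dirichlet_summable_norm[OF abs_conv_c s] dirichlet_sums[OF abs_conv_c s]])
  have fa: "(\<lambda>n. norm (f n)) summable_on UNIV" unfolding f_def
    by (rule norm_summable_imp_summable_on) (use dirichlet_summable_norm[OF abs_conv_L s] in simp)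
  have ga: "(\<lambda>n. norm (g n)) summable_on UNIV" unfolding g_def
    by (rule norm_summable_imp_summable_on) (use dirichlet_summable_norm[OF abs_conv_c s] in simp)
  have "(\<lambda>x. norm (case x of (d, e) \<Rightarrow> f d * g e)) summable_on UNIV \<times> UNIV"
  proof (subst Infinite_Sum.abs_summable_on_Sigma_iff, intro conjI ballI)
    show "(\<lambda>e. norm (case (d, e) of (d, e) \<Rightarrow> f d * g e)) summable_on UNIV" for d
      using summable_on_cmult_right[OF ga, of "norm (f d)"] by (simp add: norm_mult)
    show "(\<lambda>d. norm (\<Sum>\<^sub>\<infinity>e. norm (case (d, e) of (d, e) \<Rightarrow> f d * g e))) summable_on UNIV"
      using summable_on_cmult_left[OF fa, of "infsum (\<lambda>e. norm (g e)) UNIV"]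
      by (simp add: norm_mult infsum_cmult_right' infsum_nonneg)
  qed
  hence sm: "(\<lambda>(d, e). f d * g e) summable_on UNIV \<times> UNIV" by (rule abs_summable_summable)
  have "((\<lambda>(d, e). f d * g e) has_sum (dirichlet L s * dirichlet c s)) (UNIV \<times> UNIV)"
    by (rule has_sum_SigmaI[OF _ has_sum_cmult_left[OF f] sm]) (use has_sum_cmult_right[OF g] in auto)
  \<comment> \<open>Terms with d = 0 or e = 0 vanish. Without them (d, e) is determined by (d e, d),
    which makes the regrouping a bijection.\<close>
  also have "?this \<longleftrightarrow> ((\<lambda>(d, e). f d * g e) has_sum (dirichlet L s * dirichlet c s)) ({1..} \<times> {1..})"
    by (rule has_sum_cong_neutral) (auto simp: f_def g_def L_0 c_0 Suc_le_eq intro!: gr0I)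
  also have "\<dots> \<longleftrightarrow> ((\<lambda>(n, d). f d * g (n div d)) has_sum (dirichlet L s * dirichlet c s)) (Sigma {1..} (\<lambda>n. {d. d dvd n}))"
    by (rule has_sum_reindex_bij_witness[where j = "\<lambda>(d, e). (d * e, d)" and i = "\<lambda>(n, d). (d, n div d)"])
       (auto simp: dvd_div_eq_0_iff Suc_le_eq elim!: dvdE)
  finally have "((\<lambda>n. of_real (c n * ln (real n)) * dpow s (real n)) has_sum (dirichlet L s * dirichlet c s)) {1..}"
  proof (rule has_sum_SigmaD)
    fix n :: nat assume n: "n \<in> {1..}"
    have "(\<Sum>d | d dvd n. f d * g (n div d)) = (\<Sum>d | d dvd n. of_real (L d * c (n div d)) * dpow s (real n))"
    proof (rule sum.cong[OF refl])
      fix d assume "d \<in> {d. d dvd n}"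
      then obtain e where e: "n = d * e" by auto
      with n have "d > 0" "e > 0" by auto
      thus "f d * g (n div d) = of_real (L d * c (n div d)) * dpow s (real n)"
        unfolding e f_def g_def by (simp add: dpow_mult)
    qed
    also have "\<dots> = of_real (\<Sum>d | d dvd n. L d * c (n div d)) * dpow s (real n)"
      by (simp add: sum_distrib_right)
    also have "\<dots> = of_real (c n * ln (real n)) * dpow s (real n)"
      using conv[of n] n by simp
    finally show "((\<lambda>d. (case (n, d) of (n, d) \<Rightarrow> f d * g (n div d))) has_sum
        of_real (c n * ln (real n)) * dpow s (real n)) {d. d dvd n}"
      using n by (intro has_sum_finiteI) (auto intro: finite_divisors_nat)
  qed
  also have "?this \<longleftrightarrow> ((\<lambda>n. of_real (c n * ln (real n)) * dpow s (real n)) has_sum (dirichlet L s * dirichlet c s)) UNIV"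
    by (rule has_sum_cong_neutral) (auto simp: not_less_eq_eq)
  finally have "(\<lambda>n. of_real (c n * ln (real n)) * dpow s (real n)) sums (dirichlet L s * dirichlet c s)"
    by (rule has_sum_imp_sums)
  from sums_unique2[OF this dirichlet_sums[OF abs_conv_mult_ln[OF abs_conv_c] s]] show ?thesis .
qed

lemma Z_has_derivative:
  assumes s: "Re s > \<delta>"
  shows "(Z has_field_derivative - dirichlet L s * Z s) (at s)"
proof -
  have op: "open {s. Re s > \<delta>}" by (rule open_halfspace_Re_gt)
  have "(dirichlet c has_field_derivative - dirichlet L s * Z s) (at s)"
    using dirichlet_has_derivative[OF abs_conv_c s] dirichlet_mult[OF s] Z_eq_dirichlet[OF s] by simp
  thus ?thesis
    by (rule has_field_derivative_transform_within_open[OF _ op]) (use s Z_eq_dirichlet in auto)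
qed

text \<open>As \<sigma> grows only the term n = 1 survives: for n \<ge> 2, n^(-\<sigma>) \<le>
  n^(-\<sigma>0) 2^(\<sigma>0-\<sigma>). This fixes the constant of integration in
  \<open>Z_eq_exp\<close>.\<close>

lemma dirichlet_tendsto:
  assumes a: "abs_conv a \<delta>"
  shows "((\<lambda>\<sigma>. dirichlet a (of_real \<sigma>)) \<longlongrightarrow> of_real (a 1)) at_top"
proof -
  define \<sigma>0 where "\<sigma>0 = \<delta> + 1"
  define S where "S = (\<Sum>n. \<bar>a n\<bar> * real n powr (- \<sigma>0))"
  have a0: "a 0 = 0" using a by (simp add: abs_conv_def)
  have sm: "summable (\<lambda>n. \<bar>a n\<bar> * real n powr (- \<sigma>0))" by (rule abs_convD[OF a]) (simp add: \<sigma>0_def)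
  have bound: "norm (dirichlet a (of_real \<sigma>) - of_real (a 1)) \<le> S * 2 powr (\<sigma>0 - \<sigma>)" if \<sigma>: "\<sigma> \<ge> \<sigma>0" for \<sigma>
  proof -
    have \<sigma>': "Re (of_real \<sigma>) > \<delta>" using \<sigma> by (simp add: \<sigma>0_def)
    define a' where "a' = (\<lambda>n. if n = 1 then 0 else a n)"
    have a': "abs_conv a' \<delta>" by (rule abs_conv_mono[OF a]) (auto simp: a'_def)
    have a1: "abs_conv (\<lambda>n. if n = 1 then a n else 0) \<delta>" by (rule abs_conv_mono[OF a]) auto
    have sm2: "summable (\<lambda>n. \<bar>a' n\<bar> * real n powr (- \<sigma>))" by (rule abs_convD[OF a']) (use \<sigma>' in auto)
    have "dirichlet (\<lambda>n. if n = 1 then a n else 0) (of_real \<sigma>) = (\<Sum>n. if n = 1 then of_real (a 1) else 0)"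
      unfolding dirichlet_def by (rule suminf_cong) auto
    also have "\<dots> = of_real (a 1)" using sums_single[of 1 "\<lambda>_. complex_of_real (a 1)"] by (simp add: sums_iff)
    finally have 1: "dirichlet (\<lambda>n. if n = 1 then a n else 0) (of_real \<sigma>) = of_real (a 1)" .
    have "dirichlet a' (of_real \<sigma>) = dirichlet (\<lambda>n. a n - (if n = 1 then a n else 0)) (of_real \<sigma>)"
      by (rule arg_cong[of _ _ "\<lambda>a. dirichlet a (of_real \<sigma>)"]) (auto simp: a'_def)
    also have "\<dots> = dirichlet a (of_real \<sigma>) - of_real (a 1)"
      using dirichlet_diff[OF a a1 \<sigma>'] 1 by simp
    finally have "norm (dirichlet a (of_real \<sigma>) - of_real (a 1)) = norm (dirichlet a' (of_real \<sigma>))" by simp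
    also have "\<dots> \<le> (\<Sum>n. \<bar>a' n\<bar> * real n powr (- \<sigma>))" by (rule norm_dirichlet_le[OF a']) (use \<sigma>' in auto)
    also have "\<dots> \<le> (\<Sum>n. \<bar>a n\<bar> * real n powr (- \<sigma>0) * 2 powr (\<sigma>0 - \<sigma>))"
    proof (rule suminf_le[OF _ sm2 summable_mult2[OF sm]])
      fix n
      show "\<bar>a' n\<bar> * real n powr (- \<sigma>) \<le> \<bar>a n\<bar> * real n powr (- \<sigma>0) * 2 powr (\<sigma>0 - \<sigma>)"
      proof (cases "n \<le> 1")
        case True
        thus ?thesis using a0 by (cases "n = 0") (auto simp: a'_def)
      next
        case False
        have "real n powr (- \<sigma>) = real n powr (- \<sigma>0) * real n powr (\<sigma>0 - \<sigma>)"
          by (subst powr_add[symmetric]) simp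
        also have "\<dots> \<le> real n powr (- \<sigma>0) * 2 powr (\<sigma>0 - \<sigma>)"
          using False \<sigma> by (intro mult_left_mono powr_mono2') auto
        finally have "\<bar>a n\<bar> * real n powr (- \<sigma>) \<le> \<bar>a n\<bar> * (real n powr (- \<sigma>0) * 2 powr (\<sigma>0 - \<sigma>))"
          by (intro mult_left_mono) auto
        thus ?thesis using False by (simp add: a'_def mult_ac)
      qed
    qed
    also have "\<dots> = S * 2 powr (\<sigma>0 - \<sigma>)" unfolding S_def using suminf_mult2[OF sm] by simp
    finally show ?thesis .
  qed
  have "((\<lambda>\<sigma>. dirichlet a (of_real \<sigma>) - of_real (a 1)) \<longlongrightarrow> 0) at_top"
  proof (rule Lim_null_comparison)
    show "\<forall>\<^sub>F \<sigma> in at_top. norm (dirichlet a (of_real \<sigma>) - of_real (a 1)) \<le> S * 2 powr (\<sigma>0 - \<sigma>)"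
      using eventually_ge_at_top[of \<sigma>0] by eventually_elim (rule bound)
    show "((\<lambda>\<sigma>. S * 2 powr (\<sigma>0 - \<sigma>)) \<longlongrightarrow> 0) at_top" by real_asymp
  qed
  thus ?thesis by (simp add: LIM_zero_iff)
qed

text \<open>Z exp(-\<open>dirichlet M\<close>) has derivative 0 on the half-plane, hence is
  constant, and its limit along the real axis is 1. No branch of the logarithm of Z has to be
  chosen.\<close>

lemma Z_eq_exp:
  assumes s: "Re s > \<delta>"
  shows "Z s = exp (dirichlet M s)"
proof -
  let ?S = "{s. Re s > \<delta>}"
  define F where "F = (\<lambda>s. Z s * exp (- dirichlet M s))"
  have dM: "(dirichlet M has_field_derivative - dirichlet L s) (at s)" if "Re s > \<delta>" for s
    using dirichlet_has_derivative[OF abs_conv_M that] by (simp add: M_ln)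
  have "\<exists>k. \<forall>x\<in>?S. F x = k"
  proof (rule has_field_derivative_zero_constant)
    show "convex ?S" by (rule convex_halfspace_Re_gt)
    fix z assume "z \<in> ?S"
    hence z: "Re z > \<delta>" by simp
    have "(F has_field_derivative (- dirichlet L z * Z z) * exp (- dirichlet M z) + Z z * (exp (- dirichlet M z) * - (- dirichlet L z))) (at z within ?S)"
      unfolding F_def
      by (rule has_field_derivative_at_within) (auto intro!: derivative_eq_intros Z_has_derivative[OF z] dM[OF z])
    thus "(F has_field_derivative 0) (at z within ?S)" by simp
  qed
  then obtain k where k: "\<And>x. Re x > \<delta> \<Longrightarrow> F x = k" by auto
  have "((\<lambda>\<sigma>. dirichlet c (of_real \<sigma>) * exp (- dirichlet M (of_real \<sigma>))) \<longlongrightarrow> of_real (c 1) * exp (- of_real (M 1))) at_top"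
    by (intro tendsto_intros dirichlet_tendsto abs_conv_c abs_conv_M)
  moreover have "\<forall>\<^sub>F \<sigma> in at_top. dirichlet c (of_real \<sigma>) * exp (- dirichlet M (of_real \<sigma>)) = k"
    using eventually_gt_at_top[of \<delta>]
    by eventually_elim (use k Z_eq_dirichlet in \<open>force simp: F_def\<close>)
  ultimately have "((\<lambda>_::real. k) \<longlongrightarrow> of_real (c 1) * exp (- of_real (M 1))) at_top"
    by (rule Lim_transform_eventually)
  hence "k = of_real (c 1) * exp (- of_real (M 1))" by (simp add: tendsto_const_iff)
  also have "\<dots> = 1" using c_1 by (simp add: M_def)
  finally have "Z s * exp (- dirichlet M s) = 1" using k[OF s] by (simp add: F_def)
  thus ?thesis by (simp add: exp_minus field_simps)
qed

text \<open>The logarithm of the left side is a series with coefficients \<open>M n\<close> \<ge> 0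
  times 3 + 4 cos x + cos 2x = 2 (1 + cos x)^2, where x = t ln n.\<close>

lemma three_four_one:
  assumes \<sigma>: "\<sigma> > \<delta>"
  shows "norm (Z (of_real \<sigma>)) ^ 3 * norm (Z (Complex \<sigma> t)) ^ 4 * norm (Z (Complex \<sigma> (2 * t))) \<ge> 1"
proof -
  have Re_M: "(\<lambda>n. M n * (real n powr (- \<sigma>) * cos (u * ln (real n)))) sums Re (dirichlet M (Complex \<sigma> u))" for u
  proof -
    have "(\<lambda>n. Re (of_real (M n) * dpow (Complex \<sigma> u) (real n))) sums Re (dirichlet M (Complex \<sigma> u))"
      by (rule sums_Re, rule dirichlet_sums[OF abs_conv_M]) (use \<sigma> in auto)
    moreover have "Re (of_real (M n) * dpow (Complex \<sigma> u) (real n)) = M n * (real n powr (- \<sigma>) * cos (u * ln (real n)))" for n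
      using abs_conv_M by (cases "n = 0") (auto simp: Re_dpow abs_conv_def)
    ultimately show ?thesis by (simp only:)
  qed
  have e: "Complex \<sigma> 0 = of_real \<sigma>" by (simp add: complex_eq_iff)
  have "(\<lambda>n. 3 * (M n * (real n powr (- \<sigma>) * cos (0 * ln (real n)))) + 4 * (M n * (real n powr (- \<sigma>) * cos (t * ln (real n))))
      + M n * (real n powr (- \<sigma>) * cos (2 * t * ln (real n)))) sums
      (3 * Re (dirichlet M (Complex \<sigma> 0)) + 4 * Re (dirichlet M (Complex \<sigma> t)) + Re (dirichlet M (Complex \<sigma> (2 * t))))"
    by (intro sums_add sums_mult Re_M)
  moreover have "3 * (M n * (real n powr (- \<sigma>) * cos (0 * ln (real n)))) + 4 * (M n * (real n powr (- \<sigma>) * cos (t * ln (real n))))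
      + M n * (real n powr (- \<sigma>) * cos (2 * t * ln (real n))) = M n * real n powr (- \<sigma>) * (2 * (1 + cos (t * ln (real n)))\<^sup>2)" for n
  proof -
    have "cos (2 * t * ln (real n)) = 2 * (cos (t * ln (real n)))\<^sup>2 - 1"
      using cos_double_cos[of "t * ln (real n)"] by (simp add: mult_ac)
    thus ?thesis by (simp only:) (simp add: power2_eq_square algebra_simps)
  qed
  ultimately have "(\<lambda>n. M n * real n powr (- \<sigma>) * (2 * (1 + cos (t * ln (real n)))\<^sup>2)) sums
      (3 * Re (dirichlet M (Complex \<sigma> 0)) + 4 * Re (dirichlet M (Complex \<sigma> t)) + Re (dirichlet M (Complex \<sigma> (2 * t))))"
    by (simp only:)
  hence "3 * Re (dirichlet M (Complex \<sigma> 0)) + 4 * Re (dirichlet M (Complex \<sigma> t)) + Re (dirichlet M (Complex \<sigma> (2 * t))) \<ge> 0"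
    by (rule sums_le[OF _ sums_zero, rotated]) (auto intro!: mult_nonneg_nonneg M_nonneg)
  hence "exp (3 * Re (dirichlet M (Complex \<sigma> 0)) + 4 * Re (dirichlet M (Complex \<sigma> t)) + Re (dirichlet M (Complex \<sigma> (2 * t)))) \<ge> 1"
    by simp
  also have "exp (3 * Re (dirichlet M (Complex \<sigma> 0)) + 4 * Re (dirichlet M (Complex \<sigma> t)) + Re (dirichlet M (Complex \<sigma> (2 * t)))) =
     exp (Re (dirichlet M (Complex \<sigma> 0))) ^ 3 * exp (Re (dirichlet M (Complex \<sigma> t))) ^ 4 * exp (Re (dirichlet M (Complex \<sigma> (2 * t))))"
    by (simp add: exp_add exp_of_nat_mult [symmetric])
  finally show ?thesis using \<sigma> by (simp add: Z_eq_exp e)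
qed

lemma Z_nonzero: "Re s > \<delta> \<Longrightarrow> Z s \<noteq> 0"
  by (simp add: Z_eq_exp)

end

section \<open>Non-vanishing on the line Re s = \<delta> and lower bounds near it\<close>

context counting_seq begin

lemma Y_isCont: "Re s > \<eta> \<Longrightarrow> isCont Y s"
  using holomorphic_on_imp_continuous_on[OF Y_holomorphic]
  by (simp add: continuous_on_eq_continuous_at open_halfspace_Re_gt)

lemma Z_has_deriv:
  assumes "Re s > \<eta>" "s \<noteq> \<delta>"
  shows "(Z has_field_derivative deriv Z s) (at s)"
proof -
  have "open ({s. Re s > \<eta>} - {complex_of_real \<delta>})"
    by (intro open_Diff open_halfspace_Re_gt closed_singleton)
  with Z_holomorphic assms show ?thesis by (intro holomorphic_derivI) auto
qed

lemma Z_isCont: "Re s > \<eta> \<Longrightarrow> s \<noteq> \<delta> \<Longrightarrow> isCont Z s"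
  using Z_has_deriv DERIV_isCont by blast

text \<open>The pole of Z contributes exactly 1 / (s - \<delta>), the same polar part that zeta(s -
  \<delta> + 1) has.\<close>

lemma log_deriv_Y:
  assumes "Re s > \<eta>" "s \<noteq> \<delta>" "Y s \<noteq> 0"
  shows "- (deriv Y s / Y s) = - (deriv Z s / Z s) - 1 / (s - \<delta>)"
proof -
  have "(Y has_field_derivative deriv Y s) (at s)"
    using Y_holomorphic assms by (intro holomorphic_derivI[OF _ open_halfspace_Re_gt]) auto
  hence "(Z has_field_derivative (deriv Y s * (s - \<delta>) - Y s * 1) / ((s - \<delta>) * (s - \<delta>))) (at s)"
    unfolding Z_def[abs_def] using assms by (auto intro!: derivative_eq_intros)
  hence dZ: "deriv Z s = (deriv Y s * (s - \<delta>) - Y s) / ((s - \<delta>) * (s - \<delta>))"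
    by (simp add: DERIV_imp_deriv)
  have *: "- (y' / v) = - (((y' * u - v) / (u * u)) / (v / u)) - 1 / u" if "u \<noteq> 0" "v \<noteq> 0" for u v y' :: complex
  proof -
    have "((y' * u - v) / (u * u)) / (v / u) = (y' * u - v) / (v * u)"
      using that(1) by simp
    also have "\<dots> = y' / v - 1 / u"
      using that by (simp add: diff_divide_distrib)
    finally show ?thesis by simp
  qed
  show ?thesis unfolding dZ Z_def by (rule *) (use assms in auto)
qed

end

context euler_seq begin

lemma Complex_eq': "Complex \<sigma> t = of_real \<sigma> + \<i> * of_real t"
  by (simp add: complex_eq_iff)

text \<open>At a zero \<delta> + it the product in \<open>three_four_one\<close> would have at most
  a triple pole against a zero of order at least 4 as \<sigma> tends to \<delta>. It would tend to
  0, although it is at least 1.\<close>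

lemma Z_line_nonzero:
  assumes t: "t > 0"
  shows "Z (Complex \<delta> t) \<noteq> 0"
proof
  assume zero: "Z (Complex \<delta> t) = 0"
  define D where "D = deriv Z (Complex \<delta> t)"
  have nr: "Complex \<delta> u \<noteq> of_real \<delta>" if "u > 0" for u using that by (simp add: complex_eq_iff)
  have "(Z has_field_derivative D) (at (Complex \<delta> t))"
    unfolding D_def by (rule Z_has_deriv) (use nr[OF t] eta_less in auto)
  hence "((\<lambda>h. (Z (Complex \<delta> t + h) - Z (Complex \<delta> t)) / h) \<longlongrightarrow> D) (at 0)"
    by (simp add: DERIV_def)
  moreover have "filterlim (\<lambda>\<sigma>. complex_of_real (\<sigma> - \<delta>)) (at 0) (at_right \<delta>)"
    unfolding filterlim_at
    by (auto simp: eventually_at_filter intro!: tendsto_eq_intros)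
  ultimately have *: "((\<lambda>\<sigma>. (Z (Complex \<delta> t + of_real (\<sigma> - \<delta>)) - Z (Complex \<delta> t)) / of_real (\<sigma> - \<delta>)) \<longlongrightarrow> D) (at_right \<delta>)"
    by (rule filterlim_compose)
  have l1: "((\<lambda>\<sigma>. Z (Complex \<sigma> t) / of_real (\<sigma> - \<delta>)) \<longlongrightarrow> D) (at_right \<delta>)"
  proof -
    have "Complex \<delta> t + of_real (\<sigma> - \<delta>) = Complex \<sigma> t" for \<sigma> by (simp add: complex_eq_iff)
    with * show ?thesis by (simp only: zero diff_0_right)
  qed
  have l2: "((\<lambda>\<sigma>. Z (Complex \<sigma> (2 * t))) \<longlongrightarrow> Z (Complex \<delta> (2 * t))) (at_right \<delta>)"
    by (rule isCont_tendsto_compose[OF Z_isCont])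
       (use nr[of "2 * t"] t eta_less in \<open>auto simp: Complex_eq' intro!: tendsto_eq_intros\<close>)
  have l3: "((\<lambda>\<sigma>. Y (of_real \<sigma>)) \<longlongrightarrow> Y (of_real \<delta>)) (at_right \<delta>)"
    by (rule isCont_tendsto_compose[OF Y_isCont]) (use eta_less in \<open>auto intro!: tendsto_eq_intros\<close>)
  have "((\<lambda>\<sigma>. norm (Y (of_real \<sigma>)) ^ 3 * norm (Z (Complex \<sigma> t) / of_real (\<sigma> - \<delta>)) ^ 4 * (\<sigma> - \<delta>)
      * norm (Z (Complex \<sigma> (2 * t)))) \<longlongrightarrow> norm (Y (of_real \<delta>)) ^ 3 * norm D ^ 4 * (\<delta> - \<delta>) * norm (Z (Complex \<delta> (2 * t)))) (at_right \<delta>)"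
    by (intro tendsto_intros l1 l2 l3)
  moreover have "\<forall>\<^sub>F \<sigma> in at_right \<delta>. 1 \<le> norm (Y (of_real \<sigma>)) ^ 3 * norm (Z (Complex \<sigma> t) / of_real (\<sigma> - \<delta>)) ^ 4 * (\<sigma> - \<delta>)
      * norm (Z (Complex \<sigma> (2 * t)))"
    using eventually_at_right_less[of \<delta>]
  proof eventually_elim
    fix \<sigma> assume \<sigma>: "\<delta> < \<sigma>"
    have "Y (of_real \<sigma>) = Z (of_real \<sigma>) * of_real (\<sigma> - \<delta>)" using \<sigma> by (simp add: Z_def)
    hence "norm (Y (of_real \<sigma>)) ^ 3 * norm (Z (Complex \<sigma> t) / of_real (\<sigma> - \<delta>)) ^ 4 * (\<sigma> - \<delta>) * norm (Z (Complex \<sigma> (2 * t))) =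
       (norm (Z (of_real \<sigma>)) * (\<sigma> - \<delta>)) ^ 3 * (norm (Z (Complex \<sigma> t)) / (\<sigma> - \<delta>)) ^ 4 * (\<sigma> - \<delta>) * norm (Z (Complex \<sigma> (2 * t)))"
      using \<sigma> by (simp only: norm_mult norm_divide norm_of_real)
    also have "\<dots> = norm (Z (of_real \<sigma>)) ^ 3 * norm (Z (Complex \<sigma> t)) ^ 4 * norm (Z (Complex \<sigma> (2 * t)))"
    proof -
      have "(x * d) ^ 3 * (z / d) ^ 4 * d * w = x ^ 3 * z ^ 4 * w" if "d > 0" for x d z w :: real
        using that by (simp add: field_simps eval_nat_numeral)
      moreover have "\<sigma> - \<delta> > 0" using \<sigma> by simp
      ultimately show ?thesis by blast
    qed
    finally show "1 \<le> norm (Y (of_real \<sigma>)) ^ 3 * norm (Z (Complex \<sigma> t) / of_real (\<sigma> - \<delta>)) ^ 4 * (\<sigma> - \<delta>)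
      * norm (Z (Complex \<sigma> (2 * t)))" using three_four_one[OF \<sigma>, of t] by (simp only:)
  qed
  ultimately have "1 \<le> norm (Y (of_real \<delta>)) ^ 3 * norm D ^ 4 * (\<delta> - \<delta>) * norm (Z (Complex \<delta> (2 * t)))"
    by (rule tendsto_lowerbound) simp
  thus False by simp
qed

lemma Y_nonzero:
  assumes "Re s \<ge> \<delta>" "Im s \<ge> 0"
  shows "Y s \<noteq> 0"
proof (cases "s = of_real \<delta>")
  case True thus ?thesis using Y_delta delta_pos by simp
next
  case False
  have "Z s \<noteq> 0"
  proof (cases "Re s > \<delta>")
    case True thus ?thesis by (rule Z_nonzero)
  next
    case F: False
    hence "s = Complex \<delta> (Im s)" using assms by (simp add: complex_eq_iff)
    moreover have "Im s > 0" using F assms False by (cases "Im s = 0") (auto simp: complex_eq_iff)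
    ultimately show ?thesis using Z_line_nonzero by metis
  qed
  thus ?thesis by (auto simp: Z_def)
qed

lemma Z_real_bound: "\<exists>B>0. \<forall>\<sigma>. \<delta> < \<sigma> \<longrightarrow> \<sigma> \<le> \<delta> + 1 \<longrightarrow> norm (Z (of_real \<sigma>)) \<le> B / (\<sigma> - \<delta>)"
proof -
  have "compact ((\<lambda>\<sigma>. Y (of_real \<sigma>)) ` {\<delta>..\<delta>+1})"
  proof (rule compact_continuous_image)
    show "continuous_on {\<delta>..\<delta> + 1} (\<lambda>\<sigma>. Y (of_real \<sigma>))"
      by (rule continuous_on_compose2[OF holomorphic_on_imp_continuous_on[OF Y_holomorphic]])
         (use eta_less in \<open>auto intro!: continuous_intros\<close>)
  qed auto
  from compact_imp_bounded[OF this]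
  obtain B where B: "B > 0" "\<And>\<sigma>. \<sigma> \<in> {\<delta>..\<delta>+1} \<Longrightarrow> norm (Y (of_real \<sigma>)) \<le> B"
    unfolding bounded_pos by auto
  have "norm (Z (of_real \<sigma>)) \<le> B / (\<sigma> - \<delta>)" if "\<delta> < \<sigma>" "\<sigma> \<le> \<delta> + 1" for \<sigma>
  proof -
    have "norm (Z (of_real \<sigma>)) = norm (Y (of_real \<sigma>)) / (\<sigma> - \<delta>)"
      using that unfolding Z_def norm_divide of_real_diff[symmetric] norm_of_real by simp
    thus ?thesis using B(2)[of \<sigma>] that by (simp add: divide_right_mono)
  qed
  with B(1) show ?thesis by blast
qed

text \<open>Put \<tau> = c2 t^(-8\<kappa>). At distance at least \<tau> to the right of the line,
  \<open>three_four_one\<close> gives |Z| >> \<tau>^(3/4) t^(-\<kappa>), which is of order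
  t^(-7\<kappa>). From the point at distance \<tau> one moves left by at most 2\<tau>, and as |Z'|
  \<le> B t^\<kappa> this changes Z by at most 2 B \<tau> t^\<kappa>, again of order t^(-7\<kappa>).
  The exponent 8 is the one for which the two orders agree; a small c2 decides between the
  constants.\<close>

lemma Z_lower:
  assumes k: "\<kappa> > 0"
  shows "\<exists>c2 c3 B. c2 > 0 \<and> c2 \<le> (\<delta> - \<eta>) / 2 \<and> c3 > 0 \<and> B > 0 \<and>
    (\<forall>s. Im s \<ge> 2 \<longrightarrow> Re s \<ge> \<delta> - c2 * Im s powr (- 8 * \<kappa>) \<longrightarrow> Re s \<le> \<delta> + 1 / 2 \<longrightarrow>
      norm (Z s) \<ge> c3 * Im s powr (- 7 * \<kappa>) \<and> norm (deriv Z s) \<le> B * Im s powr \<kappa>)"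
proof -
  obtain e B where e: "e > 0" "e \<le> (\<delta> - \<eta>) / 2" and B: "B > 0"
    and bd: "\<And>s. Im s \<ge> 2 \<Longrightarrow> Re s \<ge> \<delta> - e \<Longrightarrow> Re s \<le> \<delta> + 1 / 2 \<Longrightarrow>
       norm (Z s) \<le> B * Im s powr \<kappa> \<and> norm (deriv Z s) \<le> B * Im s powr \<kappa>"
    using Z_growth[OF k] by blast
  obtain B3 where B3: "B3 > 0" "\<And>\<sigma>. \<delta> < \<sigma> \<Longrightarrow> \<sigma> \<le> \<delta> + 1 \<Longrightarrow> norm (Z (of_real \<sigma>)) \<le> B3 / (\<sigma> - \<delta>)"
    using Z_real_bound by blast
  \<comment> \<open>Chosen so that the three-four-one inequality becomes c1^4 d^3 \<le> z^4
    t^\<kappa>.\<close>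
  define c1 where "c1 = (1 / (B3 ^ 3 * B * 2 powr \<kappa>)) powr (1 / 4)"
  have c1: "c1 > 0" using B B3 by (simp add: c1_def)
  have c1_4: "c1 ^ 4 = 1 / (B3 ^ 3 * B * 2 powr \<kappa>)"
    unfolding c1_def using B B3 by (simp add: powr_power)
  have low: "norm (Z (Complex \<sigma> t)) \<ge> c1 * (\<sigma> - \<delta>) powr (3 / 4) * t powr (- \<kappa>)"
    if \<sigma>: "\<delta> < \<sigma>" "\<sigma> \<le> \<delta> + 1 / 2" and t: "t \<ge> 2" for \<sigma> t
  proof -
    define z where "z = norm (Z (Complex \<sigma> t))"
    define d where "d = \<sigma> - \<delta>"
    have d: "d > 0" using \<sigma> by (simp add: d_def)
    have "1 \<le> norm (Z (of_real \<sigma>)) ^ 3 * z ^ 4 * norm (Z (Complex \<sigma> (2 * t)))"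
      unfolding z_def by (rule three_four_one[OF \<sigma>(1)])
    also have "\<dots> \<le> (B3 / d) ^ 3 * z ^ 4 * (B * (2 * t) powr \<kappa>)"
    proof -
      have "norm (Z (of_real \<sigma>)) ^ 3 \<le> (B3 / d) ^ 3"
        unfolding d_def by (rule power_mono[OF B3(2)]) (use \<sigma> in auto)
      moreover have "norm (Z (Complex \<sigma> (2 * t))) \<le> B * (2 * t) powr \<kappa>"
        using bd[of "Complex \<sigma> (2 * t)"] \<sigma> t e by simp
      moreover have "z ^ 4 \<ge> 0" by (simp add: z_def)
      ultimately show ?thesis using B3(1) d by (intro mult_mono mult_right_mono) auto
    qed
    also have "\<dots> = z ^ 4 * (t powr \<kappa> * (B3 ^ 3 * B * 2 powr \<kappa>)) / d ^ 3"
      using t by (simp add: power_divide powr_mult mult_ac)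
    also have "\<dots> = z ^ 4 * t powr \<kappa> / (c1 ^ 4 * d ^ 3)" using c1_4 by simp
    finally have *: "c1 ^ 4 * d ^ 3 \<le> z ^ 4 * t powr \<kappa>" using c1 d by (simp add: field_simps)
    \<comment> \<open>The inequality would allow the exponent -\<kappa>/4; the weaker -\<kappa>
      keeps the exponents below integral multiples of \<kappa>.\<close>
    have "(c1 * d powr (3 / 4) * t powr (- \<kappa>)) ^ 4 = c1 ^ 4 * d ^ 3 * t powr (- 4 * \<kappa>)"
    proof -
      have "(d powr (3 / 4)) ^ 4 = d powr 3" using d by (simp add: powr_power)
      also have "\<dots> = d ^ 3" using d by (simp add: powr_numeral)
      finally have "(d powr (3 / 4)) ^ 4 = d ^ 3" .
      moreover have "(t powr (- \<kappa>)) ^ 4 = t powr (- 4 * \<kappa>)" using t by (simp add: powr_power mult_ac)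
      ultimately show ?thesis by (simp only: power_mult_distrib)
    qed
    also have "\<dots> \<le> z ^ 4 * t powr \<kappa> * t powr (- 4 * \<kappa>)" by (intro mult_right_mono *) auto
    also have "\<dots> = z ^ 4 * t powr (- 3 * \<kappa>)" by (simp add: powr_add[symmetric])
    also have "\<dots> \<le> z ^ 4 * t powr 0" using t k by (intro mult_left_mono powr_mono) auto
    finally have "(c1 * d powr (3 / 4) * t powr (- \<kappa>)) ^ 4 \<le> z ^ 4" using t by simp
    hence "c1 * d powr (3 / 4) * t powr (- \<kappa>) \<le> z"
      using power_mono_iff[of "c1 * d powr (3 / 4) * t powr (- \<kappa>)" z 4] c1 by (simp add: z_def)
    thus ?thesis by (simp add: z_def d_def)
  qed
  \<comment> \<open>The fourth power gives 4 B c2^(1/4) \<le> c1, hence 2 B c2 \<le> c3: the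
    horizontal shift then costs at most half of the bound 2 c3 t^(-7\<kappa>) at its starting
    point.\<close>
  define c2 where "c2 = min (1 / 2) (min e ((c1 / (4 * B)) ^ 4))"
  have c2: "c2 > 0" "c2 \<le> 1 / 2" "c2 \<le> e" "c2 \<le> (c1 / (4 * B)) ^ 4" using e c1 B by (auto simp: c2_def)
  define c3 where "c3 = c1 * c2 powr (3 / 4) / 2"
  have c3: "c3 > 0" using c1 c2 by (simp add: c3_def)
  have Bc: "2 * B * c2 \<le> c3"
  proof -
    have "c2 powr (1 / 4) \<le> ((c1 / (4 * B)) ^ 4) powr (1 / 4)" using c2 by (intro powr_mono2) auto
    also have "\<dots> = c1 / (4 * B)"
    proof -
      have "(x ^ 4) powr (1 / 4) = x" if "x > 0" for x :: real
      proof -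
        have "x ^ 4 = x powr 4" using that by simp
        thus ?thesis using that by (simp only: powr_powr) simp
      qed
      thus ?thesis using c1 B by simp
    qed
    finally have "4 * B * c2 powr (1 / 4) \<le> c1" using B by (simp add: field_simps)
    hence "4 * B * c2 powr (1 / 4) * c2 powr (3 / 4) \<le> c1 * c2 powr (3 / 4)" by (intro mult_right_mono) auto
    moreover have "c2 powr (1 / 4) * c2 powr (3 / 4) = c2" using c2 by (simp add: powr_add[symmetric])
    ultimately show ?thesis by (simp add: c3_def mult.assoc)
  qed
  have "norm (Z s) \<ge> c3 * Im s powr (- 7 * \<kappa>) \<and> norm (deriv Z s) \<le> B * Im s powr \<kappa>"
    if s: "Im s \<ge> 2" "Re s \<ge> \<delta> - c2 * Im s powr (- 8 * \<kappa>)" "Re s \<le> \<delta> + 1 / 2" for s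
  proof
    define t where "t = Im s"
    define \<tau> where "\<tau> = c2 * t powr (- 8 * \<kappa>)"
    have t: "t \<ge> 2" using s by (simp add: t_def)
    have s_eq: "s = Complex (Re s) t" by (simp add: t_def)
    have "t powr (- 8 * \<kappa>) \<le> t powr 0" using t k by (intro powr_mono) auto
    hence "\<tau> \<le> c2 * 1" unfolding \<tau>_def using c2 t by (intro mult_left_mono) auto
    hence \<tau>: "\<tau> \<le> 1 / 2" "\<tau> \<le> e" using c2 by linarith+
    have \<tau>0: "\<tau> > 0" using c2 t by (simp add: \<tau>_def)
    note \<tau> = \<tau>0 \<tau>
    show "norm (deriv Z s) \<le> B * Im s powr \<kappa>" using bd[of s] s \<tau> by (auto simp: \<tau>_def t_def)
    have tau_pow: "c1 * \<tau> powr (3 / 4) * t powr (- \<kappa>) = 2 * c3 * t powr (- 7 * \<kappa>)"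
    proof -
      have "\<tau> powr (3 / 4) = c2 powr (3 / 4) * t powr (- 6 * \<kappa>)"
        unfolding \<tau>_def using c2 t by (simp add: powr_mult powr_powr)
      moreover have "t powr (- 6 * \<kappa>) * t powr (- \<kappa>) = t powr (- 7 * \<kappa>)"
        by (subst powr_add[symmetric]) (simp add: algebra_simps)
      ultimately show ?thesis by (simp add: c3_def mult.assoc)
    qed
    show "norm (Z s) \<ge> c3 * Im s powr (- 7 * \<kappa>)"
    proof (cases "Re s \<ge> \<delta> + \<tau>")
      case True
      have "c3 * t powr (- 7 * \<kappa>) \<le> 2 * c3 * t powr (- 7 * \<kappa>)" using c3 by (intro mult_right_mono) auto
      also have "\<dots> = c1 * \<tau> powr (3 / 4) * t powr (- \<kappa>)" using tau_pow by simp
      also have "\<dots> \<le> c1 * (Re s - \<delta>) powr (3 / 4) * t powr (- \<kappa>)"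
        using True \<tau> c1 by (intro mult_right_mono mult_left_mono powr_mono2) auto
      also have "\<dots> \<le> norm (Z (Complex (Re s) t))" using True \<tau> s t by (intro low) auto
      finally show ?thesis using s_eq by (simp add: t_def)
    next
      case False
      let ?S = "{z. Re z \<ge> \<delta> - e} \<inter> {z. Re z \<le> \<delta> + 1 / 2} \<inter> ({z. Im z \<ge> t} \<inter> {z. Im z \<le> t})"
      have Im_S: "Im z = t" if "z \<in> ?S" for z using that by auto
      have "norm (Z s - Z (Complex (\<delta> + \<tau>) t)) \<le> B * t powr \<kappa> * norm (s - Complex (\<delta> + \<tau>) t)"
      proof (rule field_differentiable_bound[of ?S Z "deriv Z"])
        show "convex ?S"
          by (intro convex_Int convex_halfspace_Re_ge convex_halfspace_Re_le convex_halfspace_Im_ge convex_halfspace_Im_le)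
        fix z assume z: "z \<in> ?S"
        have "Re z > \<eta>" using z e eta_less by (auto simp: field_simps)
        moreover have "z \<noteq> of_real \<delta>" using Im_S[OF z] t by auto
        ultimately show "(Z has_field_derivative deriv Z z) (at z within ?S)"
          using Z_has_deriv has_field_derivative_at_within by blast
        show "norm (deriv Z z) \<le> B * t powr \<kappa>" using bd[of z] z Im_S[OF z] t by auto
      next
        show "s \<in> ?S" using s \<tau> by (auto simp: t_def \<tau>_def)
        show "Complex (\<delta> + \<tau>) t \<in> ?S" using \<tau> e by auto
      qed
      also have "norm (s - Complex (\<delta> + \<tau>) t) = \<bar>Re s - (\<delta> + \<tau>)\<bar>"
        by (subst s_eq) (simp add: cmod_def)
      also have "\<dots> \<le> 2 * \<tau>" using s False unfolding \<tau>_def t_def by linarith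
      also have "B * t powr \<kappa> * (2 * \<tau>) = 2 * B * c2 * (t powr \<kappa> * t powr (- 8 * \<kappa>))"
        by (simp add: \<tau>_def)
      also have "t powr \<kappa> * t powr (- 8 * \<kappa>) = t powr (- 7 * \<kappa>)"
        by (subst powr_add[symmetric]) (simp add: algebra_simps)
      also have "2 * B * c2 * t powr (- 7 * \<kappa>) \<le> c3 * t powr (- 7 * \<kappa>)" using Bc by (intro mult_right_mono) auto
      finally have 1: "norm (Z s - Z (Complex (\<delta> + \<tau>) t)) \<le> c3 * t powr (- 7 * \<kappa>)"
        using B by (simp add: mult_left_mono)
      have 2: "2 * c3 * t powr (- 7 * \<kappa>) \<le> norm (Z (Complex (\<delta> + \<tau>) t))"
        using low[of "\<delta> + \<tau>" t] tau_pow t \<tau> by simp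
      have "norm (Z (Complex (\<delta> + \<tau>) t)) \<le> norm (Z s) + norm (Z s - Z (Complex (\<delta> + \<tau>) t))"
        using norm_triangle_ineq4[of "Z s" "Z s - Z (Complex (\<delta> + \<tau>) t)"] by simp
      thus ?thesis using 1 2 unfolding t_def by linarith
    qed
  qed
  moreover have "c2 \<le> (\<delta> - \<eta>) / 2" using c2 e by simp
  ultimately show ?thesis using c2(1) c3 B by blast
qed

end

section \<open>Subtracting zeta(s - \<delta> + 1) from the logarithmic derivative\<close>

lemma abs_conv_powr: "abs_conv (\<lambda>n. real n powr (\<delta> - 1)) \<delta>"
  unfolding abs_conv_def
proof (intro conjI allI impI)
  fix \<sigma> assume "\<sigma> > \<delta>"
  have "\<bar>real n powr (\<delta> - 1)\<bar> * real n powr (- \<sigma>) = real n powr (\<delta> - 1 - \<sigma>)" for n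
    by (simp add: powr_diff powr_minus divide_inverse)
  thus "summable (\<lambda>n. \<bar>real n powr (\<delta> - 1)\<bar> * real n powr (- \<sigma>))"
    using \<open>\<sigma> > \<delta>\<close> by (simp add: summable_real_powr_iff)
qed simp

lemma dirichlet_powr:
  assumes s: "Re s > \<delta>"
  shows "dirichlet (\<lambda>n. real n powr (\<delta> - 1)) s = zeta.Z (s - \<delta> + 1)"
proof -
  have "(\<lambda>n. (if n = 0 then 0 else 1 :: real) * dpow (s - \<delta> + 1) n) sums zeta.Z (s - \<delta> + 1)"
    by (rule zeta.Z_sums) (use s in auto)
  moreover have "(if n = 0 then 0 else 1 :: real) * dpow (s - \<delta> + 1) n = of_real (real n powr (\<delta> - 1)) * dpow s n" for n
  proof (cases "n = 0")
    case False
    have "dpow (s - \<delta> + 1) n = dpow s n * dpow (of_real (1 - \<delta>)) n"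
      by (subst dpow_add[symmetric]) (simp add: algebra_simps)
    also have "dpow (of_real (1 - \<delta>)) n = of_real (real n powr (\<delta> - 1))"
      using False by (subst dpow_of_real) auto
    finally show ?thesis using False by simp
  qed simp
  ultimately have "(\<lambda>n. of_real (real n powr (\<delta> - 1)) * dpow s n) sums zeta.Z (s - \<delta> + 1)" by (simp only:)
  thus ?thesis unfolding dirichlet_def by (rule sums_unique[symmetric])
qed

text \<open>The zeta function without its pole. The value at 1 is the limit there (Euler's
  constant), because \<open>zeta.Y\<close> is (w - 1) zeta(w) and equals 1 at w = 1.\<close>

definition zeta_reg :: "complex \<Rightarrow> complex" where
  "zeta_reg w = (if w = 1 then deriv zeta.Y 1 else zeta.Z w - 1 / (w - 1))"

lemma zeta_reg_holomorphic: "zeta_reg holomorphic_on {w. Re w > 0}"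
proof -
  have "(\<lambda>z. if z = 1 then deriv zeta.Y 1 else zeta.Z z - zeta.Y 1 / (z - 1)) holomorphic_on {w. Re w > 0}"
    by (rule pole_theorem_open[OF zeta.Y_holomorphic open_halfspace_Re_gt]) (auto simp: zeta.Z_def)
  moreover have "zeta_reg = (\<lambda>z. if z = 1 then deriv zeta.Y 1 else zeta.Z z - zeta.Y 1 / (z - 1))"
    using zeta.Y_delta by (auto simp: zeta_reg_def fun_eq_iff)
  ultimately show ?thesis by simp
qed

context euler_seq begin

(* Subtracting the coefficients of zeta(s - \<delta> + 1), and not just the polar part 1 / (s - \<delta>), keeps the
   difference a Dirichlet series. *)
definition b :: "nat \<Rightarrow> real" where "b n = L n - real n powr (\<delta> - 1)"

text \<open>This is -Z'/Z - zeta(s - \<delta> + 1), written with the two polar parts 1 / (s -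
  \<delta>) already cancelled, so that it is holomorphic at \<delta>.\<close>

definition H :: "complex \<Rightarrow> complex" where
  "H s = - (deriv Y s / Y s) - zeta_reg (s - \<delta> + 1)"

text \<open>The last condition puts s - \<delta> + 1 into the half-plane where
  \<open>zeta_reg\<close> is holomorphic.\<close>

definition U :: "complex set" where
  "U = {s. Re s > \<eta>} \<inter> Y -` (- {0}) \<inter> {s. Re s > \<delta> - 1}"

lemma abs_conv_b: "abs_conv b \<delta>"
  unfolding b_def[abs_def] by (rule abs_conv_diff[OF abs_conv_L abs_conv_powr])

lemma open_U: "open U"
  unfolding U_def
  by (intro open_Int open_halfspace_Re_gt continuous_open_preimage
      holomorphic_on_imp_continuous_on[OF Y_holomorphic]) auto

lemma H_holomorphic: "H holomorphic_on U"
proof -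
  have 1: "Y holomorphic_on U" by (rule holomorphic_on_subset[OF Y_holomorphic]) (auto simp: U_def)
  have 2: "(\<lambda>s. s - \<delta> + 1) ` U \<subseteq> {w. Re w > 0}" by (auto simp: U_def)
  have 3: "(zeta_reg \<circ> (\<lambda>s. s - \<delta> + 1)) holomorphic_on U"
    by (rule holomorphic_on_compose[OF _ holomorphic_on_subset[OF zeta_reg_holomorphic 2]]) (intro holomorphic_intros)
  show ?thesis unfolding H_def[abs_def]
    by (intro holomorphic_intros 1 holomorphic_deriv[OF 1 open_U] 3[unfolded o_def]) (auto simp: U_def)
qed

lemma dirichlet_b_eq_H:
  assumes s: "Re s > \<delta>"
  shows "dirichlet b s = H s"
proof -
  have sn: "s \<noteq> of_real \<delta>" using s by auto
  have Zn: "Z s \<noteq> 0" by (rule Z_nonzero[OF s])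
  hence Yn: "Y s \<noteq> 0" by (auto simp: Z_def)
  have "dirichlet b s = dirichlet L s - zeta.Z (s - \<delta> + 1)"
    unfolding b_def[abs_def] using dirichlet_diff[OF abs_conv_L abs_conv_powr s] dirichlet_powr[OF s] by simp
  moreover have "deriv Z s = - dirichlet L s * Z s" by (rule DERIV_imp_deriv[OF Z_has_derivative[OF s]])
  hence "dirichlet L s = - (deriv Z s / Z s)" using Zn by simp
  moreover have "- (deriv Y s / Y s) = - (deriv Z s / Z s) - 1 / (s - \<delta>)"
    by (rule log_deriv_Y) (use s eta_less sn Yn in auto)
  moreover have "zeta_reg (s - \<delta> + 1) = zeta.Z (s - \<delta> + 1) - 1 / (s - \<delta>)"
    using sn by (simp add: zeta_reg_def)
  ultimately show ?thesis by (simp add: H_def)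
qed

lemma higher_deriv_b:
  assumes s: "Re s > \<delta>"
  shows "(- 1) ^ k * dirichlet (\<lambda>n. b n * ln (real n) ^ k) s = (deriv ^^ k) H s"
proof -
  have sub: "{s. Re s > \<delta>} \<subseteq> U"
    using eta_less Z_nonzero by (force simp: U_def Z_def)
  have "(deriv ^^ k) (dirichlet b) s = (deriv ^^ k) H s"
    by (rule higher_deriv_transform_within_open[OF dirichlet_holomorphic[OF abs_conv_b] holomorphic_on_subset[OF H_holomorphic sub] open_halfspace_Re_gt])
       (use s dirichlet_b_eq_H in auto)
  thus ?thesis using higher_deriv_dirichlet[OF abs_conv_b s] by simp
qed

text \<open>On a disc of radius r of order t^(-8\<kappa>) around s, \<open>Z_lower\<close> gives H =
  O(t^(8\<kappa>)). Cauchy's inequality for the k-th derivative divides by r^k, so the total is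
  O(t^(8\<kappa>(k+1))).\<close>

lemma H_bound_large:
  "\<exists>B>0. \<forall>s. Im s \<ge> 4 \<longrightarrow> \<delta> < Re s \<longrightarrow> Re s \<le> \<delta> + 1 / 4 \<longrightarrow> norm ((deriv ^^ k) H s) \<le> B * Im s powr (1 / 2)"
proof -
  \<comment> \<open>Makes 8 \<kappa> (k + 1) equal to 1/2.\<close>
  define \<kappa> :: real where "\<kappa> = 1 / (16 * (real k + 1))"
  have k: "\<kappa> > 0" by (simp add: \<kappa>_def)
  obtain c2 c3 B where c: "c2 > 0" "c2 \<le> (\<delta> - \<eta>) / 2" "c3 > 0" "B > 0"
    and low: "\<And>s. Im s \<ge> 2 \<Longrightarrow> Re s \<ge> \<delta> - c2 * Im s powr (- 8 * \<kappa>) \<Longrightarrow> Re s \<le> \<delta> + 1 / 2 \<Longrightarrow>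
      norm (Z s) \<ge> c3 * Im s powr (- 7 * \<kappa>) \<and> norm (deriv Z s) \<le> B * Im s powr \<kappa>"
    using Z_lower[OF k] by blast
  obtain e B' where e: "e > 0" "e \<le> (1 - 0) / 2" "B' > 0"
    and zb: "\<And>s. Im s \<ge> 2 \<Longrightarrow> Re s \<ge> 1 - e \<Longrightarrow> Re s \<le> 1 + 1 / 2 \<Longrightarrow> norm (zeta.Z s) \<le> B' * Im s powr \<kappa>"
    using zeta.Z_growth[OF k] by blast
  \<comment> \<open>The factor 2^(-8\<kappa>) is there because points of the disc may have imaginary
    part up to 2t, where the region of \<open>Z_lower\<close> is narrower.\<close>
  define c4 where "c4 = min (1 / 4) (min e (c2 * 2 powr (- 8 * \<kappa>)))"
  have c4: "c4 > 0" "c4 \<le> 1 / 4" "c4 \<le> e" "c4 \<le> c2 * 2 powr (- 8 * \<kappa>)" using e c by (auto simp: c4_def)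
  define B5 where "B5 = B / c3 * 2 powr (8 * \<kappa>) + B' * 2 powr (8 * \<kappa>) + 2"
  have B5: "B5 > 0" unfolding B5_def using c e by (intro add_nonneg_pos add_nonneg_nonneg) auto
  define B6 where "B6 = fact k * B5 / c4 ^ k"
  have B6: "B6 > 0" using B5 c4 by (simp add: B6_def)
  have "norm ((deriv ^^ k) H s) \<le> B6 * Im s powr (1 / 2)"
    if s: "Im s \<ge> 4" "\<delta> < Re s" "Re s \<le> \<delta> + 1 / 4" for s
  proof -
    define t where "t = Im s"
    have t: "t \<ge> 4" using s by (simp add: t_def)
    define r where "r = c4 * t powr (- 8 * \<kappa>)"
    have "t powr (- 8 * \<kappa>) \<le> t powr 0" using t k by (intro powr_mono) auto
    hence "r \<le> c4 * 1" unfolding r_def using c4 t by (intro mult_left_mono) auto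
    hence r: "r \<le> 1 / 4" "r \<le> e" using c4 by linarith+
    have r0: "r > 0" using c4 t by (simp add: r_def)
    note r = r0 r
    have pt: "x \<in> U \<and> norm (H x) \<le> B5 * t powr (8 * \<kappa>)" if "norm (s - x) \<le> r" for x
    proof -
      have n: "\<bar>Re x - Re s\<bar> \<le> r" "\<bar>Im x - Im s\<bar> \<le> r"
        using abs_Re_le_cmod[of "s - x"] abs_Im_le_cmod[of "s - x"] that by auto
      define u where "u = Im x"
      have u: "u \<ge> 2" "u \<le> 2 * t" using n r t by (auto simp: u_def t_def)
      have "r \<le> c2 * (2 * t) powr (- 8 * \<kappa>)"
        unfolding r_def using c4 t by (simp add: powr_mult mult.assoc[symmetric] mult_right_mono)
      also have "\<dots> \<le> c2 * u powr (- 8 * \<kappa>)" using u k c by (intro mult_left_mono powr_mono2') auto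
      finally have ru: "r \<le> c2 * u powr (- 8 * \<kappa>)" .
      have xr: "Re x \<ge> \<delta> - r" "Re x \<le> \<delta> + 1 / 2" using n s r by linarith+
      have lo: "norm (Z x) \<ge> c3 * u powr (- 7 * \<kappa>)" "norm (deriv Z x) \<le> B * u powr \<kappa>"
        using low[of x] u ru xr by (auto simp: u_def)
      have zx: "norm (zeta.Z (x - \<delta> + 1)) \<le> B' * u powr \<kappa>"
        using zb[of "x - \<delta> + 1"] u xr r by (simp add: u_def)
      have "c2 * u powr (- 8 * \<kappa>) \<le> c2 * u powr 0" using u k c by (intro mult_left_mono powr_mono) auto
      also have "\<dots> = c2" using u by simp
      finally have "r \<le> (\<delta> - \<eta>) / 2" using ru c by linarith
      hence xe: "Re x > \<eta>" using xr eta_less by (simp add: field_simps)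
      have xd: "x \<noteq> of_real \<delta>" using u by (auto simp: u_def)
      have "c3 * u powr (- 7 * \<kappa>) > 0" using c u by simp
      hence "norm (Z x) > 0" using lo by linarith
      hence Zx: "Z x \<noteq> 0" by simp
      hence Yx: "Y x \<noteq> 0" by (auto simp: Z_def)
      have xU: "x \<in> U" using xe Yx xr r by (auto simp: U_def)
      have xd1: "norm (1 / (x - \<delta>)) \<le> 1"
        using abs_Im_le_cmod[of "x - \<delta>"] u xd by (simp add: norm_divide u_def divide_le_eq)
      have u1: "u powr \<kappa> \<le> (2 * t) powr (8 * \<kappa>)"
      proof -
        have "u powr \<kappa> \<le> u powr (8 * \<kappa>)" using u k by (intro powr_mono) auto
        also have "\<dots> \<le> (2 * t) powr (8 * \<kappa>)" using u k by (intro powr_mono2) auto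
        finally show ?thesis .
      qed
      have "norm (deriv Z x / Z x) \<le> (B * u powr \<kappa>) / (c3 * u powr (- 7 * \<kappa>))"
        unfolding norm_divide using lo c u by (intro frac_le) auto
      also have "\<dots> = B / c3 * u powr (8 * \<kappa>)"
      proof -
        have "u powr \<kappa> / u powr (- 7 * \<kappa>) = u powr (8 * \<kappa>)" by (subst powr_diff[symmetric]) simp
        thus ?thesis by (metis times_divide_times_eq)
      qed
      also have "\<dots> \<le> B / c3 * (2 * t) powr (8 * \<kappa>)"
        using u k c by (intro mult_left_mono powr_mono2) auto
      finally have a1: "norm (deriv Z x / Z x) \<le> B / c3 * (2 * t) powr (8 * \<kappa>)" .
      have a2: "norm (zeta.Z (x - \<delta> + 1)) \<le> B' * (2 * t) powr (8 * \<kappa>)"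
        using zx mult_left_mono[OF u1, of B'] e by linarith
      have "H x = - (deriv Z x / Z x) - zeta.Z (x - \<delta> + 1)"
        using log_deriv_Y[OF xe xd Yx] xd by (simp add: H_def zeta_reg_def)
      hence "norm (H x) \<le> norm (deriv Z x / Z x) + norm (zeta.Z (x - \<delta> + 1))"
        using norm_triangle_ineq4[of "- (deriv Z x / Z x)" "zeta.Z (x - \<delta> + 1)"] by simp
      also have "\<dots> \<le> (B / c3 + B') * (2 * t) powr (8 * \<kappa>)" using a1 a2 by (simp add: algebra_simps)
      also have "\<dots> = (B / c3 * 2 powr (8 * \<kappa>) + B' * 2 powr (8 * \<kappa>)) * t powr (8 * \<kappa>)"
        using t by (simp add: powr_mult algebra_simps)
      also have "\<dots> \<le> B5 * t powr (8 * \<kappa>)" unfolding B5_def by (intro mult_right_mono) auto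
      finally show ?thesis using xU by simp
    qed
    have sub: "cball s r \<subseteq> U" using pt by (auto simp: dist_norm)
    have "norm ((deriv ^^ k) H s) \<le> fact k * (B5 * t powr (8 * \<kappa>)) / r ^ k"
    proof (rule Cauchy_inequality)
      show "H holomorphic_on ball s r"
        by (rule holomorphic_on_subset[OF H_holomorphic]) (use sub ball_subset_cball in blast)
      show "continuous_on (cball s r) H"
        by (rule holomorphic_on_imp_continuous_on, rule holomorphic_on_subset[OF H_holomorphic sub])
    qed (use pt r in auto)
    also have "\<dots> = B6 * (t powr (8 * \<kappa>) / (t powr (- 8 * \<kappa>)) ^ k)"
      by (simp add: B6_def r_def power_mult_distrib)
    also have "(t powr (- 8 * \<kappa>)) ^ k = t powr (- 8 * \<kappa> * real k)" using t by (simp add: powr_power mult_ac)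
    also have "t powr (8 * \<kappa>) / \<dots> = t powr (8 * \<kappa> - (- 8 * \<kappa> * real k))" by (rule powr_diff[symmetric])
    also have "8 * \<kappa> - (- 8 * \<kappa> * real k) = 1 / 2"
    proof -
      have "8 * \<kappa> - (- 8 * \<kappa> * real k) = 8 * (\<kappa> * (real k + 1))" by (simp add: algebra_simps)
      also have "\<kappa> * (real k + 1) = 1 / 16" unfolding \<kappa>_def by (simp add: field_simps)
      finally show ?thesis by simp
    qed
    finally show ?thesis by (simp add: t_def)
  qed
  thus ?thesis using B6 by blast
qed

text \<open>For Im s \<ge> 4 this is \<open>H_bound_large\<close>. Below 4, H is holomorphic on a
  neighbourhood of a compact box that includes a segment of the line Re s = \<delta>, so its
  derivatives are bounded there; this is where \<open>Y_nonzero\<close> is needed.\<close>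

lemma b_series_bound:
  "\<exists>B>0. \<forall>s. Im s \<ge> 0 \<longrightarrow> \<delta> < Re s \<longrightarrow> Re s \<le> \<delta> + 1 / 4 \<longrightarrow>
     norm (dirichlet (\<lambda>n. b n * ln (real n) ^ k) s) \<le> B * (1 + Im s) powr (1 / 2)"
proof -
  obtain B where B: "B > 0" "\<And>s. Im s \<ge> 4 \<Longrightarrow> \<delta> < Re s \<Longrightarrow> Re s \<le> \<delta> + 1 / 4 \<Longrightarrow>
     norm ((deriv ^^ k) H s) \<le> B * Im s powr (1 / 2)"
    using H_bound_large by blast
  let ?K = "cbox (Complex \<delta> 0) (Complex (\<delta> + 1 / 4) 4)"
  have KU: "?K \<subseteq> U" using eta_less by (auto simp: U_def in_cbox_complex_iff Y_nonzero)
  have "compact ((deriv ^^ k) H ` ?K)"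
    by (intro compact_continuous_image compact_cbox continuous_on_subset[OF _ KU]
        holomorphic_on_imp_continuous_on holomorphic_higher_deriv H_holomorphic open_U)
  from compact_imp_bounded[OF this] obtain B1 where B1: "B1 > 0" "\<And>s. s \<in> ?K \<Longrightarrow> norm ((deriv ^^ k) H s) \<le> B1"
    unfolding bounded_pos by auto
  have "norm (dirichlet (\<lambda>n. b n * ln (real n) ^ k) s) \<le> (B + B1) * (1 + Im s) powr (1 / 2)"
    if s: "Im s \<ge> 0" "\<delta> < Re s" "Re s \<le> \<delta> + 1 / 4" for s
  proof -
    have "norm (dirichlet (\<lambda>n. b n * ln (real n) ^ k) s) = norm ((- 1) ^ k * dirichlet (\<lambda>n. b n * ln (real n) ^ k) s)"
      by (simp add: norm_mult norm_power)
    also have "\<dots> = norm ((deriv ^^ k) H s)" unfolding higher_deriv_b[OF s(2)] ..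
    also have "\<dots> \<le> (B + B1) * (1 + Im s) powr (1 / 2)"
    proof (cases "Im s \<ge> 4")
      case True
      have "norm ((deriv ^^ k) H s) \<le> B * Im s powr (1 / 2)" using B(2) True s by blast
      also have "\<dots> \<le> (B + B1) * (1 + Im s) powr (1 / 2)"
        using B(1) B1(1) True by (intro mult_mono powr_mono2) auto
      finally show ?thesis .
    next
      case False
      have "norm ((deriv ^^ k) H s) \<le> B1" using False s by (intro B1) (auto simp: in_cbox_complex_iff)
      also have "\<dots> \<le> (B + B1) * 1" using B(1) by simp
      also have "\<dots> \<le> (B + B1) * (1 + Im s) powr (1 / 2)"
        using B(1) B1(1) s by (intro mult_left_mono ge_one_powr_ge_zero) auto
      finally show ?thesis .
    qed
    finally show ?thesis .
  qed
  moreover have "B + B1 > 0" using B B1 by simp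
  ultimately show ?thesis by blast
qed

end

section \<open>A Tauberian argument with error term\<close>

abbreviation half_line :: "real measure" where "half_line \<equiv> restrict_space lborel {0..}"

text \<open>The integrand combines the growth t^(1/2) of the Dirichlet series with the decay 1/t^2
  of the kernel. It is at most 2 (1 + t)^(-3/2), as (1 + t)^2 \<le> 2 (1 + t^2).\<close>

lemma integrable_half_line_majorant: "integrable half_line (\<lambda>t. (1 + t) powr (1 / 2) / (1 + t\<^sup>2))"
proof -
  have nn: "(\<integral>\<^sup>+x. ennreal ((1 + \<bar>x\<bar>) powr (- 3 / 2)) * indicator {0..} x \<partial>lborel) = ennreal (0 - (- 2 * (1 + 0) powr (- 1 / 2)))"
  proof -
    define f F :: "real \<Rightarrow> real" where "f = (\<lambda>x. (1 + \<bar>x\<bar>) powr (- 3 / 2))" and "F = (\<lambda>x. - 2 * (1 + x) powr (- 1 / 2))"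
    have "(\<integral>\<^sup>+x. ennreal (f x) * indicator {0..} x \<partial>lborel) = ennreal (0 - F 0)"
    proof (rule nn_integral_FTC_atLeast)
      show "(F has_real_derivative f x) (at x)" if "0 \<le> x" for x :: real
        using that unfolding f_def F_def by (auto intro!: derivative_eq_intros)
      show "(F \<longlongrightarrow> 0) at_top" unfolding F_def by real_asymp
    qed (auto simp: f_def)
    thus ?thesis by (simp only: f_def F_def)
  qed
  have "integrable lborel (\<lambda>x. indicator {0..} x *\<^sub>R (1 + \<bar>x\<bar>) powr (- 3 / 2) :: real)"
  proof (rule integrableI_bounded)
    have "(\<integral>\<^sup>+ x. ennreal (norm (indicator {0..} x *\<^sub>R (1 + \<bar>x\<bar>) powr (- 3 / 2) :: real)) \<partial>lborel) =
       (\<integral>\<^sup>+x. ennreal ((1 + \<bar>x\<bar>) powr (- 3 / 2)) * indicator {0..} x \<partial>lborel)"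
      by (intro nn_integral_cong) (auto split: split_indicator)
    thus "(\<integral>\<^sup>+ x. ennreal (norm (indicator {0..} x *\<^sub>R (1 + \<bar>x\<bar>) powr (- 3 / 2) :: real)) \<partial>lborel) < \<infinity>"
      using nn by simp
  qed simp
  hence 1: "integrable half_line (\<lambda>x. (1 + \<bar>x\<bar>) powr (- 3 / 2) :: real)"
    by (subst integrable_restrict_space) auto
  show ?thesis
  proof (rule Bochner_Integration.integrable_bound)
    show "integrable half_line (\<lambda>x. 2 * (1 + \<bar>x\<bar>) powr (- 3 / 2) :: real)" using 1 by simp
    show "(\<lambda>t. (1 + t) powr (1 / 2) / (1 + t\<^sup>2)) \<in> borel_measurable half_line"
      by (intro measurable_restrict_space1) simp
    show "AE t in half_line. norm ((1 + t) powr (1 / 2) / (1 + t\<^sup>2)) \<le> norm (2 * (1 + \<bar>t\<bar>) powr (- 3 / 2))"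
    proof (rule AE_I2)
      fix t :: real assume "t \<in> space half_line"
      hence t: "t \<ge> 0" by (simp add: space_restrict_space)
      have p: "1 + t\<^sup>2 > 0" using zero_le_power2[of t] by linarith
      have "(1 + t) powr (1 / 2) = (1 + t) powr (- 3 / 2) * (1 + t) powr 2"
        by (subst powr_add[symmetric]) simp
      also have "(1 + t) powr 2 = (1 + t)\<^sup>2" using t by simp
      also have "(1 + t)\<^sup>2 \<le> 2 * (1 + t\<^sup>2)"
        using zero_le_power2[of "1 - t"] by (simp add: power2_eq_square algebra_simps)
      finally have "(1 + t) powr (1 / 2) \<le> (1 + t) powr (- 3 / 2) * (2 * (1 + t\<^sup>2))"
        by (simp add: mult_left_mono)
      hence "(1 + t) powr (1 / 2) / (1 + t\<^sup>2) \<le> 2 * (1 + t) powr (- 3 / 2)"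
        using p by (simp add: pos_divide_le_eq algebra_simps)
      thus "norm ((1 + t) powr (1 / 2) / (1 + t\<^sup>2)) \<le> norm (2 * (1 + \<bar>t\<bar>) powr (- 3 / 2))"
        using t p by simp
    qed
  qed
qed

text \<open>The Fejer kernel without normalisation. Its integral over t \<ge> 0 is proportional to
  |a|, so linear combinations over several a yield piecewise linear functions.\<close>

definition fejer :: "real \<Rightarrow> real \<Rightarrow> real" where
  "fejer a t = (1 - cos (a * t)) / t\<^sup>2"

lemma fejer_measurable [measurable]: "fejer a \<in> borel_measurable borel"
  unfolding fejer_def[abs_def] by measurable

lemma one_minus_cos_le: "1 - cos x \<le> x\<^sup>2 / 2" for x :: real
proof -
  have "1 - cos x = 2 * (sin (x / 2))\<^sup>2" using cos_double_sin[of "x / 2"] by simp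
  also have "(sin (x / 2))\<^sup>2 \<le> (x / 2)\<^sup>2"
    using abs_sin_x_le_abs_x[of "x / 2"] by (subst abs_le_square_iff[symmetric])
  finally show ?thesis by (simp add: power_divide)
qed

lemma cross_mult_le: "q > 0 \<Longrightarrow> p > 0 \<Longrightarrow> x * p \<le> m * q \<Longrightarrow> x / q \<le> m / (p::real)"
  by (simp add: pos_divide_le_eq pos_le_divide_eq mult_ac)

text \<open>Two estimates are added: 1 - cos(at) \<le> (at)^2 serves near 0, and 1 - cos(at) \<le> 4
  far away.\<close>

lemma fejer_bound: "\<bar>fejer a t\<bar> \<le> (a\<^sup>2 + 4) / (1 + t\<^sup>2)"
proof (cases "t = 0")
  case True thus ?thesis by (simp add: fejer_def)
next
  case False
  have t2: "t\<^sup>2 > 0" using False by simp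
  have nn: "fejer a t \<ge> 0" by (simp add: fejer_def)
  have "(1 - cos (a * t)) * (1 + t\<^sup>2) \<le> (a\<^sup>2 + 4) * t\<^sup>2"
  proof -
    have "1 - cos (a * t) \<le> (a * t)\<^sup>2" using one_minus_cos_le[of "a * t"] zero_le_power2[of "a * t"] by linarith
    moreover have "1 - cos (a * t) \<le> 4" using cos_ge_minus_one[of "a * t"] by linarith
    hence "(1 - cos (a * t)) * t\<^sup>2 \<le> 4 * t\<^sup>2" by (rule mult_right_mono) simp
    ultimately show ?thesis by (simp add: power_mult_distrib algebra_simps)
  qed
  moreover have "1 + t\<^sup>2 > 0" using t2 by linarith
  ultimately have "fejer a t \<le> (a\<^sup>2 + 4) / (1 + t\<^sup>2)" unfolding fejer_def by (intro cross_mult_le t2)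
  with nn show ?thesis by simp
qed

lemma integrable_rational_half_line: "integrable half_line (\<lambda>t. B / (1 + t\<^sup>2))"
proof (rule Bochner_Integration.integrable_bound)
  show "integrable half_line (\<lambda>t. \<bar>B\<bar> * ((1 + t) powr (1 / 2) / (1 + t\<^sup>2)))"
    by (rule Bochner_Integration.integrable_mult_right[OF integrable_half_line_majorant])
  show "(\<lambda>t. B / (1 + t\<^sup>2)) \<in> borel_measurable half_line" by (intro measurable_restrict_space1) simp
  show "AE t in half_line. norm (B / (1 + t\<^sup>2)) \<le> norm (\<bar>B\<bar> * ((1 + t) powr (1 / 2) / (1 + t\<^sup>2)))"
  proof (rule AE_I2)
    fix t :: real assume "t \<in> space half_line"
    hence t: "t \<ge> 0" by (simp add: space_restrict_space)
    have p: "1 + t\<^sup>2 > 0" using zero_le_power2[of t] by linarith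
    have "\<bar>B\<bar> * 1 \<le> \<bar>B\<bar> * (1 + t) powr (1 / 2)"
      using t by (intro mult_left_mono ge_one_powr_ge_zero) auto
    thus "norm (B / (1 + t\<^sup>2)) \<le> norm (\<bar>B\<bar> * ((1 + t) powr (1 / 2) / (1 + t\<^sup>2)))"
      using p by (simp add: divide_right_mono)
  qed
qed

lemma fejer_integrable: "integrable half_line (fejer a)"
  by (rule Bochner_Integration.integrable_bound[OF integrable_rational_half_line[of "a\<^sup>2 + 4"]])
     (auto intro!: measurable_restrict_space1 AE_I2 order_trans[OF fejer_bound])

(* Equal to pi / 2, but only its positivity matters. *)
definition fejer_const :: real where "fejer_const = (\<integral>t. fejer 1 t \<partial>half_line)"

text \<open>The substitution of a t for t gives the factor a when a > 0; the kernel is even in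
  a.\<close>

lemma fejer_integral: "(\<integral>t. fejer a t \<partial>half_line) = fejer_const * \<bar>a\<bar>"
proof -
  have pos: "(\<integral>t. fejer a t \<partial>half_line) = fejer_const * a" if a: "a > 0" for a
  proof -
    have "fejer_const = (\<integral>t. indicator {0..} t *\<^sub>R fejer 1 t \<partial>lborel)"
      unfolding fejer_const_def by (subst integral_restrict_space) auto
    also have "\<dots> = \<bar>a\<bar> *\<^sub>R (\<integral>t. indicator {0..} (0 + a * t) *\<^sub>R fejer 1 (0 + a * t) \<partial>lborel)"
      by (rule lborel_integral_real_affine) (use a in auto)
    also have "(\<lambda>t. indicator {0..} (0 + a * t) *\<^sub>R fejer 1 (0 + a * t) :: real) = (\<lambda>t. (indicator {0..} t *\<^sub>R fejer a t) / a\<^sup>2)"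
      using a by (auto simp: fun_eq_iff fejer_def indicator_def power_mult_distrib zero_le_mult_iff)
    also have "(\<integral>t. (indicator {0..} t *\<^sub>R fejer a t) / a\<^sup>2 \<partial>lborel) = (\<integral>t. indicator {0..} t *\<^sub>R fejer a t \<partial>lborel) / a\<^sup>2"
      by (rule integral_divide_zero)
    also have "(\<integral>t. indicator {0..} t *\<^sub>R fejer a t \<partial>lborel) = (\<integral>t. fejer a t \<partial>half_line)"
      by (subst integral_restrict_space) auto
    finally show ?thesis using a by (simp add: field_simps power2_eq_square)
  qed
  consider "a > 0" | "a = 0" | "- a > 0" by linarith
  thus ?thesis
  proof cases
    case 1 thus ?thesis using pos[of a] by simp
  next
    case 2 thus ?thesis by (simp add: fejer_def)
  next
    case 3
    have "fejer a = fejer (- a)" by (simp add: fejer_def fun_eq_iff)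
    thus ?thesis using pos[OF 3] 3 by simp
  qed
qed

text \<open>The integrand is nonnegative, and on [1, 2] it is at least (1 - cos 1)/4 > 0.\<close>

lemma fejer_const_pos: "fejer_const > 0"
proof -
  have c1: "cos (1::real) < 1" using cos_monotone_0_pi[of 0 1] pi_gt3 by simp
  have "(\<integral>t. indicator {1..2} t * ((1 - cos 1) / 4) \<partial>half_line) \<le> (\<integral>t. fejer 1 t \<partial>half_line)"
  proof (rule integral_mono_AE)
    show "integrable half_line (\<lambda>t. indicator {1..2} t * ((1 - cos 1) / 4) :: real)"
    proof (rule Bochner_Integration.integrable_bound[OF integrable_rational_half_line[of 10]])
      show "(\<lambda>t. indicator {1..2} t * ((1 - cos 1) / 4) :: real) \<in> borel_measurable half_line"
        by (intro measurable_restrict_space1) simp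
      have "\<bar>indicator {1..2} t * ((1 - cos 1) / 4)\<bar> \<le> \<bar>10 / (1 + t\<^sup>2)\<bar>" for t :: real
      proof (cases "t \<in> {1..2}")
        case True
        hence "t\<^sup>2 \<le> 2\<^sup>2" by (intro power_mono) auto
        moreover have "1 + t\<^sup>2 > 0" using zero_le_power2[of t] by linarith
        ultimately have "10 / (1 + t\<^sup>2) \<ge> 1" by (simp add: divide_simps)
        moreover have "\<bar>(1 - c) / 4\<bar> \<le> 1" if "c < 1" "- 1 \<le> c" for c :: real
          using that by (auto simp: abs_le_iff field_simps)
        from this[OF c1 cos_ge_minus_one] have "\<bar>(1 - cos 1) / 4\<bar> \<le> (1::real)" .
        ultimately show ?thesis using True by simp
      qed auto
      thus "AE t in half_line. norm (indicator {1..2} t * ((1 - cos 1) / 4) :: real) \<le> norm (10 / (1 + t\<^sup>2))"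
        by (intro AE_I2) simp
    qed
    show "integrable half_line (fejer 1)" by (rule fejer_integrable)
    have "indicator {1..2} t * ((1 - cos 1) / 4) \<le> fejer 1 t" for t :: real
    proof (cases "t \<in> {1..2}")
      case True
      have "cos t \<le> cos 1" using True pi_gt3 by (intro cos_monotone_0_pi_le) auto
      moreover have "t\<^sup>2 \<le> 2\<^sup>2" using True by (intro power_mono) auto
      ultimately have "(1 - cos 1) / 4 \<le> (1 - cos t) / t\<^sup>2"
        using True c1 by (intro frac_le) auto
      thus ?thesis using True by (simp add: fejer_def)
    qed (simp add: fejer_def)
    thus "AE t in half_line. indicator {1..2} t * ((1 - cos 1) / 4) \<le> fejer 1 t" by (intro AE_I2) simp
  qed
  moreover have "(\<integral>t. indicator {1..2::real} t * (q :: real) \<partial>half_line) = q" for q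
  proof -
    have "(\<integral>t. indicator {1..2::real} t * (q :: real) \<partial>half_line) =
      (\<integral>t. indicator {0..} t *\<^sub>R (indicator {1..2::real} t * (q :: real)) \<partial>lborel)"
      by (subst integral_restrict_space) auto
    also have "(\<lambda>t. indicator {0..} t *\<^sub>R (indicator {1..2::real} t * (q :: real)) :: real) = (\<lambda>t. indicator {1..2::real} t * (q :: real))"
      by (auto simp: fun_eq_iff indicator_def)
    also have "(\<integral>t. indicator {1..2::real} t * (q :: real) \<partial>lborel) = q"
      by simp
    finally show ?thesis .
  qed
  ultimately have "(1 - cos 1) / 4 \<le> fejer_const" by (simp only: fejer_const_def)
  moreover have "0 < (1 - cos 1) / (4::real)" using c1 by simp
  ultimately show ?thesis by (rule less_le_trans[rotated])
qed

text \<open>For u \<ge> 0 this is 1 up to v, 0 from v + h on, and linear in between. It is written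
  with absolute values because these are what \<open>fejer_integral\<close> produces.\<close>

definition trapezoid :: "real \<Rightarrow> real \<Rightarrow> real \<Rightarrow> real" where
  "trapezoid v h u = (\<bar>u + v + h\<bar> + \<bar>u - v - h\<bar> - \<bar>u + v\<bar> - \<bar>u - v\<bar>) / (2 * h)"

lemma trapezoid_1: "h > 0 \<Longrightarrow> v \<ge> 0 \<Longrightarrow> 0 \<le> u \<Longrightarrow> u \<le> v \<Longrightarrow> trapezoid v h u = 1"
  by (simp add: trapezoid_def)

lemma trapezoid_0: "h > 0 \<Longrightarrow> v \<ge> 0 \<Longrightarrow> v + h \<le> u \<Longrightarrow> trapezoid v h u = 0"
  by (simp add: trapezoid_def)

lemma trapezoid_bounds: "h > 0 \<Longrightarrow> v \<ge> 0 \<Longrightarrow> 0 \<le> u \<Longrightarrow> 0 \<le> trapezoid v h u \<and> trapezoid v h u \<le> 1"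
  by (auto simp: trapezoid_def divide_simps abs_if)

text \<open>Up to the factor \<open>fejer_const * h\<close>, the function whose cosine transform is
  the trapezoid. It decays like 1/t^2; a sharp cut would give only 1/t, too little against the
  growth t^(1/2).\<close>

definition kern :: "real \<Rightarrow> real \<Rightarrow> real \<Rightarrow> real" where
  "kern v h t = (cos (v * t) - cos ((v + h) * t)) / t\<^sup>2"

lemma kern_measurable [measurable]: "kern v h \<in> borel_measurable borel"
  unfolding kern_def[abs_def] by measurable

text \<open>Product-to-sum formulas, with two ones added and two subtracted so that every cosine
  becomes a Fejer kernel.\<close>

lemma cos_kern: "cos (t * u) * kern v h t =
   (fejer (u + v + h) t + fejer (u - v - h) t - fejer (u + v) t - fejer (u - v) t) / 2"
proof -
  have "2 * (cos (t * u) * (cos (v * t) - cos ((v + h) * t))) =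
    (1 - cos ((u + v + h) * t)) + (1 - cos ((u - v - h) * t)) - (1 - cos ((u + v) * t)) - (1 - cos ((u - v) * t))"
    by (simp add: cos_times_cos algebra_simps add_divide_distrib)
  moreover have "cos (t * u) * kern v h t = 2 * (cos (t * u) * (cos (v * t) - cos ((v + h) * t))) / t\<^sup>2 / 2"
    by (simp add: kern_def)
  ultimately show ?thesis by (simp only: fejer_def add_divide_distrib diff_divide_distrib)
qed

lemma kern_integral: "h > 0 \<Longrightarrow> (\<integral>t. cos (t * u) * kern v h t \<partial>half_line) = fejer_const * h * trapezoid v h u"
  unfolding cos_kern
  by (simp add: fejer_integrable fejer_integral trapezoid_def field_simps)

text \<open>Near 0 the difference of cosines is a product of two sines, one of which carries the
  factor h; far away it is bounded. After division by h the numerator becomes 2 (v + 1) + 4/h, which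
  is where the bound v + 1 + 1/h below comes from.\<close>

lemma kern_bound:
  assumes "h > 0" "h \<le> 1" "v \<ge> 0"
  shows "\<bar>kern v h t\<bar> \<le> (2 * h * (v + 1) + 4) / (1 + t\<^sup>2)"
proof (cases "t = 0")
  case True thus ?thesis using assms by (simp add: kern_def)
next
  case False
  have t2: "t\<^sup>2 > 0" using False by simp
  define D where "D = \<bar>cos (v * t) - cos ((v + h) * t)\<bar>"
  have D1: "D \<le> 2 * h * (v + 1) * t\<^sup>2"
  proof -
    have "D = 2 * \<bar>sin ((v * t + (v + h) * t) / 2)\<bar> * \<bar>sin (((v + h) * t - v * t) / 2)\<bar>"
      unfolding D_def cos_diff_cos by (simp add: abs_mult)
    also have "\<dots> \<le> 2 * \<bar>(v * t + (v + h) * t) / 2\<bar> * \<bar>((v + h) * t - v * t) / 2\<bar>"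
      by (intro mult_mono abs_sin_x_le_abs_x) auto
    also have "\<dots> = (2 * v + h) * h / 2 * t\<^sup>2"
    proof -
      have "\<bar>(v * t + (v + h) * t) / 2\<bar> = (2 * v + h) * \<bar>t\<bar> / 2"
      proof -
        have "v * t + (v + h) * t = (2 * v + h) * t" by (simp add: algebra_simps)
        thus ?thesis using assms by (simp only: abs_divide abs_mult)
      qed
      moreover have "\<bar>((v + h) * t - v * t) / 2\<bar> = h * \<bar>t\<bar> / 2" using assms by (simp add: algebra_simps abs_mult)
      moreover have "\<bar>t\<bar> * \<bar>t\<bar> = t\<^sup>2" by (simp add: power2_eq_square)
      ultimately show ?thesis by (simp add: algebra_simps)
    qed
    also have "\<dots> \<le> 2 * h * (v + 1) * t\<^sup>2"
    proof (rule mult_right_mono)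
      have "(2 * v + h) * h \<le> (2 * v + 1) * h" using assms by (intro mult_right_mono) auto
      also have "\<dots> \<le> (4 * (v + 1)) * h" using assms by (intro mult_right_mono) auto
      finally show "(2 * v + h) * h / 2 \<le> 2 * h * (v + 1)" by (simp add: algebra_simps)
    qed simp
    finally show ?thesis .
  qed
  have D2: "D \<le> 4" unfolding D_def
    using cos_ge_minus_one[of "v * t"] cos_ge_minus_one[of "(v + h) * t"] cos_le_one[of "v * t"] cos_le_one[of "(v + h) * t"] by linarith
  have "D * (1 + t\<^sup>2) \<le> (2 * h * (v + 1) + 4) * t\<^sup>2"
    using D1 mult_right_mono[OF D2, of "t\<^sup>2"] by (simp add: algebra_simps)
  moreover have "1 + t\<^sup>2 > 0" using t2 by linarith
  ultimately have "D / t\<^sup>2 \<le> (2 * h * (v + 1) + 4) / (1 + t\<^sup>2)" by (intro cross_mult_le t2)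
  thus ?thesis by (simp add: kern_def D_def)
qed

section \<open>Smoothed sums up to the boundary line\<close>

context euler_seq begin

text \<open>The real part of the Dirichlet series at \<delta> + \<tau> + it is multiplied by
  \<open>kern\<close> and integrated over t \<ge> 0. Termwise this produces the trapezoid, by
  \<open>kern_integral\<close>; as a whole it is bounded by \<open>b_series_bound\<close> and
  \<open>kern_bound\<close>. K is independent of \<tau>, which permits \<tau> -> 0
  afterwards.\<close>

lemma smoothed_b_bound_shifted:
  "\<exists>K>0. \<forall>\<tau> v h. 0 < \<tau> \<longrightarrow> \<tau> \<le> 1 / 4 \<longrightarrow> 0 \<le> v \<longrightarrow> 0 < h \<longrightarrow> h \<le> 1 \<longrightarrow>
     \<bar>\<Sum>n. b n * ln (real n) ^ k * real n powr (- (\<delta> + \<tau>)) * trapezoid v h (ln (real n))\<bar> \<le> K * (v + 1 + 1 / h)"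
proof -
  obtain B where B: "B > 0" "\<And>s. Im s \<ge> 0 \<Longrightarrow> \<delta> < Re s \<Longrightarrow> Re s \<le> \<delta> + 1 / 4 \<Longrightarrow>
     norm (dirichlet (\<lambda>n. b n * ln (real n) ^ k) s) \<le> B * (1 + Im s) powr (1 / 2)"
    using b_series_bound by blast
  define a where "a = (\<lambda>n. b n * ln (real n) ^ k)"
  have a: "abs_conv a \<delta>" unfolding a_def by (rule abs_conv_mult_ln_power[OF abs_conv_b])
  define G where "G = (\<integral>t. (1 + t) powr (1 / 2) / (1 + t\<^sup>2) \<partial>half_line)"
  have G: "G \<ge> 0" unfolding G_def by (intro integral_nonneg_AE AE_I2) (auto intro!: divide_nonneg_nonneg add_nonneg_nonneg)
  define K where "K = 4 * B * G / fejer_const + 1"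
  have K: "K > 0" unfolding K_def using B G fejer_const_pos by (intro add_nonneg_pos divide_nonneg_pos mult_nonneg_nonneg) auto
  have "\<bar>\<Sum>n. a n * real n powr (- (\<delta> + \<tau>)) * trapezoid v h (ln (real n))\<bar> \<le> K * (v + 1 + 1 / h)"
    if \<tau>: "0 < \<tau>" "\<tau> \<le> 1 / 4" and v: "0 \<le> v" and h: "0 < h" "h \<le> 1" for \<tau> v h
  proof -
    define \<sigma> where "\<sigma> = \<delta> + \<tau>"
    have \<sigma>: "\<sigma> > \<delta>" using \<tau> by (simp add: \<sigma>_def)
    define f where "f = (\<lambda>n t. a n * real n powr (- \<sigma>) * (cos (t * ln (real n)) * kern v h t))"
    define Q where "Q = 2 * h * (v + 1) + 4"
    have Q: "Q > 0" using h v by (simp add: Q_def add_nonneg_pos)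
    have kb: "norm (kern v h t) \<le> norm (Q / (1 + t\<^sup>2))" for t
      unfolding real_norm_def by (rule order_trans[OF kern_bound[OF h v, folded Q_def] abs_ge_self])
    have ki: "integrable half_line (kern v h)"
      by (rule Bochner_Integration.integrable_bound[OF integrable_rational_half_line _ AE_I2[OF kb]])
         (intro measurable_restrict_space1, simp)
    have fi: "integrable half_line (f n)" for n
    proof -
      have "integrable half_line (\<lambda>t. cos (t * ln (real n)) * kern v h t)"
        by (rule Bochner_Integration.integrable_bound[OF ki])
           (auto intro!: measurable_restrict_space1 AE_I2 mult_left_le_one_le simp: abs_mult)
      thus ?thesis unfolding f_def by simp
    qed
    have sma: "summable (\<lambda>n. \<bar>a n\<bar> * real n powr (- \<sigma>))" by (rule abs_convD[OF a \<sigma>])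
    have nf: "norm (f n t) \<le> \<bar>a n\<bar> * real n powr (- \<sigma>) * \<bar>kern v h t\<bar>" for n t
      unfolding f_def real_norm_def abs_mult
      by (intro mult_mono mult_left_le_one_le) auto
    have sm1: "summable (\<lambda>n. norm (f n t))" for t
      by (rule summable_comparison_test'[OF summable_mult2[OF sma, of "\<bar>kern v h t\<bar>"]]) (use nf in auto)
    have sm2: "summable (\<lambda>n. \<integral>t. norm (f n t) \<partial>half_line)"
    proof (rule summable_comparison_test'[OF summable_mult2[OF sma, of "\<integral>t. \<bar>kern v h t\<bar> \<partial>half_line"]])
      fix n
      have "(\<integral>t. norm (f n t) \<partial>half_line) \<le> (\<integral>t. \<bar>a n\<bar> * real n powr (- \<sigma>) * \<bar>kern v h t\<bar> \<partial>half_line)"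
        by (intro integral_mono_AE AE_I2 nf integrable_norm fi) (use ki in auto)
      also have "\<dots> = \<bar>a n\<bar> * real n powr (- \<sigma>) * (\<integral>t. \<bar>kern v h t\<bar> \<partial>half_line)" by simp
      finally show "norm (\<integral>t. norm (f n t) \<partial>half_line) \<le> \<bar>a n\<bar> * real n powr (- \<sigma>) * (\<integral>t. \<bar>kern v h t\<bar> \<partial>half_line)"
        by simp
    qed
    have int: "(\<integral>t. f n t \<partial>half_line) = fejer_const * h * (a n * real n powr (- \<sigma>) * trapezoid v h (ln (real n)))" for n
      unfolding f_def by (simp add: kern_integral[OF h(1)])
    have "(\<integral>t. (\<Sum>n. f n t) \<partial>half_line) = (\<Sum>n. \<integral>t. f n t \<partial>half_line)"
      by (rule integral_suminf[OF fi AE_I2[OF sm1] sm2])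
    also have "\<dots> = (\<Sum>n. fejer_const * h * (a n * real n powr (- \<sigma>) * trapezoid v h (ln (real n))))"
      unfolding int ..
    also have "\<dots> = fejer_const * h * (\<Sum>n. a n * real n powr (- \<sigma>) * trapezoid v h (ln (real n)))"
    proof (rule suminf_mult)
      have "\<bar>trapezoid v h (ln (real n))\<bar> \<le> 1" for n
        using trapezoid_bounds[OF h(1) v, of "ln (real n)"] by (cases "n = 0") (auto)
      thus "summable (\<lambda>n. a n * real n powr (- \<sigma>) * trapezoid v h (ln (real n)))"
        by (intro summable_comparison_test'[OF sma]) (auto simp: abs_mult intro!: mult_right_le_one_le)
    qed
    finally have eq: "fejer_const * h * (\<Sum>n. a n * real n powr (- \<sigma>) * trapezoid v h (ln (real n))) = (\<integral>t. (\<Sum>n. f n t) \<partial>half_line)" ..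
    have *: "norm (\<integral>t. (\<Sum>n. f n t) \<partial>half_line) \<le> (\<integral>t. B * Q * ((1 + t) powr (1 / 2) / (1 + t\<^sup>2)) \<partial>half_line)"
    proof (rule Bochner_Integration.integral_norm_bound_integral)
      show "integrable half_line (\<lambda>t. \<Sum>n. f n t)" by (rule integrable_suminf[OF fi AE_I2[OF sm1] sm2])
      show "integrable half_line (\<lambda>t. B * Q * ((1 + t) powr (1 / 2) / (1 + t\<^sup>2)))"
        by (rule Bochner_Integration.integrable_mult_right[OF integrable_half_line_majorant])
      fix t assume "t \<in> space half_line"
      hence t: "t \<ge> 0" by (simp add: space_restrict_space)
      have "(\<lambda>n. Re (of_real (a n) * dpow (Complex \<sigma> t) (real n))) sums Re (dirichlet a (Complex \<sigma> t))"
        by (rule sums_Re, rule dirichlet_sums[OF a]) (use \<sigma> in auto)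
      hence "(\<lambda>n. Re (of_real (a n) * dpow (Complex \<sigma> t) (real n)) * kern v h t) sums (Re (dirichlet a (Complex \<sigma> t)) * kern v h t)"
        by (rule sums_mult2)
      moreover have "Re (of_real (a n) * dpow (Complex \<sigma> t) (real n)) * kern v h t = f n t" for n
        using a by (cases "n = 0") (auto simp: Re_dpow abs_conv_def f_def)
      ultimately have "(\<lambda>n. f n t) sums (Re (dirichlet a (Complex \<sigma> t)) * kern v h t)" by (simp only:)
      hence "norm (\<Sum>n. f n t) = \<bar>Re (dirichlet a (Complex \<sigma> t))\<bar> * \<bar>kern v h t\<bar>"
        by (simp add: sums_iff abs_mult)
      also have "\<dots> \<le> (B * (1 + t) powr (1 / 2)) * (Q / (1 + t\<^sup>2))"
      proof (rule mult_mono)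
        have "\<bar>Re (dirichlet a (Complex \<sigma> t))\<bar> \<le> norm (dirichlet a (Complex \<sigma> t))" by (rule abs_Re_le_cmod)
        also have "\<dots> \<le> B * (1 + t) powr (1 / 2)"
          using B(2)[of "Complex \<sigma> t"] t \<tau> by (simp add: a_def \<sigma>_def)
        finally show "\<bar>Re (dirichlet a (Complex \<sigma> t))\<bar> \<le> B * (1 + t) powr (1 / 2)" .
        show "\<bar>kern v h t\<bar> \<le> Q / (1 + t\<^sup>2)" unfolding Q_def by (rule kern_bound[OF h v])
      qed (use B in auto)
      finally show "norm (\<Sum>n. f n t) \<le> B * Q * ((1 + t) powr (1 / 2) / (1 + t\<^sup>2))" by (simp add: mult_ac)
    qed
    have "fejer_const * h * \<bar>\<Sum>n. a n * real n powr (- \<sigma>) * trapezoid v h (ln (real n))\<bar> \<le> B * Q * G"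
    proof -
      have "(\<integral>t. B * Q * ((1 + t) powr (1 / 2) / (1 + t\<^sup>2)) \<partial>half_line) = B * Q * G"
        unfolding G_def by (rule integral_mult_right_zero)
      moreover have "\<bar>fejer_const * h * z\<bar> = fejer_const * h * \<bar>z\<bar>" for z
        using fejer_const_pos h by (simp add: abs_mult)
      ultimately show ?thesis using * unfolding eq[symmetric] real_norm_def by simp
    qed
    hence "\<bar>\<Sum>n. a n * real n powr (- \<sigma>) * trapezoid v h (ln (real n))\<bar> \<le> B * Q * G / (fejer_const * h)"
      using fejer_const_pos h by (simp add: field_simps)
    also have "\<dots> = B * G / fejer_const * (Q / h)" using fejer_const_pos h by (simp add: field_simps)
    also have "Q / h = 2 * (v + 1) + 4 / h" using h by (simp add: Q_def field_simps)
    also have "B * G / fejer_const * (2 * (v + 1) + 4 / h) \<le> B * G / fejer_const * (4 * (v + 1 + 1 / h))"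
      using B G fejer_const_pos v h by (intro mult_left_mono) auto
    also have "\<dots> = 4 * B * G / fejer_const * (v + 1 + 1 / h)" by simp
    also have "\<dots> \<le> K * (v + 1 + 1 / h)" using v h unfolding K_def by (intro mult_right_mono) auto
    finally show ?thesis by (simp add: \<sigma>_def)
  qed
  thus ?thesis using K unfolding a_def by blast
qed

text \<open>The trapezoid vanishes beyond X, so the series is a finite sum and \<tau> -> 0 raises no
  question of convergence on the line Re s = \<delta>.\<close>

lemma smoothed_b_bound:
  "\<exists>K>0. \<forall>v h X. 0 \<le> v \<longrightarrow> 0 < h \<longrightarrow> h \<le> 1 \<longrightarrow> v + h \<le> ln (real X) \<longrightarrow>
     \<bar>\<Sum>n\<le>X. b n * ln (real n) ^ k * real n powr (- \<delta>) * trapezoid v h (ln (real n))\<bar> \<le> K * (v + 1 + 1 / h)"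
proof -
  obtain K where K: "K > 0" "\<And>\<tau> v h. 0 < \<tau> \<Longrightarrow> \<tau> \<le> 1 / 4 \<Longrightarrow> 0 \<le> v \<Longrightarrow> 0 < h \<Longrightarrow> h \<le> 1 \<Longrightarrow>
     \<bar>\<Sum>n. b n * ln (real n) ^ k * real n powr (- (\<delta> + \<tau>)) * trapezoid v h (ln (real n))\<bar> \<le> K * (v + 1 + 1 / h)"
    using smoothed_b_bound_shifted by blast
  have "\<bar>\<Sum>n\<le>X. b n * ln (real n) ^ k * real n powr (- \<delta>) * trapezoid v h (ln (real n))\<bar> \<le> K * (v + 1 + 1 / h)"
    if v: "0 \<le> v" and h: "0 < h" "h \<le> 1" and X: "v + h \<le> ln (real X)" for v h X
  proof -
    have X0: "X > 0" using X v h by (cases "X = 0") auto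
    have fin: "(\<Sum>n. b n * ln (real n) ^ k * real n powr (- (\<delta> + \<tau>)) * trapezoid v h (ln (real n))) =
       (\<Sum>n\<le>X. b n * ln (real n) ^ k * real n powr (- (\<delta> + \<tau>)) * trapezoid v h (ln (real n)))" for \<tau>
    proof (rule suminf_finite)
      fix n assume "n \<notin> {..X}"
      hence "ln (real X) \<le> ln (real n)" using X0 by (subst ln_le_cancel_iff) auto
      hence "trapezoid v h (ln (real n)) = 0" using v h X by (intro trapezoid_0) auto
      thus "b n * ln (real n) ^ k * real n powr (- (\<delta> + \<tau>)) * trapezoid v h (ln (real n)) = 0" by simp
    qed simp
    have "((\<lambda>\<tau>. \<bar>\<Sum>n\<le>X. b n * ln (real n) ^ k * real n powr (- (\<delta> + \<tau>)) * trapezoid v h (ln (real n))\<bar>) \<longlongrightarrow>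
       \<bar>\<Sum>n\<le>X. b n * ln (real n) ^ k * real n powr (- (\<delta> + 0)) * trapezoid v h (ln (real n))\<bar>) (at_right 0)"
    proof (intro tendsto_rabs tendsto_sum tendsto_mult tendsto_const)
      fix n
      show "((\<lambda>\<tau>. real n powr (- (\<delta> + \<tau>))) \<longlongrightarrow> real n powr (- (\<delta> + 0))) (at_right 0)"
      proof (cases "n = 0")
        case False
        thus ?thesis by (intro tendsto_intros) auto
      qed simp
    qed
    moreover have "\<forall>\<^sub>F \<tau> in at_right 0. \<bar>\<Sum>n\<le>X. b n * ln (real n) ^ k * real n powr (- (\<delta> + \<tau>)) * trapezoid v h (ln (real n))\<bar>
       \<le> K * (v + 1 + 1 / h)"
      unfolding eventually_at_right_field
      by (rule exI[of _ "1/4"]) (use K(2)[OF _ _ v h] fin in auto)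
    ultimately have "\<bar>\<Sum>n\<le>X. b n * ln (real n) ^ k * real n powr (- (\<delta> + 0)) * trapezoid v h (ln (real n))\<bar> \<le> K * (v + 1 + 1 / h)"
      by (rule tendsto_upperbound) simp
    thus ?thesis by simp
  qed
  thus ?thesis using K(1) by blast
qed

end

section \<open>From smoothed sums to sharp sums and removal of the weight\<close>

lemma short_log_sum:
  fixes x h :: real
  assumes x: "x \<ge> 1" and h: "0 < h" "h \<le> 1" and S: "S \<subseteq> {n. x < real n \<and> real n \<le> x * exp h}"
  shows "(\<Sum>n\<in>S. ln (real n) ^ k / real n) \<le> (ln x + 1) ^ k * (2 * h + 1 / x)"
proof -
  have xe: "x \<le> x * exp h" using x h by simp
  have sub: "S \<subseteq> {nat \<lfloor>x\<rfloor><..nat \<lfloor>x * exp h\<rfloor>}"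
  proof
    fix n assume "n \<in> S"
    with S have n: "x < real n" "real n \<le> x * exp h" by auto
    have "nat \<lfloor>x\<rfloor> < n" using n x by linarith
    moreover have "n \<le> nat \<lfloor>x * exp h\<rfloor>" using n by (simp add: le_nat_floor)
    ultimately show "n \<in> {nat \<lfloor>x\<rfloor><..nat \<lfloor>x * exp h\<rfloor>}" by simp
  qed
  hence fin: "finite S" by (rule finite_subset) simp
  \<comment> \<open>S has at most 2 h x + 1 elements, since exp h \<le> 1 + h + h^2 \<le> 1 +
    2h.\<close>
  have "card S \<le> nat \<lfloor>x * exp h\<rfloor> - nat \<lfloor>x\<rfloor>" using card_mono[OF _ sub] by simp
  hence "real (card S) \<le> real (nat \<lfloor>x * exp h\<rfloor> - nat \<lfloor>x\<rfloor>)" by simp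
  also have "\<dots> \<le> x * exp h - x + 1" using xe x by linarith
  also have "exp h \<le> 1 + h + h\<^sup>2" using h by (intro exp_bound) auto
  also have "h\<^sup>2 \<le> h" using h by (simp add: power2_eq_square mult_left_le)
  finally have "real (card S) \<le> x * (1 + h + h) - x + 1" using x by simp
  hence card: "real (card S) \<le> x * (2 * h) + 1" by (simp add: algebra_simps)
  have "(\<Sum>n\<in>S. ln (real n) ^ k / real n) \<le> (\<Sum>n\<in>S. (ln x + 1) ^ k / x)"
  proof (rule sum_mono)
    fix n assume "n \<in> S"
    with S have n: "x < real n" "real n \<le> x * exp h" by auto
    have "ln (real n) \<le> ln (x * exp h)" using n x by (subst ln_le_cancel_iff) auto
    also have "\<dots> = ln x + h" using x by (simp add: ln_mult)
    also have "\<dots> \<le> ln x + 1" using h by simp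
    finally show "ln (real n) ^ k / real n \<le> (ln x + 1) ^ k / x"
      using n x by (intro frac_le power_mono) auto
  qed
  also have "\<dots> = real (card S) * ((ln x + 1) ^ k / x)" by simp
  also have "\<dots> \<le> (x * (2 * h) + 1) * ((ln x + 1) ^ k / x)"
    using x by (intro mult_right_mono card divide_nonneg_nonneg zero_le_power add_nonneg_nonneg) auto
  also have "\<dots> = (ln x + 1) ^ k * (2 * h + 1 / x)" using x by (simp add: field_simps)
  finally show ?thesis .
qed

lemma power_le_fact_exp: "x \<ge> 0 \<Longrightarrow> x ^ n \<le> fact n * exp (x::real)"
proof -
  assume x: "x \<ge> 0"
  have "(\<Sum>i\<in>{n}. inverse (fact i) *\<^sub>R x ^ i) \<le> (\<Sum>i. inverse (fact i) *\<^sub>R x ^ i)"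
    using x by (intro sum_le_suminf summable_exp_generic) auto
  hence "inverse (fact n) * x ^ n \<le> exp x" by (simp add: exp_def)
  thus ?thesis by (simp add: field_simps)
qed

text \<open>The derivative has the sign of a ln z - m, hence the threshold exp(m/a).\<close>

lemma powr_div_ln_power_mono:
  fixes a x y :: real
  assumes a: "a > 0" and x: "1 < x" "exp (real m / a) \<le> x" "x \<le> y"
  shows "x powr a / ln x ^ m \<le> y powr a / ln y ^ m"
proof (rule DERIV_nonneg_imp_nondecreasing[OF x(3), where f = "\<lambda>x. x powr a / ln x ^ m"])
  fix z assume z: "x \<le> z" "z \<le> y"
  have z1: "z > 1" using x z by linarith
  have l: "ln z > 0" using z1 by simp
  have "exp (real m / a) \<le> z" using x z by linarith
  hence "real m / a \<le> ln z" using z1 by (subst ln_ge_iff) auto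
  hence ml: "real m \<le> a * ln z" using a by (simp add: field_simps)
  have "((\<lambda>x. x powr a / ln x ^ m) has_real_derivative
      ((a * z powr (a - 1)) * ln z ^ m - z powr a * (real m * ln z ^ (m - 1) * (1 / z))) / (ln z ^ m * ln z ^ m)) (at z)"
    using z1 l by (intro DERIV_divide) (auto intro!: derivative_eq_intros)
  moreover have "(a * z powr (a - 1)) * ln z ^ m - z powr a * (real m * ln z ^ (m - 1) * (1 / z)) =
      z powr (a - 1) * (a * ln z ^ m - real m * ln z ^ (m - 1))"
  proof -
    have "z powr a = z powr (a - 1) * z" using z1 by (simp add: powr_diff)
    thus ?thesis using z1 l by (simp add: algebra_simps)
  qed
  moreover have "a * ln z ^ m - real m * ln z ^ (m - 1) \<ge> 0"
  proof (cases m)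
    case (Suc n)
    have "real m * ln z ^ n \<le> a * ln z * ln z ^ n" using ml l by (intro mult_right_mono) auto
    thus ?thesis using Suc l by simp
  qed (use a l in auto)
  ultimately show "\<exists>y. ((\<lambda>x. x powr a / ln x ^ m) has_real_derivative y) (at z) \<and> 0 \<le> y"
    using l by (intro exI conjI) (assumption, auto intro!: divide_nonneg_nonneg mult_nonneg_nonneg)
qed

context euler_seq begin

text \<open>Up to sign, the partial sums of the Dirichlet series of the k-th derivative of
  \<open>H\<close>, taken at the boundary point \<delta>.\<close>

definition T :: "nat \<Rightarrow> nat \<Rightarrow> real" where
  "T k N = (\<Sum>n\<le>N. b n * ln (real n) ^ k * real n powr (- \<delta>))"

lemma b_term:
  "b n * ln (real n) ^ k * real n powr (- \<delta>) = L n * ln (real n) ^ k * real n powr (- \<delta>) - ln (real n) ^ k / real n"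
proof (cases "n = 0")
  case False
  have "real n powr (\<delta> - 1) * real n powr (- \<delta>) = 1 / real n"
    using False by (simp add: powr_diff powr_minus)
  thus ?thesis by (simp add: b_def algebra_simps)
qed (simp add: b_def L_0)

text \<open>\<open>b_term\<close> splits the sum into an L-part and an explicit part, both with
  nonnegative terms. A trapezoid with its slope beyond N bounds the L-part from above, one with its
  slope before N from below. So only the explicit part has to be estimated on the slope, by
  \<open>short_log_sum\<close>.\<close>

lemma T_bound_aux:
  "\<exists>K>0. \<forall>N h. 3 \<le> N \<longrightarrow> 0 < h \<longrightarrow> h \<le> 1 \<longrightarrow>
     \<bar>T k N\<bar> \<le> K * (ln (real N) + 1 + 1 / h) + (ln (real N) + 1) ^ k * (2 * h + 3 / real N)"
proof -
  obtain K where K: "K > 0" "\<And>v h X. 0 \<le> v \<Longrightarrow> 0 < h \<Longrightarrow> h \<le> 1 \<Longrightarrow> v + h \<le> ln (real X) \<Longrightarrow>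
     \<bar>\<Sum>n\<le>X. b n * ln (real n) ^ k * real n powr (- \<delta>) * trapezoid v h (ln (real n))\<bar> \<le> K * (v + 1 + 1 / h)"
    using smoothed_b_bound by blast
  have "\<bar>T k N\<bar> \<le> K * (ln (real N) + 1 + 1 / h) + (ln (real N) + 1) ^ k * (2 * h + 3 / real N)"
    if N: "3 \<le> N" and h: "0 < h" "h \<le> 1" for N h
  proof -
    define v where "v = ln (real N)"
    have e3: "exp 1 \<le> (3::real)" by (rule exp_le)
    have "1 \<le> ln (3::real)" using e3 by (simp add: ln_ge_iff)
    also have "ln 3 \<le> v" unfolding v_def using N by (subst ln_le_cancel_iff) auto
    finally have v: "v \<ge> 1" .
    define a where "a = (\<lambda>n. L n * ln (real n) ^ k * real n powr (- \<delta>))"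
    define g where "g = (\<lambda>n. ln (real n) ^ k / real n)"
    have ln0: "ln (real n) \<ge> 0" for n by (cases "n = 0") auto
    have a0: "a n \<ge> 0" and g0: "g n \<ge> 0" for n
      using L_nonneg ln0 by (auto simp: a_def g_def)
    have T_eq: "T k N = (\<Sum>n\<le>N. a n) - (\<Sum>n\<le>N. g n)"
      unfolding T_def b_term a_def g_def by (rule sum_subtractf)
    have W_eq: "(\<Sum>n\<le>X. b n * ln (real n) ^ k * real n powr (- \<delta>) * w n) = (\<Sum>n\<le>X. a n * w n) - (\<Sum>n\<le>X. g n * w n)" for X w
      unfolding b_term a_def g_def by (simp add: sum_subtractf left_diff_distrib)
    have upper: "T k N \<le> K * (v + 1 + 1 / h) + (v + 1) ^ k * (2 * h + 3 / real N)"
    proof -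
      define w where "w = (\<lambda>n. trapezoid v h (ln (real n)))"
      have w: "0 \<le> w n" "w n \<le> 1" for n using trapezoid_bounds[OF h(1), of v "ln (real n)"] v ln0 by (auto simp: w_def)
      \<comment> \<open>The trapezoid vanishes from N exp h on, and exp h \<le> 3.\<close>
      define X where "X = 3 * N"
      have "v + h \<le> ln (real N) + ln 3" using h \<open>1 \<le> ln (3::real)\<close> by (simp add: v_def)
      also have "\<dots> = ln (real X)" using N by (simp add: X_def ln_mult)
      finally have X: "v + h \<le> ln (real X)" .
      have w1: "w n = 1" if "n \<le> N" "n \<noteq> 0" for n
        unfolding w_def using that h v ln0 N by (intro trapezoid_1) (auto simp: v_def)
      have "(\<Sum>n\<le>N. a n) = (\<Sum>n\<le>N. a n * w n)"
        by (intro sum.cong refl) (use w1 L_0 in \<open>force simp: a_def\<close>)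
      also have "\<dots> \<le> (\<Sum>n\<le>X. a n * w n)"
        by (rule sum_mono2) (auto simp: X_def intro!: mult_nonneg_nonneg a0 w)
      also have "\<dots> = (\<Sum>n\<le>X. b n * ln (real n) ^ k * real n powr (- \<delta>) * w n) + (\<Sum>n\<le>X. g n * w n)"
        unfolding W_eq by simp
      also have "\<dots> \<le> K * (v + 1 + 1 / h) + (\<Sum>n\<le>X. g n * w n)"
        using K(2)[of v h X] v h X unfolding w_def by simp
      also have "(\<Sum>n\<le>X. g n * w n) \<le> (\<Sum>n\<in>{..N} \<union> {n. real N < real n \<and> real n \<le> real N * exp h \<and> n \<le> X}. g n)"
      proof -
        have "(\<Sum>n\<le>X. g n * w n) = (\<Sum>n\<in>{..N} \<union> {n. real N < real n \<and> real n \<le> real N * exp h \<and> n \<le> X}. g n * w n)"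
        proof (rule sum.mono_neutral_right)
          show "\<forall>n\<in>{..X} - ({..N} \<union> {n. real N < real n \<and> real n \<le> real N * exp h \<and> n \<le> X}). g n * w n = 0"
          proof
            fix n assume "n \<in> {..X} - ({..N} \<union> {n. real N < real n \<and> real n \<le> real N * exp h \<and> n \<le> X})"
            hence "real n \<ge> real N * exp h" "n > 0" by auto
            hence "ln (real N * exp h) \<le> ln (real n)" using N by (subst ln_le_cancel_iff) auto
            hence "v + h \<le> ln (real n)" using N by (simp add: ln_mult v_def)
            hence "w n = 0" unfolding w_def using h v by (intro trapezoid_0) auto
            thus "g n * w n = 0" by simp
          qed
        qed (auto simp: X_def)
        also have "\<dots> \<le> (\<Sum>n\<in>{..N} \<union> {n. real N < real n \<and> real n \<le> real N * exp h \<and> n \<le> X}. g n)"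
          by (intro sum_mono mult_right_le_one_le g0 w)
        finally show ?thesis .
      qed
      also have "\<dots> = (\<Sum>n\<le>N. g n) + (\<Sum>n\<in>{n. real N < real n \<and> real n \<le> real N * exp h \<and> n \<le> X}. g n)"
        by (rule sum.union_disjoint) auto
      also have "(\<Sum>n\<in>{n. real N < real n \<and> real n \<le> real N * exp h \<and> n \<le> X}. g n) \<le> (ln (real N) + 1) ^ k * (2 * h + 1 / real N)"
        unfolding g_def using N h by (intro short_log_sum) auto
      also have "\<dots> \<le> (v + 1) ^ k * (2 * h + 3 / real N)"
        using v N by (auto simp: v_def intro!: mult_left_mono divide_right_mono)
      finally show ?thesis unfolding T_eq by simp
    qed
    have lower: "- T k N \<le> K * (v + 1 + 1 / h) + (v + 1) ^ k * (2 * h + 3 / real N)"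
    proof -
      \<comment> \<open>For the lower bound the slope runs from x = N exp(-h) up to N. As x \<ge>
        N/3, the term 1/x becomes the 3/N of the statement.\<close>
      define v' where "v' = v - h"
      have v': "v' \<ge> 0" "v' \<le> v" using v h by (auto simp: v'_def)
      define x where "x = real N * exp (- h)"
      have xh: "x * exp h = real N" by (simp add: x_def exp_minus)
      have "exp h \<le> exp 1" using h by simp
      hence "exp h \<le> 3" using e3 by linarith
      hence x3: "x \<ge> real N / 3" using N by (simp add: x_def exp_minus field_simps)
      hence x1: "x \<ge> 1" using N by simp
      have lnx: "ln x = v'" using N by (simp add: x_def v'_def v_def ln_mult)
      define w where "w = (\<lambda>n. trapezoid v' h (ln (real n)))"
      have w: "0 \<le> w n" "w n \<le> 1" for n using trapezoid_bounds[OF h(1), of v' "ln (real n)"] v' ln0 by (auto simp: w_def)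
      let ?S = "{n. x < real n \<and> real n \<le> x * exp h}"
      have finS: "?S \<subseteq> {..N}" unfolding xh by auto
      have "(\<Sum>n\<le>N. g n) - (\<Sum>n\<in>?S. g n) = (\<Sum>n\<in>{..N} - ?S. g n)"
        using finS by (simp add: sum_diff)
      also have "\<dots> = (\<Sum>n\<in>{..N} - ?S. g n * w n)"
      proof (rule sum.cong[OF refl])
        fix n assume n: "n \<in> {..N} - ?S"
        show "g n = g n * w n"
        proof (cases "n = 0")
          case False
          have "real n \<le> x" using n by (auto simp: xh)
          hence "ln (real n) \<le> v'" unfolding lnx[symmetric] using False x1 by (subst ln_le_cancel_iff) auto
          hence "w n = 1" unfolding w_def using h v' ln0 by (intro trapezoid_1) auto
          thus ?thesis by simp
        qed (simp add: g_def)
      qed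
      also have "\<dots> \<le> (\<Sum>n\<le>N. g n * w n)"
        by (rule sum_mono2) (auto intro!: mult_nonneg_nonneg g0 w)
      also have "\<dots> = (\<Sum>n\<le>N. a n * w n) - (\<Sum>n\<le>N. b n * ln (real n) ^ k * real n powr (- \<delta>) * w n)"
        unfolding W_eq by simp
      also have "\<dots> \<le> (\<Sum>n\<le>N. a n * w n) + K * (v' + 1 + 1 / h)"
        using K(2)[of v' h N] v' h unfolding w_def by (simp add: v'_def v_def)
      also have "(\<Sum>n\<le>N. a n * w n) \<le> (\<Sum>n\<le>N. a n)"
        by (intro sum_mono mult_right_le_one_le a0 w)
      also have "K * (v' + 1 + 1 / h) \<le> K * (v + 1 + 1 / h)"
        using K(1) v' by (intro mult_left_mono) auto
      finally have 1: "- T k N \<le> K * (v + 1 + 1 / h) + (\<Sum>n\<in>?S. g n)" unfolding T_eq by simp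
      have "(\<Sum>n\<in>?S. g n) \<le> (ln x + 1) ^ k * (2 * h + 1 / x)"
        unfolding g_def using x1 h by (intro short_log_sum) auto
      also have "\<dots> \<le> (v + 1) ^ k * (2 * h + 3 / real N)"
      proof (intro mult_mono add_left_mono power_mono)
        show "1 / x \<le> 3 / real N" using x3 x1 N by (simp add: field_simps)
      qed (use v v' h N x1 in \<open>auto simp: lnx\<close>)
      finally show ?thesis using 1 by simp
    qed
    show ?thesis using upper lower unfolding v_def by linarith
  qed
  thus ?thesis using K(1) by blast
qed

text \<open>With v = ln N, the choice h = v^(-j) turns both 1/h and h v^(2j) into v^j. The trivial
  bound for \<open>T (2 * j) N\<close> is of order v^(2j+1), so v^j is saved; j is at our
  disposal.\<close>

lemma T_bound: "\<exists>K>0. \<forall>N\<ge>3. \<bar>T (2 * j) N\<bar> \<le> K * ln (real N) ^ (j + 1)"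
proof -
  obtain K where K: "K > 0" "\<And>N h. 3 \<le> N \<Longrightarrow> 0 < h \<Longrightarrow> h \<le> 1 \<Longrightarrow>
     \<bar>T (2 * j) N\<bar> \<le> K * (ln (real N) + 1 + 1 / h) + (ln (real N) + 1) ^ (2 * j) * (2 * h + 3 / real N)"
    using T_bound_aux by blast
  define K' where "K' = 3 * K + 2 ^ (2 * j) * (2 + 3 * fact (2 * j))"
  have "\<bar>T (2 * j) N\<bar> \<le> K' * ln (real N) ^ (j + 1)" if N: "N \<ge> 3" for N
  proof -
    define v where "v = ln (real N)"
    have "1 \<le> ln (3::real)" using exp_le by (simp add: ln_ge_iff)
    also have "ln 3 \<le> v" unfolding v_def using N by (subst ln_le_cancel_iff) auto
    finally have v: "v \<ge> 1" .
    have v1: "1 \<le> v ^ i" for i using v by (rule one_le_power)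
    have Nv: "real N = exp v" using N by (simp add: v_def)
    define h where "h = 1 / v ^ j"
    have h: "0 < h" "h \<le> 1" "1 / h = v ^ j" "v ^ (2 * j) * h = v ^ j"
      using v v1[of j] by (auto simp: h_def mult_2 power_add)
    have "\<bar>T (2 * j) N\<bar> \<le> K * (v + 1 + 1 / h) + (v + 1) ^ (2 * j) * (2 * h + 3 / real N)"
      using K(2)[OF N h(1,2)] by (simp add: v_def)
    also have "v + 1 + 1 / h \<le> 3 * v ^ (j + 1)"
    proof -
      have "v ^ 1 \<le> v ^ (j + 1)" "v ^ j \<le> v ^ (j + 1)" using v by (auto intro!: power_increasing)
      thus ?thesis using v1[of "j + 1"] by (simp add: h(3))
    qed
    also have "(v + 1) ^ (2 * j) * (2 * h + 3 / real N) \<le> (2 * v) ^ (2 * j) * (2 * h + 3 / real N)"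
      using v h by (intro mult_right_mono power_mono) auto
    also have "\<dots> = 2 ^ (2 * j) * (2 * (v ^ (2 * j) * h) + 3 * (v ^ (2 * j) / real N))"
      by (simp add: power_mult_distrib algebra_simps)
    also have "\<dots> \<le> 2 ^ (2 * j) * (2 * v ^ (j + 1) + 3 * (fact (2 * j) * v ^ (j + 1)))"
    proof (intro mult_left_mono add_mono)
      show "v ^ (2 * j) * h \<le> v ^ (j + 1)" unfolding h(4) using v by (intro power_increasing) auto
      have "v ^ (2 * j) / real N \<le> fact (2 * j) * 1"
        using power_le_fact_exp[of v "2 * j"] v by (simp add: Nv divide_le_eq)
      also have "\<dots> \<le> fact (2 * j) * v ^ (j + 1)" by (intro mult_left_mono v1) auto
      finally show "v ^ (2 * j) / real N \<le> fact (2 * j) * v ^ (j + 1)" .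
    qed auto
    finally show ?thesis using K(1) by (simp add: K'_def v_def[symmetric] algebra_simps)
  qed
  moreover have "K' > 0" unfolding K'_def using K(1) by (intro add_pos_nonneg) auto
  ultimately show ?thesis by blast
qed

text \<open>Partial summation: b n / ln n is the n-th term of \<open>T (2 * j)\<close> times g n =
  n^\<delta> / ln^(2j+1) n. The bound ln^(j+1) N for T, times g N, leaves N^\<delta> / ln^j
  N.\<close>

lemma b_ln_sum_bound:
  assumes j: "j \<ge> 1"
  shows "\<exists>K>0. \<exists>N0. \<forall>N\<ge>N0. \<bar>\<Sum>n=2..N. b n / ln (real n)\<bar> \<le> K * real N powr \<delta> / ln (real N) ^ j"
proof -
  obtain K0 where K0: "K0 > 0" "\<And>N. N \<ge> 3 \<Longrightarrow> \<bar>T (2 * j) N\<bar> \<le> K0 * ln (real N) ^ (j + 1)"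
    using T_bound by blast
  \<comment> \<open>\<open>T_bound\<close> starts at N = 3, the partial summation at N = 2; the
    extra summand covers that case.\<close>
  define K where "K = K0 + \<bar>T (2 * j) 2\<bar> / ln 2 ^ (j + 1)"
  have K: "K > 0" "K \<ge> K0" using K0(1) by (auto simp: K_def intro!: add_pos_nonneg)
  have TK: "\<bar>T (2 * j) N\<bar> \<le> K * ln (real N) ^ (j + 1)" if "N \<ge> 2" for N
  proof (cases "N = 2")
    case True
    have "\<bar>T (2 * j) 2\<bar> = \<bar>T (2 * j) 2\<bar> / ln 2 ^ (j + 1) * ln 2 ^ (j + 1)" by simp
    also have "\<dots> \<le> K * ln 2 ^ (j + 1)" unfolding K_def using K0(1) by (intro mult_right_mono) auto
    finally show ?thesis using True by simp
  next
    case False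
    hence "\<bar>T (2 * j) N\<bar> \<le> K0 * ln (real N) ^ (j + 1)" using that by (intro K0) auto
    also have "\<dots> \<le> K * ln (real N) ^ (j + 1)" using K that by (intro mult_right_mono) auto
    finally show ?thesis .
  qed
  \<comment> \<open>2j powers remove the weight of T and one more provides the division by ln
    n.\<close>
  define m where "m = 2 * j + 1"
  define g where "g = (\<lambda>n::nat. real n powr \<delta> / ln (real n) ^ m)"
  have g0: "g n \<ge> 0" for n by (cases "n = 0") (auto simp: g_def)
  have Abel: "(\<Sum>n=2..N. b n / ln (real n)) = T (2 * j) N * g N - (\<Sum>n=2..<N. T (2 * j) n * (g (Suc n) - g n))"
    if "N \<ge> 2" for N
    using that
  proof (induction N rule: dec_induct)
    case base
    \<comment> \<open>The terms n = 0 and n = 1 of T drop out, the latter because ln 1 = 0 occurs to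
      the positive power 2j.\<close>
    have "{..2::nat} = {0, 1, 2}" by auto
    hence "T (2 * j) 2 = b 2 * ln 2 ^ (2 * j) * 2 powr (- \<delta>)" using j by (simp add: T_def b_def L_0)
    moreover have "ln 2 ^ (2 * j) * 2 powr (- \<delta>) * g 2 = 1 / ln (2::real)"
      by (simp add: g_def m_def powr_minus)
    ultimately show ?case by (simp add: mult.assoc)
  next
    case (step N)
    have "T (2 * j) (Suc N) = T (2 * j) N + b (Suc N) * ln (real (Suc N)) ^ (2 * j) * real (Suc N) powr (- \<delta>)"
      by (simp add: T_def)
    moreover have "ln (real (Suc N)) ^ (2 * j) * real (Suc N) powr (- \<delta>) * g (Suc N) = 1 / ln (real (Suc N))"
      using step.hyps by (simp add: g_def m_def powr_minus)
    ultimately have "T (2 * j) (Suc N) * g (Suc N) = T (2 * j) N * g (Suc N) + b (Suc N) / ln (real (Suc N))"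
      by (simp add: distrib_right mult.assoc)
    thus ?case using step by (simp add: algebra_simps)
  qed
  obtain n0 where n0: "n0 \<ge> 2" "\<And>n. n \<ge> n0 \<Longrightarrow> g n \<le> g (Suc n)"
  proof -
    define n0 where "n0 = max 2 (nat \<lceil>exp (real m / \<delta>)\<rceil>)"
    have "g n \<le> g (Suc n)" if n: "n \<ge> n0" for n
    proof -
      have "real n \<ge> 2" "real n \<ge> exp (real m / \<delta>)" using n unfolding n0_def by linarith+
      hence "real n powr \<delta> / ln (real n) ^ m \<le> real (Suc n) powr \<delta> / ln (real (Suc n)) ^ m"
        using delta_pos by (intro powr_div_ln_power_mono) auto
      thus ?thesis by (simp add: g_def)
    qed
    moreover have "n0 \<ge> 2" by (simp add: n0_def)
    ultimately show ?thesis using that by blast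
  qed
  \<comment> \<open>g increases only from n0 on. V is its variation before that, a constant that is
    absorbed below once g N \<ge> 1.\<close>
  define V where "V = (\<Sum>n=2..<n0. \<bar>g (Suc n) - g n\<bar>)"
  have V: "V \<ge> 0" unfolding V_def by (intro sum_nonneg) auto
  have var: "(\<Sum>n=2..<N. \<bar>g (Suc n) - g n\<bar>) \<le> V + g N" if "N \<ge> n0" for N
  proof -
    have "(\<Sum>n=2..<N. \<bar>g (Suc n) - g n\<bar>) = V + (\<Sum>n=n0..<N. \<bar>g (Suc n) - g n\<bar>)"
      unfolding V_def using that n0(1) by (intro sum.atLeastLessThan_concat[symmetric]) auto
    also have "(\<Sum>n=n0..<N. \<bar>g (Suc n) - g n\<bar>) = (\<Sum>n=n0..<N. g (Suc n) - g n)"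
      by (intro sum.cong refl) (use n0(2) in auto)
    also have "\<dots> = g N - g n0" using that by (rule sum_Suc_diff')
    finally show ?thesis using g0[of n0] by simp
  qed
  have "filterlim g at_top sequentially" unfolding g_def using delta_pos by real_asymp
  hence "\<forall>\<^sub>F N in sequentially. g N \<ge> 1" unfolding filterlim_at_top by blast
  then obtain n1 where n1: "\<And>N. N \<ge> n1 \<Longrightarrow> g N \<ge> 1" unfolding eventually_sequentially by blast
  have "\<bar>\<Sum>n=2..N. b n / ln (real n)\<bar> \<le> K * (V + 2) * real N powr \<delta> / ln (real N) ^ j" if N: "N \<ge> max n0 n1" for N
  proof -
    have N2: "N \<ge> 2" "N \<ge> n0" using N n0(1) by auto
    have lnN: "ln (real N) > 0" using N2 by simp
    define v where "v = K * ln (real N) ^ (j + 1)"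
    have v: "v \<ge> 0" unfolding v_def using K lnN by simp
    have "\<bar>\<Sum>n=2..N. b n / ln (real n)\<bar> \<le> \<bar>T (2 * j) N * g N\<bar> + \<bar>\<Sum>n=2..<N. T (2 * j) n * (g (Suc n) - g n)\<bar>"
      unfolding Abel[OF N2(1)] by (rule abs_triangle_ineq4)
    also have "\<bar>T (2 * j) N * g N\<bar> \<le> v * g N"
      unfolding abs_mult v_def using TK[OF N2(1)] g0[of N] by (simp add: mult_right_mono)
    also have "\<bar>\<Sum>n=2..<N. T (2 * j) n * (g (Suc n) - g n)\<bar> \<le> (\<Sum>n=2..<N. v * \<bar>g (Suc n) - g n\<bar>)"
    proof (rule sum_norm_le[where 'a = real, unfolded real_norm_def])
      fix n assume n: "n \<in> {2..<N}"
      have "\<bar>T (2 * j) n\<bar> \<le> K * ln (real n) ^ (j + 1)" using n by (intro TK) auto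
      also have "\<dots> \<le> v" unfolding v_def using n K by (intro mult_left_mono power_mono) auto
      finally show "\<bar>T (2 * j) n * (g (Suc n) - g n)\<bar> \<le> v * \<bar>g (Suc n) - g n\<bar>"
        unfolding abs_mult by (rule mult_right_mono) simp
    qed
    also have "\<dots> \<le> v * (V + g N)" unfolding sum_distrib_left[symmetric] by (intro mult_left_mono var N2 v)
    also have "v * g N + v * (V + g N) = v * (V * 1 + 2 * g N)" by (simp add: algebra_simps)
    also have "\<dots> \<le> v * (V * g N + 2 * g N)"
      using n1[of N] N V v by (intro mult_left_mono add_right_mono) auto
    also have "\<dots> = K * (V + 2) * (ln (real N) ^ (j + 1) * g N)" by (simp add: v_def algebra_simps)
    also have "ln (real N) ^ (j + 1) * g N = real N powr \<delta> / ln (real N) ^ j"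
    proof -
      have "ln (real N) ^ m = ln (real N) ^ (j + 1) * ln (real N) ^ j"
        by (simp add: m_def power_add[symmetric] mult_2)
      thus ?thesis using lnN by (simp add: g_def)
    qed
    finally show ?thesis by simp
  qed
  moreover have "K * (V + 2) > 0" using K V by simp
  ultimately show ?thesis by blast
qed

end

section \<open>The abstract prime number theorem\<close>

text \<open>A discrete version of li(n^\<delta>): the integral of u^(\<delta>-1) / ln u becomes the
  logarithmic integral under the substitution of u^\<delta>.\<close>

definition li_sum :: "real \<Rightarrow> nat \<Rightarrow> real" where
  "li_sum \<delta> n = (\<Sum>m=2..n. real m powr (\<delta> - 1) / ln (real m))"

locale integral_semigroup = arithmetical_semigroup P "\<lambda>g. real (N g)"
  for P :: "'a::comm_monoid_mult set" and N :: "'a \<Rightarrow> nat" +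
  assumes N_pos: "N g > 0"
begin

lemma N_1: "N 1 = 1" using norm_one by simp

lemma N_mult: "N (g * h) = N g * N h"
  using norm_mult[of g h] by (simp only: of_nat_mult[symmetric] of_nat_eq_iff)

lemma N_power: "N (g ^ j) = N g ^ j"
  by (induction j) (auto simp: N_1 N_mult)

lemma N_prime: "p \<in> P \<Longrightarrow> N p \<ge> 2"
  using norm_prime[of p] by simp

lemma finite_N_le: "finite {g. N g \<le> n}"
proof -
  have "finite {g. real (N g) \<le> real n + 1}" by (rule finite_norm_le) simp
  thus ?thesis by (rule finite_subset[rotated]) auto
qed

lemma finite_N_eq: "finite {g. N g = n}"
  by (rule finite_subset[OF _ finite_N_le[of n]]) auto

lemma N_prod_mset: "N (prod_mset A) = prod_mset (image_mset N A)"
  by (induction A) (auto simp: N_1 N_mult)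

text \<open>The case g = 1 holds because a nonempty product of primes has norm at least 2.\<close>

lemma factorization: "\<exists>!A. set_mset A \<subseteq> P \<and> prod_mset A = g"
proof (cases "g = 1")
  case True
  show ?thesis
  proof (rule ex1I[of _ "{#}"])
    fix A assume A: "set_mset A \<subseteq> P \<and> prod_mset A = g"
    show "A = {#}"
    proof (rule ccontr)
      assume "A \<noteq> {#}"
      then obtain p B where pB: "A = add_mset p B" using multiset_cases by blast
      hence "N p * N (prod_mset B) = 1" using A True N_1 by (simp add: N_mult[symmetric])
      hence "N p = 1" by simp
      moreover have "p \<in> P" using A pB by simp
      ultimately show False using N_prime by fastforce
    qed
  qed (use True in auto)
qed (rule unique_factorization)

section \<open>Factorizations and the von Mangoldt function of the semigroup\<close>

definition fac :: "'a \<Rightarrow> 'a multiset" where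
  "fac g = (THE A. set_mset A \<subseteq> P \<and> prod_mset A = g)"

lemma fac_subset: "set_mset (fac g) \<subseteq> P" and prod_fac: "prod_mset (fac g) = g"
  using theI'[OF factorization[of g]] unfolding fac_def by auto

lemma fac_eq: "set_mset A \<subseteq> P \<Longrightarrow> prod_mset A = g \<Longrightarrow> fac g = A"
  unfolding fac_def using factorization[of g] by (intro the1_equality) auto

lemma ln_N: "ln (real (N g)) = (\<Sum>p\<in>set_mset (fac g). real (count (fac g) p) * ln (real (N p)))"
proof -
  have "N g = (\<Prod>p\<in>set_mset (fac g). N p ^ count (fac g) p)"
    using N_prod_mset[of "fac g"] by (simp add: prod_fac image_prod_mset_multiplicity)
  hence "ln (real (N g)) = ln (\<Prod>p\<in>set_mset (fac g). real (N p) ^ count (fac g) p)" by simp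
  also have "\<dots> = (\<Sum>p\<in>set_mset (fac g). ln (real (N p) ^ count (fac g) p))"
    by (rule ln_prod) (use N_pos in auto)
  also have "\<dots> = (\<Sum>p\<in>set_mset (fac g). real (count (fac g) p) * ln (real (N p)))"
    by (intro sum.cong refl ln_realpow)
  finally show ?thesis .
qed

definition level :: "nat \<Rightarrow> real" where
  "level n = real (card {g. N g = n})"

text \<open>Pairs are collected, not norms or powers: different primes may have the same norm, and
  each of them must contribute to \<open>mangoldt\<close>.\<close>

definition prime_powers :: "nat \<Rightarrow> ('a \<times> nat) set" where
  "prime_powers n = {(p, j). p \<in> P \<and> j \<ge> 1 \<and> N p ^ j = n}"

definition mangoldt :: "nat \<Rightarrow> real" where
  "mangoldt n = (\<Sum>(p, j)\<in>prime_powers n. ln (real (N p)))"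

lemma prime_power_bounds:
  assumes "p \<in> P" "j \<ge> 1"
  shows "N p \<le> N p ^ j" "j < N p ^ j"
proof -
  show "N p \<le> N p ^ j" using N_pos[of p] assms(2) by (intro self_le_power) auto
  have "j < 2 ^ j" by simp
  also have "\<dots> \<le> N p ^ j" using N_prime[OF assms(1)] by (intro power_mono) auto
  finally show "j < N p ^ j" .
qed

lemma finite_prime_powers_le: "finite {(p, j). p \<in> P \<and> j \<ge> 1 \<and> N p ^ j \<le> n}"
proof (rule finite_subset)
  show "{(p, j). p \<in> P \<and> j \<ge> 1 \<and> N p ^ j \<le> n} \<subseteq> {g. N g \<le> n} \<times> {..n}"
    using prime_power_bounds by (force dest: order_trans)
  show "finite ({g. N g \<le> n} \<times> {..n})" using finite_N_le by auto
qed

lemma finite_prime_powers: "finite (prime_powers n)"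
  by (rule finite_subset[OF _ finite_prime_powers_le[of n]]) (auto simp: prime_powers_def)

lemma fac_mult_power: "p \<in> P \<Longrightarrow> fac (h * p ^ j) = fac h + replicate_mset j p"
  by (rule fac_eq) (use fac_subset in \<open>auto simp: prod_fac split: if_splits dest!: in_replicate_mset[THEN iffD1]\<close>)

text \<open>Both sides weigh by ln N(p) the triples (g, p, j) in which N(g) = n, j \<ge> 1 and p^j
  divides g. For fixed g they add up to ln N(g). Splitting off p^j leaves a cofactor h of norm n/d
  with d = N(p)^j, which gives the right side.\<close>

lemma log_convolution:
  assumes n: "n \<ge> 1"
  shows "level n * ln (real n) = (\<Sum>d | d dvd n. mangoldt d * level (n div d))"
proof -
  define split_off where "split_off = (\<lambda>(g, p, j). (N p ^ j, (p, j), prod_mset (fac g - replicate_mset j p)))"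
  define join where "join = (\<lambda>(d :: nat, (p :: 'a, j), h). (h * p ^ j, p, j :: nat))"
  have "level n * ln (real n) = (\<Sum>g\<in>{g. N g = n}. ln (real (N g)))" by (simp add: level_def)
  also have "\<dots> = (\<Sum>g\<in>{g. N g = n}. \<Sum>(p, j)\<in>(SIGMA p:set_mset (fac g). {1..count (fac g) p}). ln (real (N p)))"
  proof (rule sum.cong[OF refl])
    fix g
    have "(\<Sum>(p, j)\<in>(SIGMA p:set_mset (fac g). {1..count (fac g) p}). ln (real (N p))) =
      (\<Sum>p\<in>set_mset (fac g). \<Sum>j\<in>{1..count (fac g) p}. ln (real (N p)))"
      by (rule sum.Sigma[symmetric]) auto
    also have "\<dots> = (\<Sum>p\<in>set_mset (fac g). real (count (fac g) p) * ln (real (N p)))" by simp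
    also have "\<dots> = ln (real (N g))" by (rule ln_N[symmetric])
    finally show "ln (real (N g)) = (\<Sum>(p, j)\<in>(SIGMA p:set_mset (fac g). {1..count (fac g) p}). ln (real (N p)))" ..
  qed
  also have "\<dots> = (\<Sum>(g, p, j)\<in>(SIGMA g:{g. N g = n}. SIGMA p:set_mset (fac g). {1..count (fac g) p}). ln (real (N p)))"
    by (subst sum.Sigma) (auto intro: finite_N_eq)
  also have "\<dots> = (\<Sum>(d, (p, j), h)\<in>(SIGMA d:{d. d dvd n}. prime_powers d \<times> {h. N h = n div d}). ln (real (N p)))"
  proof (rule sum.reindex_bij_witness[where j = split_off and i = join])
    fix x assume x: "x \<in> (SIGMA g:{g. N g = n}. SIGMA p:set_mset (fac g). {1..count (fac g) p})"
    obtain g p j where xe: "x = (g, p, j)" by (cases x) auto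
    have g: "N g = n" and p: "p \<in># fac g" and j: "1 \<le> j" "j \<le> count (fac g) p" using x by (auto simp: xe)
    define h where "h = prod_mset (fac g - replicate_mset j p)"
    have "fac g = (fac g - replicate_mset j p) + replicate_mset j p"
      using j by (simp add: count_le_replicate_mset_subset_eq[symmetric])
    hence "prod_mset (fac g) = h * prod_mset (replicate_mset j p)" unfolding h_def by (metis prod_mset_Un)
    hence g_eq: "h * p ^ j = g" by (simp add: prod_fac)
    have nn: "N h * N p ^ j = n" using g g_eq by (simp add: N_mult[symmetric] N_power[symmetric])
    show "join (split_off x) = x"
      using g_eq by (simp add: xe h_def split_off_def join_def)
    have "N p ^ j dvd n" "N h = n div N p ^ j" using nn N_pos[of p] by (auto simp flip: nn)
    thus "split_off x
       \<in> (SIGMA d:{d. d dvd n}. prime_powers d \<times> {h. N h = n div d})"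
      using p j fac_subset by (auto simp: xe prime_powers_def h_def split_off_def)
    show "(\<lambda>(d, (p, j), h). ln (real (N p))) (split_off x) =
       (\<lambda>(g, p, j). ln (real (N p))) x" by (simp add: xe split_off_def)
  next
    fix x assume x: "x \<in> (SIGMA d:{d. d dvd n}. prime_powers d \<times> {h. N h = n div d})"
    obtain d p j h where xe: "x = (d, (p, j), h)" by (cases x) auto
    have d: "d dvd n" "p \<in> P" "j \<ge> 1" "N p ^ j = d" "N h = n div d" using x by (auto simp: xe prime_powers_def)
    have f: "fac (h * p ^ j) = fac h + replicate_mset j p" by (rule fac_mult_power[OF d(2)])
    show "split_off (join x) = x"
      using d by (simp add: xe f prod_fac split_off_def join_def)
    show "join x \<in> (SIGMA g:{g. N g = n}. SIGMA p:set_mset (fac g). {1..count (fac g) p})"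
      using d by (auto simp: xe f N_mult N_power join_def)
  qed
  also have "\<dots> = (\<Sum>d | d dvd n. \<Sum>((p, j), h)\<in>prime_powers d \<times> {h. N h = n div d}. ln (real (N p)))"
    using n by (subst sum.Sigma) (auto intro!: finite_cartesian_product finite_prime_powers finite_N_eq finite_divisors_nat simp: case_prod_unfold)
  also have "\<dots> = (\<Sum>d | d dvd n. mangoldt d * level (n div d))"
  proof (rule sum.cong[OF refl])
    fix d
    have "(\<Sum>((p, j), h)\<in>prime_powers d \<times> {h. N h = n div d}. ln (real (N p))) =
      (\<Sum>x\<in>prime_powers d. \<Sum>h\<in>{h. N h = n div d}. ln (real (N (fst x))))"
      unfolding case_prod_unfold by (subst sum.cartesian_product) (simp add: case_prod_unfold)
    also have "\<dots> = mangoldt d * level (n div d)"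
      by (simp add: mangoldt_def level_def sum_distrib_left sum_distrib_right case_prod_unfold mult_ac)
    finally show "(\<Sum>((p, j), h)\<in>prime_powers d \<times> {h. N h = n div d}. ln (real (N p))) = mangoldt d * level (n div d)" .
  qed
  finally show ?thesis .
qed

lemma mangoldt_nonneg: "mangoldt n \<ge> 0"
  unfolding mangoldt_def using N_pos by (intro sum_nonneg) (auto simp: Suc_le_eq)

lemma mangoldt_0: "mangoldt 0 = 0"
proof -
  have "prime_powers 0 = {}" using N_pos by (auto simp: prime_powers_def)
  thus ?thesis by (simp add: mangoldt_def)
qed

lemma level_0: "level 0 = 0"
proof -
  have *: "{g. N g = 0} = {}" using N_pos by (metis (mono_tags, lifting) Collect_empty_eq less_irrefl)
  show ?thesis unfolding level_def * by simp
qed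

lemma level_1: "level 1 = 1"
proof -
  have "g = 1" if "N g = 1" for g
  proof (rule ccontr)
    assume "g \<noteq> 1"
    hence "fac g \<noteq> {#}" using prod_fac[of g] by auto
    then obtain p B where pB: "fac g = add_mset p B" using multiset_cases by blast
    hence "N p * N (prod_mset B) = 1" using that prod_fac[of g] by (simp add: N_mult[symmetric])
    moreover have "p \<in> P" using fac_subset[of g] pB by simp
    ultimately show False using N_prime by fastforce
  qed
  hence "{g. N g = 1} = {1}" using N_1 by auto
  thus ?thesis by (simp add: level_def)
qed

lemma sum_level: "(\<Sum>m\<le>n. level m) = real (card {g. N g \<le> n})"
proof -
  have "{g. N g \<le> n} = (\<Union>m\<in>{..n}. {g. N g = m})" by auto
  also have "card \<dots> = (\<Sum>m\<le>n. card {g. N g = m})"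
    by (rule card_UN_disjoint) (auto intro: finite_N_eq)
  finally show ?thesis by (simp add: level_def)
qed

lemma count_upto_eq: "x \<ge> 0 \<Longrightarrow> real (count_upto (\<lambda>g. real (N g)) x) = (\<Sum>m\<le>nat \<lfloor>x\<rfloor>. level m)"
  unfolding sum_level count_upto_def
  by (intro arg_cong[of _ _ "\<lambda>S. real (card S)"]) (auto simp: le_nat_iff le_floor_iff)

text \<open>The O-estimate holds from some x0 on. On [1, x0] both terms are bounded and x^\<eta>
  \<ge> 1, so a larger constant serves for all x \<ge> 1, as \<open>counting_seq\<close>
  demands.\<close>

lemma axiom_A_bound:
  assumes "axiom_A (\<lambda>g. real (N g)) \<delta>"
  obtains \<eta> C where "0 \<le> \<eta>" "\<eta> < \<delta>" "\<And>x. x \<ge> 1 \<Longrightarrow> \<bar>(\<Sum>m\<le>nat \<lfloor>x\<rfloor>. level m) - x powr \<delta>\<bar> \<le> C * x powr \<eta>"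
proof -
  let ?S = "\<lambda>x. \<Sum>m\<le>nat \<lfloor>x\<rfloor>. level m"
  obtain \<eta> where \<eta>: "0 \<le> \<eta>" "\<eta> < \<delta>"
    and O: "(\<lambda>x. real (count_upto (\<lambda>g. real (N g)) x) - x powr \<delta>) \<in> O[at_top](\<lambda>x. x powr \<eta>)"
    using assms unfolding axiom_A_def by blast
  from O obtain c where c: "c > 0" "\<forall>\<^sub>F x in at_top. norm (real (count_upto (\<lambda>g. real (N g)) x) - x powr \<delta>) \<le> c * norm (x powr \<eta>)"
    by (elim landau_o.bigE)
  then obtain x0 where x0: "\<And>x. x \<ge> x0 \<Longrightarrow> \<bar>real (count_upto (\<lambda>g. real (N g)) x) - x powr \<delta>\<bar> \<le> c * x powr \<eta>"
    unfolding eventually_at_top_linorder by auto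
  define C where "C = c + ?S x0 + \<bar>x0\<bar> powr \<delta>"
  have l0: "level m \<ge> 0" for m by (simp add: level_def)
  have "\<bar>?S x - x powr \<delta>\<bar> \<le> C * x powr \<eta>" if x: "x \<ge> 1" for x
  proof (cases "x \<ge> x0")
    case True
    have "\<bar>?S x - x powr \<delta>\<bar> \<le> c * x powr \<eta>" using x0[OF True] x by (simp add: count_upto_eq)
    also have "\<dots> \<le> C * x powr \<eta>"
    proof (rule mult_right_mono)
      have "?S x0 \<ge> 0" by (intro sum_nonneg l0)
      thus "c \<le> C" unfolding C_def using powr_ge_zero[of "\<bar>x0\<bar>" \<delta>] by linarith
    qed simp
    finally show ?thesis .
  next
    case False
    have S0: "?S x0 \<ge> 0" by (intro sum_nonneg l0)
    have "?S x \<le> ?S x0" using False by (intro sum_mono2) (auto intro!: l0 nat_mono floor_mono)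
    moreover have "?S x \<ge> 0" by (intro sum_nonneg l0)
    moreover have "x powr \<delta> \<le> \<bar>x0\<bar> powr \<delta>" using False x \<eta> by (intro powr_mono2) auto
    ultimately have "\<bar>?S x - x powr \<delta>\<bar> \<le> ?S x0 + \<bar>x0\<bar> powr \<delta>"
      using powr_ge_zero[of x \<delta>] by linarith
    also have "\<dots> \<le> C * 1" using c(1) by (simp add: C_def)
    also have "C * 1 \<le> C * x powr \<eta>"
    proof -
      have "C \<ge> 0" unfolding C_def using c(1) S0 powr_ge_zero[of "\<bar>x0\<bar>" \<delta>] by linarith
      thus ?thesis using x \<eta> by (intro mult_left_mono ge_one_powr_ge_zero) auto
    qed
    finally show ?thesis .
  qed
  thus ?thesis using that \<eta> by blast
qed

section \<open>From prime powers to primes\<close>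

definition prime_count :: "nat \<Rightarrow> nat" where
  "prime_count n = card {p \<in> P. N p \<le> n}"

lemma finite_primes_le: "finite {p \<in> P. N p \<le> n}"
  by (rule finite_subset[OF _ finite_N_le[of n]]) auto

text \<open>Each pair (p, j) contributes ln N(p) / ln(N(p)^j) = 1/j. The pairs with j = 1 are the
  primes; every other pair contributes at most 1.\<close>

lemma sum_mangoldt:
  shows "real (prime_count n) \<le> (\<Sum>m=2..n. mangoldt m / ln (real m))"
    and "(\<Sum>m=2..n. mangoldt m / ln (real m)) \<le> real (prime_count n) + real (card {(p, j). p \<in> P \<and> j \<ge> 2 \<and> N p ^ j \<le> n})"
proof -
  let ?Q = "{(p, j). p \<in> P \<and> j \<ge> 1 \<and> N p ^ j \<le> n}"
  let ?Q1 = "(\<lambda>p. (p, 1::nat)) ` {p \<in> P. N p \<le> n}"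
  let ?Q2 = "{(p, j). p \<in> P \<and> j \<ge> 2 \<and> N p ^ j \<le> n}"
  have "mangoldt m / ln (real m) = (\<Sum>(p, j)\<in>prime_powers m. 1 / real j)" if m: "m \<ge> 2" for m
  proof -
    have "mangoldt m / ln (real m) = (\<Sum>(p, j)\<in>prime_powers m. ln (real (N p)) / ln (real m))"
      by (simp add: mangoldt_def sum_divide_distrib case_prod_unfold)
    also have "\<dots> = (\<Sum>(p, j)\<in>prime_powers m. 1 / real j)"
    proof (rule sum.cong[OF refl], clarify)
      fix p j assume "(p, j) \<in> prime_powers m"
      hence pj: "p \<in> P" "j \<ge> 1" "m = N p ^ j" by (auto simp: prime_powers_def)
      have "ln (real m) = real j * ln (real (N p))" using N_pos[of p] by (simp add: pj(3) ln_realpow)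
      moreover have "ln (real (N p)) > 0" using N_prime[OF pj(1)] by simp
      ultimately show "ln (real (N p)) / ln (real m) = 1 / real j" by simp
    qed
    finally show ?thesis .
  qed
  hence "(\<Sum>m=2..n. mangoldt m / ln (real m)) = (\<Sum>m=2..n. \<Sum>(p, j)\<in>prime_powers m. 1 / real j)" by simp
  also have "\<dots> = (\<Sum>(p, j)\<in>(\<Union>m\<in>{2..n}. prime_powers m). 1 / real j)"
    by (rule sum.UNION_disjoint[symmetric]) (auto simp: finite_prime_powers, auto simp: prime_powers_def)
  also have "(\<Union>m\<in>{2..n}. prime_powers m) = ?Q"
  proof -
    have "2 \<le> N p ^ j" if "p \<in> P" "1 \<le> j" for p j
      using prime_power_bounds(1)[OF that] N_prime[OF that(1)] by linarith
    thus ?thesis by (auto simp: prime_powers_def)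
  qed
  also have "?Q = ?Q1 \<union> ?Q2"
  proof (intro equalityI subsetI)
    fix x assume x: "x \<in> ?Q"
    then obtain p j where xe: "x = (p, j)" by (cases x)
    show "x \<in> ?Q1 \<union> ?Q2" using x unfolding xe by (cases "j = 1") auto
  qed auto
  also have "(\<Sum>(p, j)\<in>?Q1 \<union> ?Q2. 1 / real j) = (\<Sum>(p, j)\<in>?Q1. 1 / real j) + (\<Sum>(p, j)\<in>?Q2. 1 / real j)"
  proof (rule sum.union_disjoint)
    show "finite ?Q1" using finite_primes_le by simp
    show "finite ?Q2" by (rule finite_subset[OF _ finite_prime_powers_le[of n]]) auto
  qed auto
  also have "(\<Sum>(p, j)\<in>?Q1. 1 / real j) = real (prime_count n)"
    by (subst sum.reindex) (auto simp: inj_on_def prime_count_def)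
  finally have eq: "(\<Sum>m=2..n. mangoldt m / ln (real m)) = real (prime_count n) + (\<Sum>(p, j)\<in>?Q2. 1 / real j)" .
  have "(\<Sum>(p, j)\<in>?Q2. 1 / real j) \<ge> 0" by (rule sum_nonneg) auto
  with eq show "real (prime_count n) \<le> (\<Sum>m=2..n. mangoldt m / ln (real m))" by simp
  have "(\<Sum>(p, j)\<in>?Q2. 1 / real j) \<le> (\<Sum>x\<in>?Q2. 1)" by (rule sum_mono) auto
  with eq show "(\<Sum>m=2..n. mangoldt m / ln (real m)) \<le> real (prime_count n) + real (card ?Q2)" by simp
qed

text \<open>If j \<ge> 2 and N(p)^j \<le> n, then N(p) is at most the square root of n and, as N(p)
  \<ge> 2, j is at most log n to base 2.\<close>

lemma card_proper_powers_le:
  assumes n: "n \<ge> 1"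
  shows "real (card {(p, j). p \<in> P \<and> j \<ge> 2 \<and> N p ^ j \<le> n}) \<le> (\<Sum>m\<le>nat \<lfloor>sqrt (real n)\<rfloor>. level m) * (ln (real n) / ln 2)"
proof -
  let ?r = "nat \<lfloor>sqrt (real n)\<rfloor>" and ?l = "nat \<lfloor>ln (real n) / ln 2\<rfloor>"
  have sub: "{(p, j). p \<in> P \<and> j \<ge> 2 \<and> N p ^ j \<le> n} \<subseteq> {g. N g \<le> ?r} \<times> {1..?l}"
  proof clarify
    fix p j assume p: "p \<in> P" and j: "2 \<le> j" "N p ^ j \<le> n"
    have "N p ^ 2 \<le> N p ^ j" using N_pos[of p] j by (intro power_increasing) auto
    hence "real (N p) ^ 2 \<le> real n" using j by (simp flip: of_nat_power)
    hence "real (N p) \<le> sqrt (real n)" by (rule real_le_rsqrt)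
    hence 1: "N p \<le> ?r" by (rule le_nat_floor)
    have "2 ^ j \<le> N p ^ j" using N_prime[OF p] by (intro power_mono) auto
    hence "real (2 ^ j) \<le> real n" using j by linarith
    hence "ln (real (2 ^ j)) \<le> ln (real n)" using n by (subst ln_le_cancel_iff) auto
    hence "real j * ln 2 \<le> ln (real n)" by (simp add: ln_realpow)
    hence "real j \<le> ln (real n) / ln 2" by (simp add: field_simps)
    hence "j \<le> ?l" by (rule le_nat_floor)
    thus "p \<in> {g. N g \<le> ?r} \<and> j \<in> {1..?l}" using 1 j by auto
  qed
  have "card {(p, j). p \<in> P \<and> j \<ge> 2 \<and> N p ^ j \<le> n} \<le> card {g. N g \<le> ?r} * ?l"
    using card_mono[OF _ sub] finite_N_le by (simp add: card_cartesian_product)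
  hence "real (card {(p, j). p \<in> P \<and> j \<ge> 2 \<and> N p ^ j \<le> n}) \<le> real (card {g. N g \<le> ?r}) * real ?l"
    by (simp flip: of_nat_mult)
  also have "\<dots> \<le> real (card {g. N g \<le> ?r}) * (ln (real n) / ln 2)"
    using n by (intro mult_left_mono) auto
  finally show ?thesis by (simp add: sum_level)
qed

text \<open>\<open>b_ln_sum_bound\<close> treats primes together with prime powers. The proper
  powers number O(n^(\<delta>/2) ln n), which is below n^\<delta> / ln^j n for every j.\<close>

theorem abstract_prime_number_theorem:
  assumes A: "axiom_A (\<lambda>g. real (N g)) \<delta>" and j: "j \<ge> 1"
  shows "\<exists>K>0. \<exists>n0. \<forall>n\<ge>n0. \<bar>real (prime_count n) - li_sum \<delta> n\<bar> \<le> K * real n powr \<delta> / ln (real n) ^ j"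
proof -
  obtain \<eta> C where \<eta>: "0 \<le> \<eta>" "\<eta> < \<delta>"
    and cb: "\<And>x. x \<ge> 1 \<Longrightarrow> \<bar>(\<Sum>m\<le>nat \<lfloor>x\<rfloor>. level m) - x powr \<delta>\<bar> \<le> C * x powr \<eta>"
    using axiom_A_bound[OF A] by blast
  interpret E: euler_seq level \<delta> \<eta> C mangoldt
    by unfold_locales
       (use \<eta> cb level_0 level_1 mangoldt_nonneg mangoldt_0 log_convolution in \<open>auto simp: level_def\<close>)
  obtain K n0 where K: "K > 0" "\<And>n. n \<ge> n0 \<Longrightarrow> \<bar>\<Sum>m=2..n. E.b m / ln (real m)\<bar> \<le> K * real n powr \<delta> / ln (real n) ^ j"
    using E.b_ln_sum_bound[OF j] by blast
  define D where "D = (1 + C) / ln 2"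
  have D: "D > 0" using E.C_nonneg by (simp add: D_def add_pos_nonneg)
  have "\<forall>\<^sub>F x::real in at_top. D * x powr (\<delta> / 2) * ln x \<le> x powr \<delta> / ln x ^ j"
    using D E.delta_pos by real_asymp
  then obtain x0 where x0: "\<And>x. x \<ge> x0 \<Longrightarrow> D * x powr (\<delta> / 2) * ln x \<le> x powr \<delta> / ln x ^ j"
    unfolding eventually_at_top_linorder by blast
  have "\<bar>real (prime_count n) - li_sum \<delta> n\<bar> \<le> (K + 1) * real n powr \<delta> / ln (real n) ^ j"
    if n: "n \<ge> max 2 (max n0 (nat \<lceil>x0\<rceil>))" for n
  proof -
    have n2: "n \<ge> 2" "n \<ge> n0" "real n \<ge> x0" using n by (auto simp: nat_ceiling_le_eq)
    have "(\<Sum>m=2..n. E.b m / ln (real m)) = (\<Sum>m=2..n. mangoldt m / ln (real m)) - li_sum \<delta> n"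
      by (simp add: E.b_def li_sum_def diff_divide_distrib sum_subtractf)
    moreover have "real (card {(p, j). p \<in> P \<and> j \<ge> 2 \<and> N p ^ j \<le> n}) \<le> real n powr \<delta> / ln (real n) ^ j"
    proof -
      define s where "s = sqrt (real n)"
      have s: "s \<ge> 1" using n2 by (simp add: s_def)
      have "(\<Sum>m\<le>nat \<lfloor>s\<rfloor>. level m) \<le> (1 + C) * s powr \<delta>"
      proof -
        have "s powr \<eta> \<le> s powr \<delta>" using s \<eta> by (intro powr_mono) auto
        hence "C * s powr \<eta> \<le> C * s powr \<delta>" by (intro mult_left_mono E.C_nonneg)
        with cb[OF s] show ?thesis by (simp add: algebra_simps)
      qed
      also have "s powr \<delta> = real n powr (\<delta> / 2)"
        using n2 by (simp add: s_def powr_half_sqrt[symmetric] powr_powr)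
      finally have "(\<Sum>m\<le>nat \<lfloor>s\<rfloor>. level m) * (ln (real n) / ln 2) \<le> (1 + C) * real n powr (\<delta> / 2) * (ln (real n) / ln 2)"
        using n2 by (intro mult_right_mono) auto
      also have "\<dots> = D * real n powr (\<delta> / 2) * ln (real n)" by (simp add: D_def)
      also have "\<dots> \<le> real n powr \<delta> / ln (real n) ^ j" by (rule x0[OF n2(3)])
      finally show ?thesis using card_proper_powers_le[of n] n2 by (simp add: s_def)
    qed
    moreover have "(K + 1) * real n powr \<delta> / ln (real n) ^ j = K * real n powr \<delta> / ln (real n) ^ j + real n powr \<delta> / ln (real n) ^ j"
      by (simp add: add_divide_distrib distrib_right)
    ultimately show ?thesis using K(2)[OF n2(2)] sum_mangoldt[of n] by linarith
  qed
  moreover have "K + 1 > 0" using K by simp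
  ultimately show ?thesis by blast
qed

end

section \<open>Primes in half blocks\<close>

definition li_weight :: "real \<Rightarrow> nat \<Rightarrow> real" where
  "li_weight \<delta> n = (if n < 2 then 0 else real n powr (\<delta> - 1) / ln (real n))"

lemma li_weight_nonneg: "li_weight \<delta> n \<ge> 0"
  by (simp add: li_weight_def)

lemma li_weight_antimono:
  assumes "\<delta> \<le> 1" "2 \<le> m" "m \<le> n"
  shows "li_weight \<delta> n \<le> li_weight \<delta> m"
  using assms unfolding li_weight_def by (auto intro!: frac_le powr_mono2')

text \<open>n^(\<delta>-1) outgrows the logarithm from exp(1/(\<delta>-1)) on.\<close>

lemma li_weight_mono:
  assumes \<delta>: "\<delta> > 1" and m: "exp (1 / (\<delta> - 1)) \<le> real m" "m \<le> n"
  shows "li_weight \<delta> m \<le> li_weight \<delta> n"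
proof -
  have "exp (1 / (\<delta> - 1)) > 1" using \<delta> by simp
  hence m2: "m \<ge> 2" using m by linarith
  have "real m powr (\<delta> - 1) / ln (real m) ^ 1 \<le> real n powr (\<delta> - 1) / ln (real n) ^ 1"
    using \<delta> m m2 by (intro powr_div_ln_power_mono) auto
  thus ?thesis using m2 m by (simp add: li_weight_def)
qed

lemma li_weight_le:
  assumes "\<delta> \<ge> 1" "real n \<le> X" "X \<ge> 1"
  shows "li_weight \<delta> n \<le> X powr (\<delta> - 1) / ln 2"
  using assms unfolding li_weight_def by (auto intro!: frac_le powr_mono2)

text \<open>The expected number of primes in the lower half of block j minus that in the upper half,
  arranged in pairs symmetric about the middle of the block. Monotonicity of the weight decides the
  sign of each pair.\<close>

definition li_block :: "real \<Rightarrow> nat \<Rightarrow> nat \<Rightarrow> real" where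
  "li_block \<delta> K j = (\<Sum>r=1..(K - 1) div 2. li_weight \<delta> (j * K + r) - li_weight \<delta> ((j + 1) * K - r))"

lemma li_block_nonneg:
  assumes "\<delta> \<le> 1" "j \<ge> 1" "K \<ge> 3"
  shows "li_block \<delta> K j \<ge> 0"
  unfolding li_block_def
proof (rule sum_nonneg)
  fix r assume r: "r \<in> {1..(K - 1) div 2}"
  have "1 * K \<le> j * K" using assms by (intro mult_right_mono) auto
  moreover have "(j + 1) * K = j * K + K" "1 \<le> r" "2 * r \<le> K" using r by auto
  ultimately have "2 \<le> j * K + r" "j * K + r \<le> (j + 1) * K - r" using assms(3) by linarith+
  thus "0 \<le> li_weight \<delta> (j * K + r) - li_weight \<delta> ((j + 1) * K - r)"
    using li_weight_antimono[OF assms(1)] by simp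
qed

lemma li_block_nonpos:
  assumes "\<delta> > 1" "j \<ge> 1" "exp (1 / (\<delta> - 1)) \<le> real K"
  shows "li_block \<delta> K j \<le> 0"
  unfolding li_block_def
proof (rule sum_nonpos)
  fix r assume r: "r \<in> {1..(K - 1) div 2}"
  have "1 * K \<le> j * K" using assms by (intro mult_right_mono) auto
  moreover have "(j + 1) * K = j * K + K" "2 * r \<le> K" using r by auto
  ultimately have "K \<le> j * K + r" "j * K + r \<le> (j + 1) * K - r" by linarith+
  moreover from this assms(3) have "exp (1 / (\<delta> - 1)) \<le> real (j * K + r)" by linarith
  ultimately show "li_weight \<delta> (j * K + r) - li_weight \<delta> ((j + 1) * K - r) \<le> 0"
    using li_weight_mono[OF assms(1)] by simp
qed

text \<open>If 2 \<le> r \<le> K/4 then K - r \<ge> 3r, so the logarithms of r and K - r differ by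
  at least ln 3 \<ge> 1 and their reciprocals by at least 1/ln^2 K. At least K/16 pairs gain
  K^(\<delta>-1)/ln^2 K in this way; for \<delta> = 1 the logarithm alone produces the gain.\<close>

lemma li_block_0_concave:
  assumes \<delta>: "\<delta> \<le> 1" and K: "K \<ge> 16"
  shows "li_block \<delta> K 0 \<ge> real K powr \<delta> / (16 * ln (real K) ^ 2) - 2"
proof -
  define h where "h = (K - 1) div 2"
  define g where "g = (\<lambda>r. li_weight \<delta> r - li_weight \<delta> (K - r))"
  have lnK: "ln (real K) > 0" using K by simp
  have h: "h \<ge> K div 4" "h \<ge> 2" using K by (auto simp: h_def)
  define w where "w = real K powr (\<delta> - 1) / ln (real K) ^ 2"
  have "li_block \<delta> K 0 = (\<Sum>r=1..h. g r)" by (simp add: li_block_def h_def g_def)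
  also have "{1..h} = insert 1 {2..h}" using h by auto
  also have "(\<Sum>r\<in>insert 1 {2..h}. g r) = g 1 + (\<Sum>r=2..h. g r)" by simp
  finally have split: "li_block \<delta> K 0 = g 1 + (\<Sum>r=2..h. g r)" .
  have sum_ge: "(\<Sum>r=2..K div 4. w) \<le> (\<Sum>r=2..h. g r)"
  proof -
    have g0: "g r \<ge> 0" if "r \<in> {2..h}" for r
      using li_weight_antimono[OF \<delta>, of r "K - r"] that by (auto simp: g_def h_def)
    have "(\<Sum>r=2..K div 4. w) \<le> (\<Sum>r=2..K div 4. g r)"
    proof (rule sum_mono)
      fix r assume r: "r \<in> {2..K div 4}"
      define s where "s = K - r"
      have rs: "2 \<le> r" "4 * r \<le> K" "3 * r \<le> s" "s \<le> K" "r \<le> K" using r by (auto simp: s_def)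
      define lr ls lK where "lr = ln (real r)" and "ls = ln (real s)" and "lK = ln (real K)"
      have lr: "lr > 0" unfolding lr_def using rs by simp
      have "ln (3 * real r) \<le> ls" unfolding ls_def using rs by (subst ln_le_cancel_iff) auto
      moreover have "ln (3 * real r) = ln 3 + lr" unfolding lr_def using rs by (simp add: ln_mult)
      moreover have "1 \<le> ln (3::real)" using exp_le by (simp add: ln_ge_iff)
      ultimately have d: "ls - lr \<ge> 1" by linarith
      have lK: "ls \<le> lK" "lr \<le> lK" "lK > 0" unfolding ls_def lr_def lK_def using rs K by auto
      have "1 / lK ^ 2 \<le> (ls - lr) / (lr * ls)"
        unfolding power2_eq_square using d lr lK by (intro frac_le mult_mono) auto
      also have "\<dots> = 1 / lr - 1 / ls" using d lr by (simp add: field_simps)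
      finally have 1: "1 / lK ^ 2 \<le> 1 / lr - 1 / ls" .
      have 2: "real K powr (\<delta> - 1) \<le> real r powr (\<delta> - 1)" "real s powr (\<delta> - 1) \<le> real r powr (\<delta> - 1)"
        using rs \<delta> by (auto intro!: powr_mono2')
      have "real K powr (\<delta> - 1) * (1 / lK ^ 2) \<le> real r powr (\<delta> - 1) * (1 / lr - 1 / ls)"
        using 1 2 lK by (intro mult_mono) auto
      also have "\<dots> = real r powr (\<delta> - 1) / lr - real r powr (\<delta> - 1) / ls" by (simp add: algebra_simps)
      also have "\<dots> \<le> real r powr (\<delta> - 1) / lr - real s powr (\<delta> - 1) / ls"
        using 2 d lr by (intro diff_left_mono divide_right_mono) auto
      also have "\<dots> = g r" using rs by (simp add: g_def li_weight_def lr_def ls_def s_def)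
      finally show "w \<le> g r" by (simp add: lK_def w_def)
    qed
    also have "\<dots> \<le> (\<Sum>r=2..h. g r)" using h by (intro sum_mono2 g0) auto
    finally show ?thesis .
  qed
  have "real K powr \<delta> = real K powr (\<delta> - 1) * real K"
    using powr_add[of "real K" "\<delta> - 1" 1] by simp
  hence "real K powr \<delta> / (16 * ln (real K) ^ 2) = real K / 16 * w"
    unfolding w_def by simp
  also have "\<dots> \<le> real (K div 4 - 1) * w"
  proof (rule mult_right_mono)
    have "4 * (K div 4) + 3 \<ge> K" by linarith
    hence "16 * (K div 4 - 1) \<ge> K" using K by linarith
    thus "real K / 16 \<le> real (K div 4 - 1)" by linarith
  qed (use lnK in \<open>auto simp: w_def\<close>)
  also have "\<dots> = (\<Sum>r=2..K div 4. w)" by simp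
  finally have main: "real K powr \<delta> / (16 * ln (real K) ^ 2) \<le> (\<Sum>r=2..h. g r)" using sum_ge by linarith
  \<comment> \<open>The pair r = 1 is the exception: the weight at 1 is 0, so this pair can only be
    bounded below by minus the weight at K - 1, which is at least -2.\<close>
  have "li_weight \<delta> (K - 1) \<le> li_weight \<delta> 2" using K \<delta> by (intro li_weight_antimono) auto
  also have "\<dots> \<le> 2"
  proof -
    have "2 powr (\<delta> - 1) \<le> 2 powr (0::real)" using \<delta> by (intro powr_mono) auto
    hence "2 powr (\<delta> - 1) \<le> 2 * ln 2" using ln2_ge_two_thirds by simp
    thus ?thesis unfolding li_weight_def by (simp add: pos_divide_le_eq)
  qed
  finally have "g 1 \<ge> - 2" using li_weight_nonneg[of \<delta> 1] by (simp add: g_def)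
  thus ?thesis using main split by linarith
qed

text \<open>For r \<le> K/4 the partner K - r is at least 3K/4, so each such pair loses a constant
  multiple of K^(\<delta>-1)/ln K. At least K/16 pairs of this kind lie above t, where the weight is
  increasing.\<close>

lemma li_block_0_convex:
  assumes \<delta>: "\<delta> > 1"
  shows "\<exists>c>0. \<exists>B K0. \<forall>K\<ge>K0. li_block \<delta> K 0 \<le> B - c * real K powr \<delta> / ln (real K)"
proof -
  \<comment> \<open>From t on the weight increases; the finitely many pairs with r < t contribute at
    most the constant B.\<close>
  define t where "t = nat \<lceil>exp (1 / (\<delta> - 1))\<rceil> + 2"
  have t: "exp (1 / (\<delta> - 1)) \<le> real t" "t \<ge> 2" unfolding t_def by linarith+
  define B where "B = (\<Sum>r<t. li_weight \<delta> r)"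
  \<comment> \<open>l^2 = 3^(\<delta>-1) is the ratio of (3K/4)^(\<delta>-1) to (K/4)^(\<delta>-1).
    One factor l pays for ln K \<le> l ln(K/4), and l^2 - l > 0 is left for c.\<close>
  define l where "l = 3 powr ((\<delta> - 1) / 2)"
  have l: "l > 1" using \<delta> by (simp add: l_def gr_one_powr)
  have ll: "l * l = 3 powr (\<delta> - 1)" unfolding l_def by (subst powr_add[symmetric]) simp
  define c where "c = (1 / 4) powr (\<delta> - 1) * (l * l - l) / 16"
  have c: "c > 0" unfolding c_def using l by simp
  have "\<forall>\<^sub>F x::real in at_top. ln x \<le> l * ln (x / 4)" using l by real_asymp
  then obtain x0 where x0: "\<And>x. x \<ge> x0 \<Longrightarrow> ln x \<le> l * ln (x / 4)" unfolding eventually_at_top_linorder by blast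
  define K0 where "K0 = max (16 * t) (nat \<lceil>x0\<rceil>)"
  have "li_block \<delta> K 0 \<le> B - c * real K powr \<delta> / ln (real K)" if K: "K \<ge> K0" for K
  proof -
    have K16: "K \<ge> 16 * t" "real K \<ge> x0" using K unfolding K0_def by linarith+
    have K32: "K \<ge> 32" using K16 t by linarith
    define h where "h = (K - 1) div 2"
    define g where "g = (\<lambda>r. li_weight \<delta> r - li_weight \<delta> (K - r))"
    have h: "h \<ge> K div 4" "t \<le> K div 4" using K16 K32 by (auto simp: h_def)
    define lK where "lK = ln (real K)"
    have lK: "lK > 0" unfolding lK_def using K32 by simp
    define D where "D = real K powr (\<delta> - 1) / lK * ((1 / 4) powr (\<delta> - 1) * (l * l - l))"
    have D: "D > 0" unfolding D_def using lK l K32 by simp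
    have "{1..h} = {1..<t} \<union> {t..h}" using h t by auto
    hence "li_block \<delta> K 0 = (\<Sum>r\<in>{1..<t}. g r) + (\<Sum>r\<in>{t..h}. g r)"
      unfolding li_block_def h_def[symmetric] g_def[symmetric]
      by (subst sum.union_disjoint[symmetric]) (auto simp: g_def)
    also have "(\<Sum>r\<in>{1..<t}. g r) \<le> (\<Sum>r\<in>{1..<t}. li_weight \<delta> r)"
      by (intro sum_mono) (simp add: g_def li_weight_nonneg)
    also have "\<dots> \<le> B" unfolding B_def by (intro sum_mono2) (auto intro: li_weight_nonneg)
    also have "(\<Sum>r\<in>{t..h}. g r) \<le> (\<Sum>r\<in>{t..K div 4}. g r)"
    proof -
      have g0: "g r \<le> 0" if "r \<in> {t..h}" for r
        using li_weight_mono[OF \<delta>, of r "K - r"] that t by (auto simp: g_def h_def)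
      have "(\<Sum>r\<in>{t..h}. g r) = (\<Sum>r\<in>{t..K div 4}. g r) + (\<Sum>r\<in>{t..h} - {t..K div 4}. g r)"
        using h by (subst add.commute, intro sum.subset_diff) auto
      moreover have "(\<Sum>r\<in>{t..h} - {t..K div 4}. g r) \<le> 0" using g0 by (intro sum_nonpos) auto
      ultimately show ?thesis by simp
    qed
    also have "(\<Sum>r\<in>{t..K div 4}. g r) \<le> (\<Sum>r\<in>{t..K div 4}. - D)"
    proof (rule sum_mono)
      fix r assume r: "r \<in> {t..K div 4}"
      define q where "q = K div 4"
      define s where "s = K - q"
      have q2: "q \<ge> 2" "real q \<le> real K / 4" using K32 by (auto simp: q_def)
      have s2: "s \<ge> 2" "real s \<ge> 3 * (real K / 4)" "s \<le> K" using K32 by (auto simp: s_def q_def)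
      have up: "li_weight \<delta> r \<le> (real K / 4) powr (\<delta> - 1) / (lK / l)"
      proof -
        have "li_weight \<delta> r \<le> li_weight \<delta> q" using r t by (intro li_weight_mono \<delta>) (auto simp: q_def)
        also have "\<dots> \<le> (real K / 4) powr (\<delta> - 1) / ln (real K / 4)"
        proof -
          have "exp (1 / (\<delta> - 1)) \<le> real q" using t h unfolding q_def by linarith
          hence "real q powr (\<delta> - 1) / ln (real q) ^ 1 \<le> (real K / 4) powr (\<delta> - 1) / ln (real K / 4) ^ 1"
            using \<delta> q2 by (intro powr_div_ln_power_mono) auto
          thus ?thesis using q2 by (simp add: li_weight_def)
        qed
        also have "\<dots> \<le> (real K / 4) powr (\<delta> - 1) / (lK / l)"
        proof -
          have "lK / l \<le> ln (real K / 4)" using x0[OF K16(2)] l by (simp add: lK_def field_simps)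
          thus ?thesis using lK l by (intro divide_left_mono mult_pos_pos) (auto intro: less_le_trans[of 0 "lK / l"])
        qed
        finally show ?thesis .
      qed
      have lo: "(3 * (real K / 4)) powr (\<delta> - 1) / lK \<le> li_weight \<delta> (K - r)"
      proof -
        have "(3 * (real K / 4)) powr (\<delta> - 1) / lK \<le> real s powr (\<delta> - 1) / ln (real s)"
          using s2 \<delta> K32 unfolding lK_def by (intro frac_le powr_mono2) auto
        also have "\<dots> = li_weight \<delta> s" using s2 by (simp add: li_weight_def)
        also have "\<dots> \<le> li_weight \<delta> (K - r)"
        proof (intro li_weight_mono \<delta>)
          have "t \<le> s" using h by (simp add: s_def q_def)
          thus "exp (1 / (\<delta> - 1)) \<le> real s" using t by linarith
          show "s \<le> K - r" using r by (auto simp: s_def q_def)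
        qed
        finally show ?thesis .
      qed
      have K4: "(real K / 4) powr (\<delta> - 1) = real K powr (\<delta> - 1) * (1 / 4) powr (\<delta> - 1)"
        by (simp add: powr_mult[symmetric])
      have "g r \<le> (real K / 4) powr (\<delta> - 1) / (lK / l) - (3 * (real K / 4)) powr (\<delta> - 1) / lK"
        using up lo by (simp add: g_def)
      also have "(3 * (real K / 4)) powr (\<delta> - 1) = l * l * (real K / 4) powr (\<delta> - 1)"
        unfolding ll by (rule powr_mult) 
      also have "(real K / 4) powr (\<delta> - 1) / (lK / l) - l * l * (real K / 4) powr (\<delta> - 1) / lK = - D"
        unfolding D_def K4 using lK by (simp add: field_simps)
      finally show "g r \<le> - D" .
    qed
    also have "(\<Sum>r\<in>{t..K div 4}. - D) = - (real (Suc (K div 4) - t) * D)" by simp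
    also have "\<dots> \<le> - (real K / 16 * D)"
    proof -
      have "16 * (Suc (K div 4) - t) \<ge> K" using K16 K32 by linarith
      hence "real K / 16 \<le> real (Suc (K div 4) - t)" by linarith
      thus ?thesis using D by (simp add: mult_right_mono)
    qed
    also have "real K / 16 * D = c * real K powr \<delta> / lK"
    proof -
      have e: "real K powr \<delta> = real K powr (\<delta> - 1) * real K"
        using powr_add[of "real K" "\<delta> - 1" 1] by simp
      have "y / 16 * (x / z * (u * v)) = u * v / 16 * (x * y) / z" for x y z u v :: real by simp
      thus ?thesis unfolding D_def c_def e by blast
    qed
    finally show ?thesis by (simp add: lK_def)
  qed
  thus ?thesis using c by blast
qed

lemma li_sum_eq: "li_sum \<delta> n = (\<Sum>i\<le>n. li_weight \<delta> i)"
proof -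
  have "li_sum \<delta> n = (\<Sum>i=2..n. li_weight \<delta> i)"
    unfolding li_sum_def by (intro sum.cong) (auto simp: li_weight_def)
  also have "\<dots> = (\<Sum>i\<le>n. li_weight \<delta> i)"
    by (rule sum.mono_neutral_left) (auto simp: li_weight_def)
  finally show ?thesis .
qed

lemma li_sum_diff:
  assumes "x \<le> y"
  shows "li_sum \<delta> y - li_sum \<delta> x = (\<Sum>i\<in>{x<..y}. li_weight \<delta> i)"
proof -
  have "{..y} = {..x} \<union> {x<..y}" using assms by auto
  hence "li_sum \<delta> y = li_sum \<delta> x + (\<Sum>i\<in>{x<..y}. li_weight \<delta> i)"
    unfolding li_sum_eq by (subst sum.union_disjoint[symmetric]) auto
  thus ?thesis by simp
qed

lemma li_block_eq:
  assumes K: "K \<ge> 3"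
  shows "li_block \<delta> K j = (li_sum \<delta> (j * K + (K - 1) div 2) - li_sum \<delta> (j * K))
     - (li_sum \<delta> ((j + 1) * K - 1) - li_sum \<delta> ((j + 1) * K - 1 - (K - 1) div 2))"
proof -
  let ?h = "(K - 1) div 2"
  have e: "(j + 1) * K = j * K + K" "?h < K" using K by auto
  have "li_sum \<delta> (j * K + ?h) - li_sum \<delta> (j * K) = (\<Sum>r=1..?h. li_weight \<delta> (j * K + r))"
    by (subst li_sum_diff, simp)
       (rule sum.reindex_bij_witness[where i = "\<lambda>r. j * K + r" and j = "\<lambda>i. i - j * K"], auto)
  moreover have "li_sum \<delta> ((j + 1) * K - 1) - li_sum \<delta> ((j + 1) * K - 1 - ?h) = (\<Sum>r=1..?h. li_weight \<delta> ((j + 1) * K - r))"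
    by (subst li_sum_diff, simp)
       (rule sum.reindex_bij_witness[where i = "\<lambda>r. (j + 1) * K - r" and j = "\<lambda>i. (j + 1) * K - i"], use e in auto)
  ultimately show ?thesis by (simp add: li_block_def sum_subtractf)
qed

lemma mod_block: "j * K \<le> n \<Longrightarrow> n < j * K + K \<Longrightarrow> n mod K = n - j * (K::nat)"
proof -
  assume n: "j * K \<le> n" "n < j * K + K"
  then obtain x where x: "n = j * K + x" using le_Suc_ex by blast
  thus ?thesis using n by simp
qed

text \<open>The two halves miss at most 0 and K/2 among the residues. Neither is coprime to K when K
  \<ge> 3.\<close>

lemma card_half_reduced_residues:
  fixes K :: nat
  assumes K: "K \<ge> 3"
  defines "h \<equiv> (K - 1) div 2"
  shows "2 * card {r \<in> {1..h}. coprime r K} = totient K"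
    and "2 * card {r \<in> {K - h..<K}. coprime r K} = totient K"
proof -
  let ?A = "{r \<in> {1..h}. coprime r K}" and ?B = "{r \<in> {K - h..<K}. coprime r K}"
  have cop: "coprime (K - r) K \<longleftrightarrow> coprime r K" if "r \<le> K" for r
  proof -
    have "gcd (K - r) K = gcd r K" using gcd_diff2_nat[OF that] .
    thus ?thesis unfolding coprime_iff_gcd_eq_1 by (simp only:)
  qed
  have bij: "bij_betw (\<lambda>r. K - r) ?A ?B"
    by (rule bij_betw_byWitness[where f' = "\<lambda>r. K - r"]) (use K in \<open>auto simp: cop h_def\<close>)
  hence AB: "card ?A = card ?B" by (rule bij_betw_same_card)
  have "totatives K = ?A \<union> ?B"
  proof (intro equalityI subsetI)
    fix r assume r: "r \<in> totatives K"
    hence r': "0 < r" "r < K" "coprime r K" using K totatives_less[OF r] by (auto simp: in_totatives_iff)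
    have "r \<le> h \<or> K - h \<le> r"
    proof (rule ccontr)
      assume "\<not> (r \<le> h \<or> K - h \<le> r)"
      moreover have "2 * h + 2 \<ge> K" using K unfolding h_def by linarith
      ultimately have "K = 2 * r" by linarith
      hence "r dvd K" by simp
      hence "r = 1" using r'(3) by (metis coprime_common_divisor_nat dvd_refl)
      thus False using K \<open>K = 2 * r\<close> by simp
    qed
    thus "r \<in> ?A \<union> ?B" using r' by auto
  qed (use K in \<open>auto simp: in_totatives_iff h_def\<close>)
  moreover have "h < K - h" using K unfolding h_def by linarith
  hence "?A \<inter> ?B = {}" by auto
  ultimately have "totient K = card ?A + card ?B"
    unfolding totient_def by (simp only:) (rule card_Un_disjoint, auto)
  thus "2 * card ?A = totient K" "2 * card ?B = totient K" using AB by simp_all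
qed

text \<open>Rounding \<beta> to a block boundary may add up to K. As ln K \<ge> 1, raising C to C +
  1 absorbs this.\<close>

lemma add_le_mult_log_powr:
  assumes K: "K \<ge> (3::nat)" and C: "C > 0" and a: "a > 0" and \<beta>: "real \<beta> \<le> C * real K * ln (real K) powr a"
  shows "real \<beta> + real K \<le> (C + 1) * real K * ln (real K) powr a"
proof -
  have "exp 1 \<le> real K" using exp_le K by linarith
  hence "ln (real K) \<ge> 1" using K by (subst ln_ge_iff) auto
  hence "ln (real K) powr a \<ge> 1" using a by (intro ge_one_powr_ge_zero) auto
  hence "real K * 1 \<le> real K * ln (real K) powr a" by (intro mult_left_mono) auto
  thus ?thesis using \<beta> by (simp add: algebra_simps)
qed

section \<open>Counting primes with residues in the lower and the upper half\<close>

context integral_semigroup begin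

definition low :: "nat \<Rightarrow> nat \<Rightarrow> 'a set" where
  "low K y = {p \<in> P. N p \<le> y \<and> 1 \<le> N p mod K \<and> N p mod K \<le> (K - 1) div 2}"

definition high :: "nat \<Rightarrow> nat \<Rightarrow> 'a set" where
  "high K y = {p \<in> P. N p \<le> y \<and> K - (K - 1) div 2 \<le> N p mod K}"

lemma finite_low [simp]: "finite (low K y)" and finite_high [simp]: "finite (high K y)"
  by (auto intro!: finite_subset[OF _ finite_primes_le[of y]] simp: low_def high_def)

lemma primes_between_eq: "primes_between P N 1 y = {p \<in> P. N p \<le> y}"
proof -
  have "1 \<le> N p" for p using N_pos[of p] by linarith
  thus ?thesis unfolding primes_between_def by blast
qed

text \<open>Each half contains \<phi>(K)/2 reduced classes with at least \<gamma> primes apiece.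
  Since there are \<gamma> \<phi>(K) + \<iota> primes in all, each half has between \<gamma>
  \<phi>(K)/2 and \<gamma> \<phi>(K)/2 + \<iota>, even with the primes in non-reduced classes
  included.\<close>

lemma residue_balance:
  assumes K: "K \<ge> 3" and Pint: "P_integer P N 1 \<beta> \<gamma> \<iota> k" and NK: "N k = K"
  shows "card (low K \<beta>) \<le> card (high K \<beta>) + \<iota>" "card (high K \<beta>) \<le> card (low K \<beta>) + \<iota>"
proof -
  define h where "h = (K - 1) div 2"
  define M where "M = {p \<in> P. N p \<le> \<beta>}"
  have finM: "finite M" unfolding M_def by (rule finite_primes_le)
  have cls: "\<gamma> \<le> card {p \<in> M. N p mod K = r}" if "coprime r K" "r < K" for r
  proof -
    have "\<gamma> \<le> card {p \<in> primes_between P N 1 \<beta>. [N p = r] (mod K)}"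
      using Pint that(1) unfolding P_integer_def NK by blast
    moreover have "{p \<in> primes_between P N 1 \<beta>. [N p = r] (mod K)} = {p \<in> M. N p mod K = r}"
      unfolding primes_between_eq M_def using that(2) by (auto simp: unique_euclidean_semiring_class.cong_def)
    ultimately show ?thesis by simp
  qed
  have tot: "card M = \<gamma> * totient K + \<iota>"
    using Pint unfolding P_integer_def NK primes_between_eq M_def by blast
  have part: "\<gamma> * card {r \<in> R. coprime r K} \<le> card S"
    if R: "finite R" "\<And>r. r \<in> R \<Longrightarrow> r < K" and S: "finite S" "\<And>p r. r \<in> R \<Longrightarrow> p \<in> M \<Longrightarrow> N p mod K = r \<Longrightarrow> p \<in> S" for R S
  proof -
    let ?R = "{r \<in> R. coprime r K}"
    have "\<gamma> * card ?R = (\<Sum>r\<in>?R. \<gamma>)" by simp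
    also have "\<dots> \<le> (\<Sum>r\<in>?R. card {p \<in> M. N p mod K = r})"
      using R by (intro sum_mono cls) auto
    also have "\<dots> = card (\<Union>r\<in>?R. {p \<in> M. N p mod K = r})"
      using R finM by (intro card_UN_disjoint[symmetric]) auto
    also have "\<dots> \<le> card S" using S by (intro card_mono) auto
    finally show ?thesis .
  qed
  have lo: "\<gamma> * card {r \<in> {1..h}. coprime r K} \<le> card (low K \<beta>)"
    by (rule part[OF _ _ finite_low]) (use K in \<open>auto simp: low_def M_def h_def\<close>)
  have hi: "\<gamma> * card {r \<in> {K - h..<K}. coprime r K} \<le> card (high K \<beta>)"
    by (rule part[OF _ _ finite_high]) (use K in \<open>auto simp: high_def M_def h_def\<close>)
  have "h < K - h" using K unfolding h_def by linarith
  hence "low K \<beta> \<inter> high K \<beta> = {}" unfolding low_def high_def h_def[symmetric] by auto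
  hence "card (low K \<beta>) + card (high K \<beta>) = card (low K \<beta> \<union> high K \<beta>)"
    by (intro card_Un_disjoint[symmetric] finite_low finite_high)
  also have "\<dots> \<le> card M" by (intro card_mono finM) (auto simp: low_def high_def M_def)
  finally have le: "card (low K \<beta>) + card (high K \<beta>) \<le> \<gamma> * totient K + \<iota>" using tot by simp
  have "\<gamma> * totient K = \<gamma> * card {r \<in> {1..h}. coprime r K} + \<gamma> * card {r \<in> {K - h..<K}. coprime r K}"
    using card_half_reduced_residues[OF K, folded h_def]
    by (metis (no_types, lifting) mult_2 mult_left_cancel add_mult_distrib2 zero_neq_numeral)
  moreover have "card {r \<in> {1..h}. coprime r K} = card {r \<in> {K - h..<K}. coprime r K}"
    using card_half_reduced_residues[OF K, folded h_def] by linarith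
  ultimately show "card (low K \<beta>) \<le> card (high K \<beta>) + \<iota>" "card (high K \<beta>) \<le> card (low K \<beta>) + \<iota>"
    using lo hi le by simp_all
qed

text \<open>The reduced class of K - 1 contains a prime, whose norm is at least K - 1. So the range
  up to \<beta> essentially contains block 0, on which the argument rests.\<close>

lemma P_integer_bound_ge:
  assumes K: "K \<ge> 2" and Pint: "P_integer P N 1 \<beta> \<gamma> \<iota> k" and NK: "N k = K" and \<gamma>: "\<gamma> > 0"
  shows "K - 1 \<le> \<beta>"
proof -
  have "coprime (K - 1) K" using K by (intro coprime_diff_one_left_nat) simp
  hence "\<gamma> \<le> card {p \<in> primes_between P N 1 \<beta>. [N p = K - 1] (mod K)}"
    using Pint unfolding P_integer_def NK by blast
  hence "{p \<in> primes_between P N 1 \<beta>. [N p = K - 1] (mod K)} \<noteq> {}" using \<gamma> by (metis card.empty leD)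
  then obtain p where "N p \<le> \<beta>" "N p mod K = K - 1"
    using K by (auto simp: primes_between_def unique_euclidean_semiring_class.cong_def)
  thus ?thesis using mod_less_eq_dividend[of "N p" K] by linarith
qed

lemma card_between:
  assumes "x \<le> y"
  shows "real (card {p \<in> P. x < N p \<and> N p \<le> y}) = real (prime_count y) - real (prime_count x)"
proof -
  have "{p \<in> P. N p \<le> y} = {p \<in> P. N p \<le> x} \<union> {p \<in> P. x < N p \<and> N p \<le> y}" using assms by auto
  hence "prime_count y = prime_count x + card {p \<in> P. x < N p \<and> N p \<le> y}"
    unfolding prime_count_def
    by (subst card_Un_disjoint[symmetric]) (auto intro: finite_primes_le finite_subset[OF _ finite_primes_le[of y]])
  thus ?thesis by simp
qed

text \<open>Here the residue condition turns into an interval condition: block m adds to the lower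
  half exactly the primes with mK < N(p) \<le> mK + (K-1) div 2. For m = 0 truncated subtraction
  gives the cut 0, below which there are no primes.\<close>

lemma card_low_Suc:
  assumes K: "K \<ge> 3"
  shows "real (card (low K ((m + 1) * K - 1))) = real (card (low K (m * K - 1)))
     + (real (prime_count (m * K + (K - 1) div 2)) - real (prime_count (m * K)))"
proof -
  let ?h = "(K - 1) div 2"
  have "low K ((m + 1) * K - 1) = low K (m * K - 1) \<union> {p \<in> P. m * K < N p \<and> N p \<le> m * K + ?h}"
  proof (rule Set.set_eqI)
    fix p
    show "p \<in> low K ((m + 1) * K - 1) \<longleftrightarrow> p \<in> low K (m * K - 1) \<union> {p \<in> P. m * K < N p \<and> N p \<le> m * K + ?h}"
    proof (cases "m * K \<le> N p \<and> N p < m * K + K")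
      case True
      with N_pos[of p] show ?thesis using K by (auto simp: low_def mod_block[of m K "N p"])
    next
      case False
      have e: "(m + 1) * K = m * K + K" "?h < K" using K by auto
      have "N p \<le> (m + 1) * K - 1 \<longleftrightarrow> N p \<le> m * K - 1" "\<not> (m * K < N p \<and> N p \<le> m * K + ?h)"
        using False e N_pos[of p] by linarith+
      thus ?thesis unfolding low_def by blast
    qed
  qed
  moreover have "low K (m * K - 1) \<inter> {p \<in> P. m * K < N p \<and> N p \<le> m * K + ?h} = {}" by (auto simp: low_def)
  moreover have "finite {p \<in> P. m * K < N p \<and> N p \<le> m * K + ?h}"
    by (rule finite_subset[OF _ finite_primes_le[of "m * K + ?h"]]) auto
  ultimately have "card (low K ((m + 1) * K - 1)) = card (low K (m * K - 1)) + card {p \<in> P. m * K < N p \<and> N p \<le> m * K + ?h}"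
    by (simp add: card_Un_disjoint)
  thus ?thesis by (simp add: card_between)
qed

lemma card_high_Suc:
  assumes K: "K \<ge> 3"
  shows "real (card (high K ((m + 1) * K - 1))) = real (card (high K (m * K - 1)))
     + (real (prime_count ((m + 1) * K - 1)) - real (prime_count ((m + 1) * K - 1 - (K - 1) div 2)))"
proof -
  let ?h = "(K - 1) div 2"
  have "high K ((m + 1) * K - 1) = high K (m * K - 1) \<union> {p \<in> P. (m + 1) * K - 1 - ?h < N p \<and> N p \<le> (m + 1) * K - 1}"
  proof (rule Set.set_eqI)
    fix p
    show "p \<in> high K ((m + 1) * K - 1) \<longleftrightarrow> p \<in> high K (m * K - 1) \<union> {p \<in> P. (m + 1) * K - 1 - ?h < N p \<and> N p \<le> (m + 1) * K - 1}"
    proof (cases "m * K \<le> N p \<and> N p < m * K + K")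
      case True
      have "(K - ?h \<le> N p - m * K) \<longleftrightarrow> ((m + 1) * K - 1 - ?h < N p)"
      proof -
        have "(m + 1) * K = m * K + K" "?h < K" using K by auto
        thus ?thesis using True by linarith
      qed
      with True N_pos[of p] show ?thesis using K by (auto simp: high_def mod_block[of m K "N p"])
    next
      case False
      have e: "(m + 1) * K = m * K + K" "?h < K" using K by auto
      have "N p \<le> (m + 1) * K - 1 \<longleftrightarrow> N p \<le> m * K - 1" "\<not> ((m + 1) * K - 1 - ?h < N p \<and> N p \<le> (m + 1) * K - 1)"
        using False e N_pos[of p] by linarith+
      thus ?thesis unfolding high_def by blast
    qed
  qed
  moreover have "high K (m * K - 1) \<inter> {p \<in> P. (m + 1) * K - 1 - ?h < N p \<and> N p \<le> (m + 1) * K - 1} = {}"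
  proof -
    have "(m + 1) * K = m * K + K" "?h < K" using K by auto
    thus ?thesis by (auto simp: high_def)
  qed
  moreover have "finite {p \<in> P. (m + 1) * K - 1 - ?h < N p \<and> N p \<le> (m + 1) * K - 1}"
    by (rule finite_subset[OF _ finite_primes_le[of "(m + 1) * K - 1"]]) auto
  ultimately have "card (high K ((m + 1) * K - 1)) = card (high K (m * K - 1)) + card {p \<in> P. (m + 1) * K - 1 - ?h < N p \<and> N p \<le> (m + 1) * K - 1}"
    by (simp add: card_Un_disjoint)
  thus ?thesis using card_between[OF diff_le_self, of "(m + 1) * K - 1" ?h] by (simp only: of_nat_add)
qed

text \<open>The lower and upper half of a block are intervals with four endpoints altogether, so
  every block costs four errors of the prime number theorem.\<close>

lemma half_system_difference:
  assumes K: "K \<ge> 3" and err: "\<And>x. (K - 1) div 2 \<le> x \<Longrightarrow> x \<le> m * K \<Longrightarrow> \<bar>real (prime_count x) - li_sum \<delta> x\<bar> \<le> e"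
  shows "\<bar>(real (card (low K (m * K - 1))) - real (card (high K (m * K - 1)))) - (\<Sum>j<m. li_block \<delta> K j)\<bar> \<le> 4 * e * real m"
  using err
proof (induction m)
  case 0
  have "low K 0 = {}" "high K 0 = {}" using N_pos by (auto simp: low_def high_def)
  thus ?case by simp
next
  case (Suc m)
  define h where "h = (K - 1) div 2"
  have e: "(m + 1) * K = m * K + K" "2 * h \<le> K - 1" using K by (auto simp: h_def)
  have IH: "\<bar>(real (card (low K (m * K - 1))) - real (card (high K (m * K - 1)))) - (\<Sum>j<m. li_block \<delta> K j)\<bar> \<le> 4 * e * real m"
    by (rule Suc.IH) (use Suc.prems in auto)
  have er: "\<bar>real (prime_count x) - li_sum \<delta> x\<bar> \<le> e" if "h \<le> x" "x \<le> (m + 1) * K" for x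
    using Suc.prems[of x] that by (simp add: h_def)
  have "e \<ge> 0" using er[of "(m + 1) * K"] e by linarith
  \<comment> \<open>The endpoint 0 lies outside the range of the error hypothesis, but there both
    counts are 0.\<close>
  have e1: "\<bar>real (prime_count (m * K)) - li_sum \<delta> (m * K)\<bar> \<le> e"
  proof (cases "m = 0")
    case True
    have "{p \<in> P. N p \<le> 0} = {}" using N_pos by auto
    hence "prime_count 0 = 0" unfolding prime_count_def by (metis card.empty)
    thus ?thesis using True \<open>e \<ge> 0\<close> by (simp add: li_sum_def)
  next
    case False
    hence "1 * K \<le> m * K" by (intro mult_right_mono) auto
    thus ?thesis using e by (intro er) linarith+
  qed
  have e2: "\<bar>real (prime_count (m * K + h)) - li_sum \<delta> (m * K + h)\<bar> \<le> e"
    using e by (intro er) linarith+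
  have e3: "\<bar>real (prime_count ((m + 1) * K - 1)) - li_sum \<delta> ((m + 1) * K - 1)\<bar> \<le> e"
    using e by (intro er) linarith+
  have e4: "\<bar>real (prime_count ((m + 1) * K - 1 - h)) - li_sum \<delta> ((m + 1) * K - 1 - h)\<bar> \<le> e"
    using e by (intro er) linarith+
  have combine: "\<bar>(x + (p2 - p1)) - (y + (p3 - p4)) - (s + ((l2 - l1) - (l3 - l4)))\<bar> \<le> E + 4 * e"
    if "\<bar>x - y - s\<bar> \<le> E" "\<bar>p1 - l1\<bar> \<le> e" "\<bar>p2 - l2\<bar> \<le> e" "\<bar>p3 - l3\<bar> \<le> e" "\<bar>p4 - l4\<bar> \<le> e"
    for x y s E p1 p2 p3 p4 l1 l2 l3 l4 :: real
  proof (rule abs_leI)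
    note b = that[THEN abs_le_D1] that[THEN abs_le_D2]
    show "(x + (p2 - p1)) - (y + (p3 - p4)) - (s + ((l2 - l1) - (l3 - l4))) \<le> E + 4 * e"
      and "- ((x + (p2 - p1)) - (y + (p3 - p4)) - (s + ((l2 - l1) - (l3 - l4)))) \<le> E + 4 * e"
      using b by linarith+
  qed
  have "4 * e * real (m + 1) = 4 * e * real m + 4 * e" by (simp add: algebra_simps)
  moreover have "(\<Sum>j<m + 1. li_block \<delta> K j) = (\<Sum>j<m. li_block \<delta> K j) + li_block \<delta> K m" by simp
  ultimately show ?case
    unfolding Suc_eq_plus1
    using combine[OF IH e1 e2 e3 e4, folded li_block_eq[OF K, of \<delta> m, folded h_def]
        card_low_Suc[OF K, of m, folded h_def] card_high_Suc[OF K, of m, folded h_def]]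
    by (simp only:)
qed

text \<open>Since x \<le> B K ln^a K, x^\<delta> is O(K^\<delta> ln^(a \<delta>) K). The saving ln^j
  with j \<ge> a \<delta> + a + 3 pays for this and leaves a + 3 powers: a for the number of blocks,
  and 3 to beat the main term of order K^\<delta>/ln^2 K.\<close>

lemma prime_count_error_log:
  assumes A: "axiom_A (\<lambda>g. real (N g)) \<delta>" and \<delta>: "\<delta> > 0" and B: "B > 0" and a: "a > 0"
  shows "\<exists>c>0. \<exists>K0. \<forall>K\<ge>K0. \<forall>x. (K - 1) div 2 \<le> x \<longrightarrow> real x \<le> B * real K * ln (real K) powr a \<longrightarrow>
     \<bar>real (prime_count x) - li_sum \<delta> x\<bar> \<le> c * real K powr \<delta> / ln (real K) powr (a + 3)"
proof -
  define j where "j = nat \<lceil>a * \<delta> + a + 3\<rceil>"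
  have j2: "real j \<ge> a * \<delta> + a + 3" unfolding j_def by (rule real_nat_ceiling_ge)
  moreover have "a * \<delta> > 0" using a \<delta> by simp
  ultimately have "real j \<ge> 1" using a by linarith
  hence "j \<ge> 1" by simp
  note j = this j2
  obtain c n0 where c: "c > 0" "\<And>n. n \<ge> n0 \<Longrightarrow> \<bar>real (prime_count n) - li_sum \<delta> n\<bar> \<le> c * real n powr \<delta> / ln (real n) ^ j"
    using abstract_prime_number_theorem[OF A j(1)] by blast
  define c' where "c' = c * B powr \<delta> * 2 ^ j"
  define K0 where "K0 = max 100 (2 * n0 + 3)"
  have "\<bar>real (prime_count x) - li_sum \<delta> x\<bar> \<le> c' * real K powr \<delta> / ln (real K) powr (a + 3)"
    if K: "K \<ge> K0" and x: "(K - 1) div 2 \<le> x" "real x \<le> B * real K * ln (real K) powr a" for K x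
  proof -
    have K100: "K \<ge> 100" and xn: "x \<ge> n0" using K x unfolding K0_def by linarith+
    define l where "l = ln (real K)"
    have "exp 1 \<le> real K" using exp_le K100 by linarith
    hence l: "l \<ge> 1" unfolding l_def using K100 by (subst ln_ge_iff) auto
    \<comment> \<open>As x is at least about K/2 and K \<ge> 100, K \<le> x^2 and so ln x \<ge> (ln
      K)/2.\<close>
    have "K \<le> 2 * x + 2" using x by linarith
    hence "real K \<le> 4 * real x" using K100 by linarith
    hence "real K * real K \<le> (4 * real x) * (4 * real x)" by (intro mult_mono) auto
    moreover have "16 * real K \<le> real K * real K" using K100 by (intro mult_right_mono) auto
    ultimately have "real K \<le> real x ^ 2" by (simp add: power2_eq_square)
    hence "ln (real K) \<le> ln (real x ^ 2)" using K100 x by (subst ln_le_cancel_iff) auto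
    hence lx: "l / 2 \<le> ln (real x)" unfolding l_def by (simp add: ln_realpow)
    have "\<bar>real (prime_count x) - li_sum \<delta> x\<bar> \<le> c * real x powr \<delta> / ln (real x) ^ j" by (rule c(2)[OF xn])
    also have "\<dots> \<le> c * (B * real K * l powr a) powr \<delta> / (l / 2) ^ j"
      using x lx l c \<delta> unfolding l_def[symmetric]
      by (intro frac_le mult_left_mono powr_mono2 power_mono mult_nonneg_nonneg) auto
    also have "\<dots> = c' * (real K powr \<delta> * (l powr (a * \<delta>) / l ^ j))"
      using B l by (simp add: c'_def powr_mult powr_powr power_divide)
    also have "l powr (a * \<delta>) / l ^ j = l powr (a * \<delta> - real j)"
      using l by (simp add: powr_diff powr_realpow)
    also have "c' * (real K powr \<delta> * l powr (a * \<delta> - real j)) \<le> c' * (real K powr \<delta> * l powr (- (a + 3)))"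
      using j l c B by (intro mult_left_mono powr_mono) (auto simp: c'_def)
    also have "\<dots> = c' * real K powr \<delta> / l powr (a + 3)"
      by (simp only: powr_minus divide_inverse mult.assoc)
    finally show ?thesis by (simp add: l_def)
  qed
  moreover have "c' > 0" using c B by (simp add: c'_def)
  ultimately show ?thesis by blast
qed

end

section \<open>Contradiction for elements of large norm\<close>

context integral_semigroup begin

text \<open>There are at most B ln^a K blocks, which reduces the saving ln^(a+3) K per endpoint to
  ln^3 K in total.\<close>

lemma half_system_difference_log:
  assumes A: "axiom_A (\<lambda>g. real (N g)) \<delta>" and \<delta>: "\<delta> > 0" and B: "B > 0" and a: "a > 0"
  shows "\<exists>c>0. \<exists>K0. \<forall>K\<ge>K0. \<forall>m. real (m * K) \<le> B * real K * ln (real K) powr a \<longrightarrow>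
     \<bar>(real (card (low K (m * K - 1))) - real (card (high K (m * K - 1)))) - (\<Sum>j<m. li_block \<delta> K j)\<bar>
       \<le> c * real K powr \<delta> / ln (real K) powr 3"
proof -
  obtain c K0 where c: "c > 0" "\<And>K x. K \<ge> K0 \<Longrightarrow> (K - 1) div 2 \<le> x \<Longrightarrow> real x \<le> B * real K * ln (real K) powr a \<Longrightarrow>
     \<bar>real (prime_count x) - li_sum \<delta> x\<bar> \<le> c * real K powr \<delta> / ln (real K) powr (a + 3)"
    using prime_count_error_log[OF A \<delta> B a] by blast
  have "\<bar>(real (card (low K (m * K - 1))) - real (card (high K (m * K - 1)))) - (\<Sum>j<m. li_block \<delta> K j)\<bar>
       \<le> (4 * c * B) * real K powr \<delta> / ln (real K) powr 3"
    if K: "K \<ge> max 3 K0" and m: "real (m * K) \<le> B * real K * ln (real K) powr a" for K m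
  proof -
    define l where "l = ln (real K)"
    have l: "l > 0" unfolding l_def using K by simp
    define e where "e = c * real K powr \<delta> / l powr (a + 3)"
    have e: "e \<ge> 0" using c by (simp add: e_def)
    have "\<bar>(real (card (low K (m * K - 1))) - real (card (high K (m * K - 1)))) - (\<Sum>j<m. li_block \<delta> K j)\<bar> \<le> 4 * e * real m"
    proof (rule half_system_difference)
      fix x assume x: "(K - 1) div 2 \<le> x" "x \<le> m * K"
      have "real x \<le> real (m * K)" using x(2) by (simp only: of_nat_le_iff)
      thus "\<bar>real (prime_count x) - li_sum \<delta> x\<bar> \<le> e"
        unfolding e_def l_def using c(2)[of K x] K x m by simp
    qed (use K in simp)
    also have "real m \<le> B * l powr a"
    proof -
      have "real m * real K \<le> (B * l powr a) * real K" using m by (simp add: l_def mult_ac)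
      thus ?thesis using K by (simp add: mult_le_cancel_right)
    qed
    hence "4 * e * real m \<le> 4 * e * (B * l powr a)" using e by (intro mult_left_mono) auto
    also have "\<dots> = (4 * c * B) * real K powr \<delta> * (l powr a / l powr (a + 3))" by (simp add: e_def)
    also have "l powr a / l powr (a + 3) = 1 / l powr 3" using l by (simp add: powr_add)
    finally show ?thesis by (simp add: l_def)
  qed
  moreover have "4 * c * B > 0" using c B by simp
  ultimately show ?thesis by blast
qed

text \<open>The cut is moved to a block boundary without increasing the lower count minus the upper
  count. If \<beta> has not reached the upper half of its block, the part of the block up to \<beta>
  is discarded, which loses no upper primes; otherwise the block is completed, which adds no lower
  ones.\<close>

lemma truncate_to_blocks:
  assumes K: "K \<ge> 3" and \<beta>: "K - 1 \<le> \<beta>"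
  shows "\<exists>m\<ge>1. m * K \<le> \<beta> + K \<and>
    card (low K (m * K - 1)) + card (high K \<beta>) \<le> card (low K \<beta>) + card (high K (m * K - 1))"
proof -
  define h where "h = (K - 1) div 2"
  define q where "q = \<beta> div K"
  have h: "h < K - h" "h < K" using K unfolding h_def by linarith+
  have "q * K \<le> \<beta>" unfolding q_def by simp
  moreover have "\<beta> < q * K + K" unfolding q_def
    using K by (metis add.commute dividend_less_div_times less_le_trans zero_less_numeral)
  ultimately have q: "q * K \<le> \<beta>" "\<beta> < q * K + K" .
  show ?thesis
  proof (cases "\<beta> + h < q * K + K")
    case True
    \<comment> \<open>As \<beta> \<ge> K - 1, the cut lies at the end of block 0 or beyond it, so in
      this case it never falls back to 0.\<close>
    have "q \<noteq> 0"
    proof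
      assume "q = 0"
      moreover have "h \<ge> 1" using K unfolding h_def by linarith
      ultimately show False using True \<beta> K by simp
    qed
    moreover have "card (low K (q * K - 1)) \<le> card (low K \<beta>)"
      using q by (intro card_mono finite_low) (auto simp: low_def)
    moreover have "card (high K \<beta>) \<le> card (high K (q * K - 1))"
    proof (intro card_mono finite_high subsetI)
      fix p assume p: "p \<in> high K \<beta>"
      hence p': "p \<in> P" "N p \<le> \<beta>" "K - h \<le> N p mod K" by (auto simp: high_def h_def)
      have "\<not> q * K \<le> N p"
      proof
        assume "q * K \<le> N p"
        moreover from this have "N p mod K = N p - q * K" using p' q by (intro mod_block) auto
        ultimately show False using p' True h by linarith
      qed
      hence "N p \<le> q * K - 1" by linarith
      thus "p \<in> high K (q * K - 1)" using p' by (simp add: high_def h_def)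
    qed
    ultimately show ?thesis using q by (intro exI[of _ q]) auto
  next
    case False
    have Q: "(q + 1) * K = q * K + K" by simp
    have "card (high K \<beta>) \<le> card (high K ((q + 1) * K - 1))"
    proof (intro card_mono finite_high subsetI)
      fix p assume p: "p \<in> high K \<beta>"
      hence p': "p \<in> P" "N p \<le> \<beta>" "K - h \<le> N p mod K" by (auto simp: high_def h_def)
      have "N p \<le> (q + 1) * K - 1" using p' q Q by linarith
      thus "p \<in> high K ((q + 1) * K - 1)" using p' by (simp add: high_def h_def)
    qed
    moreover have "card (low K ((q + 1) * K - 1)) \<le> card (low K \<beta>)"
    proof (intro card_mono finite_low subsetI)
      fix p assume p: "p \<in> low K ((q + 1) * K - 1)"
      hence p': "p \<in> P" "N p \<le> (q + 1) * K - 1" "1 \<le> N p mod K" "N p mod K \<le> h" by (auto simp: low_def h_def)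
      have lt: "N p < q * K + K" using p'(2) Q K by linarith
      have "N p \<le> \<beta>"
      proof (rule ccontr)
        assume n: "\<not> N p \<le> \<beta>"
        hence "N p mod K = N p - q * K" using lt q by (intro mod_block) auto
        thus False using n False p' h by linarith
      qed
      thus "p \<in> low K \<beta>" using p' by (simp add: low_def h_def)
    qed
    ultimately show ?thesis using q by (intro exI[of _ "q + 1"]) auto
  qed
qed

text \<open>For \<delta> > 1 the opposite inequality is wanted, where the choice made in
  \<open>truncate_to_blocks\<close> fails. Each count is instead allowed to change by all primes
  between the two cuts.\<close>

lemma half_system_perturb:
  "card (high K y) + card (low K x) \<le> card (high K x) + card (low K y) + 2 * card {p \<in> P. min x y < N p \<and> N p \<le> max x y}"
proof -
  let ?G = "{p \<in> P. min x y < N p \<and> N p \<le> max x y}"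
  have fin: "finite ?G" by (rule finite_subset[OF _ finite_primes_le[of "max x y"]]) auto
  have "card (high K y) \<le> card (high K x \<union> ?G)"
    by (intro card_mono finite_UnI finite_high fin) (auto simp: high_def)
  also have "\<dots> \<le> card (high K x) + card ?G" by (rule card_Un_le)
  finally have 1: "card (high K y) \<le> card (high K x) + card ?G" .
  have "card (low K x) \<le> card (low K y \<union> ?G)"
    by (intro card_mono finite_UnI finite_low fin) (auto simp: low_def)
  also have "\<dots> \<le> card (low K y) + card ?G" by (rule card_Un_le)
  finally show ?thesis using 1 by simp
qed

text \<open>The balance forces the lower excess below C ln^b K, after truncation as well. The excess
  is at least K^\<delta>/(16 ln^2 K) - 2, up to an error O(K^\<delta>/ln^3 K), since blocks after
  the first contribute nonnegatively.\<close>

lemma finitely_many_concave: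
  assumes A: "axiom_A (\<lambda>g. real (N g)) \<delta>" and \<delta>: "\<delta> > 0" "\<delta> \<le> 1" and a: "a > 0" and b: "b > 0" and C: "C > 0"
  shows "\<exists>K0. \<forall>k \<beta> \<gamma> \<iota>. N k \<ge> K0 \<longrightarrow> \<gamma> > 0 \<longrightarrow>
     real \<beta> \<le> C * real (N k) * ln (real (N k)) powr a \<longrightarrow> real \<iota> \<le> C * ln (real (N k)) powr b \<longrightarrow>
     \<not> P_integer P N 1 \<beta> \<gamma> \<iota> k"
proof -
  have C1: "C + 1 > 0" using C by simp
  obtain c K1 where c: "c > 0" and diff: "\<And>K m. K \<ge> K1 \<Longrightarrow> real (m * K) \<le> (C + 1) * real K * ln (real K) powr a \<Longrightarrow>
     \<bar>(real (card (low K (m * K - 1))) - real (card (high K (m * K - 1)))) - (\<Sum>j<m. li_block \<delta> K j)\<bar>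
       \<le> c * real K powr \<delta> / ln (real K) powr 3"
    using half_system_difference_log[OF A \<delta>(1) C1 a] by blast
  have "\<forall>\<^sub>F x::real in at_top. C * ln x powr b + 2 + c * x powr \<delta> / ln x powr 3 < x powr \<delta> / (16 * ln x ^ 2)"
    using c C b \<delta> by real_asymp
  then obtain x0 where x0: "\<And>x. x \<ge> x0 \<Longrightarrow> C * ln x powr b + 2 + c * x powr \<delta> / ln x powr 3 < x powr \<delta> / (16 * ln x ^ 2)"
    unfolding eventually_at_top_linorder by blast
  define K0 where "K0 = max 16 (max K1 (nat \<lceil>x0\<rceil>))"
  have False if k: "N k \<ge> K0" and \<gamma>: "\<gamma> > 0" and \<beta>: "real \<beta> \<le> C * real (N k) * ln (real (N k)) powr a"
    and \<iota>: "real \<iota> \<le> C * ln (real (N k)) powr b" and Pint: "P_integer P N 1 \<beta> \<gamma> \<iota> k" for k \<beta> \<gamma> \<iota>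
  proof -
    define K where "K = N k"
    have K: "K \<ge> 16" "K \<ge> K1" "real K \<ge> x0" using k unfolding K0_def K_def by linarith+
    have K3: "K \<ge> 3" "K \<ge> 2" using K by auto
    have "K - 1 \<le> \<beta>" by (rule P_integer_bound_ge[OF K3(2) Pint _ \<gamma>]) (simp add: K_def)
    then obtain m where m: "m \<ge> 1" "m * K \<le> \<beta> + K"
      and le: "card (low K (m * K - 1)) + card (high K \<beta>) \<le> card (low K \<beta>) + card (high K (m * K - 1))"
      using truncate_to_blocks[OF K3(1)] by blast
    have "card (low K \<beta>) \<le> card (high K \<beta>) + \<iota>"
      by (rule residue_balance[OF K3(1) Pint]) (simp add: K_def)
    hence "card (low K (m * K - 1)) \<le> card (high K (m * K - 1)) + \<iota>" using le by linarith
    hence up: "real (card (low K (m * K - 1))) - real (card (high K (m * K - 1))) \<le> real \<iota>" by linarith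
    have "real (m * K) \<le> real \<beta> + real K" using m(2) by linarith
    also have "\<dots> \<le> (C + 1) * real K * ln (real K) powr a"
      by (rule add_le_mult_log_powr[OF K3(1) C a]) (use \<beta> in \<open>simp add: K_def\<close>)
    finally have mK: "real (m * K) \<le> (C + 1) * real K * ln (real K) powr a" .
    have "{..<m} = insert 0 {1..<m}" using m by auto
    hence "(\<Sum>j<m. li_block \<delta> K j) = li_block \<delta> K 0 + (\<Sum>j=1..<m. li_block \<delta> K j)" by simp
    moreover have "(\<Sum>j=1..<m. li_block \<delta> K j) \<ge> 0"
      by (intro sum_nonneg li_block_nonneg \<delta> K3) auto
    ultimately have "(\<Sum>j<m. li_block \<delta> K j) \<ge> real K powr \<delta> / (16 * ln (real K) ^ 2) - 2"
      using li_block_0_concave[OF \<delta>(2) K(1)] by linarith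
    thus False using diff[OF K(2) mK] up \<iota> x0[OF K(3)] unfolding K_def[symmetric] by linarith
  qed
  thus ?thesis by blast
qed

text \<open>The cut is moved from \<beta> to nK - 1. Between the two lie at most K^(1-e) + 1
  integers, each of weight O((K ln^a K)^(\<delta>-1)), so with two errors of the prime number
  theorem the primes there are too few to offset the gain c K^\<delta>/ln K of the upper half in
  block 0.\<close>

lemma finitely_many_convex:
  assumes A: "axiom_A (\<lambda>g. real (N g)) \<delta>" and \<delta>: "\<delta> > 1" and a: "a > 0" and b: "b > 0" and C: "C > 0" and \<epsilon>: "\<epsilon> > 0"
  shows "\<exists>K0. \<forall>k \<beta> \<gamma> \<iota>. N k \<ge> K0 \<longrightarrow> \<gamma> > 0 \<longrightarrow>
     real \<beta> \<le> C * real (N k) * ln (real (N k)) powr a \<longrightarrow> real \<iota> \<le> C * ln (real (N k)) powr b \<longrightarrow>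
     (\<exists>m::int. \<bar>real \<beta> - real_of_int m * real (N k)\<bar> \<le> real (N k) powr (1 - \<epsilon>)) \<longrightarrow>
     \<not> P_integer P N 1 \<beta> \<gamma> \<iota> k"
proof -
  \<comment> \<open>Passing to a smaller exponent only enlarges the permitted distance, and keeps 1
    - e between 1/2 and 1.\<close>
  define e where "e = min \<epsilon> (1 / 2)"
  have e: "e > 0" "e \<le> 1 / 2" "e \<le> \<epsilon>" using \<epsilon> by (auto simp: e_def)
  have \<delta>0: "\<delta> > 0" using \<delta> by simp
  define B where "B = C + 1"
  have B: "B > 0" using C by (simp add: B_def)
  obtain c1 K1 where c1: "c1 > 0" and diff: "\<And>K m. K \<ge> K1 \<Longrightarrow> real (m * K) \<le> B * real K * ln (real K) powr a \<Longrightarrow>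
     \<bar>(real (card (low K (m * K - 1))) - real (card (high K (m * K - 1)))) - (\<Sum>j<m. li_block \<delta> K j)\<bar>
       \<le> c1 * real K powr \<delta> / ln (real K) powr 3"
    using half_system_difference_log[OF A \<delta>0 B a] by blast
  obtain c2 K2 where c2: "c2 > 0" and pnt: "\<And>K x. K \<ge> K2 \<Longrightarrow> (K - 1) div 2 \<le> x \<Longrightarrow> real x \<le> B * real K * ln (real K) powr a \<Longrightarrow>
     \<bar>real (prime_count x) - li_sum \<delta> x\<bar> \<le> c2 * real K powr \<delta> / ln (real K) powr (a + 3)"
    using prime_count_error_log[OF A \<delta>0 B a] by blast
  obtain c D K3 where c: "c > 0" and blk: "\<And>K. K \<ge> K3 \<Longrightarrow> li_block \<delta> K 0 \<le> D - c * real K powr \<delta> / ln (real K)"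
    using li_block_0_convex[OF \<delta>] by blast
  have "\<forall>\<^sub>F x::real in at_top. C * ln x powr b + 2 * ((x powr (1 - e) + 1) * ((B * x * ln x powr a) powr (\<delta> - 1) / ln 2)
      + 2 * (c2 * x powr \<delta> / ln x powr (a + 3))) + D + c1 * x powr \<delta> / ln x powr 3 < c * x powr \<delta> / ln x"
    using c c1 c2 C b a \<delta> e B by real_asymp
  moreover have "\<forall>\<^sub>F x::real in at_top. x powr (1 - e) < x - 1"
    using e by real_asymp
  ultimately have "\<forall>\<^sub>F x::real in at_top. C * ln x powr b + 2 * ((x powr (1 - e) + 1) * ((B * x * ln x powr a) powr (\<delta> - 1) / ln 2)
      + 2 * (c2 * x powr \<delta> / ln x powr (a + 3))) + D + c1 * x powr \<delta> / ln x powr 3 < c * x powr \<delta> / ln x \<and> x powr (1 - e) < x - 1"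
    by (rule eventually_conj)
  then obtain x0 where x0: "\<And>x. x \<ge> x0 \<Longrightarrow> C * ln x powr b + 2 * ((x powr (1 - e) + 1) * ((B * x * ln x powr a) powr (\<delta> - 1) / ln 2)
      + 2 * (c2 * x powr \<delta> / ln x powr (a + 3))) + D + c1 * x powr \<delta> / ln x powr 3 < c * x powr \<delta> / ln x"
    "\<And>x. x \<ge> x0 \<Longrightarrow> x powr (1 - e) < x - 1"
    unfolding eventually_at_top_linorder by blast
  define K0 where "K0 = max 16 (max (max K1 K2) (max K3 (max (nat \<lceil>x0\<rceil>) (nat \<lceil>exp (1 / (\<delta> - 1))\<rceil>))))"
  have False if k: "N k \<ge> K0" and \<gamma>: "\<gamma> > 0" and \<beta>: "real \<beta> \<le> C * real (N k) * ln (real (N k)) powr a"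
    and \<iota>: "real \<iota> \<le> C * ln (real (N k)) powr b"
    and near: "\<bar>real \<beta> - real_of_int m * real (N k)\<bar> \<le> real (N k) powr (1 - \<epsilon>)"
    and Pint: "P_integer P N 1 \<beta> \<gamma> \<iota> k" for k \<beta> \<gamma> \<iota> and m :: int
  proof -
    define K where "K = N k"
    have K: "K \<ge> 16" "K \<ge> K1" "K \<ge> K2" "K \<ge> K3" "real K \<ge> x0" "exp (1 / (\<delta> - 1)) \<le> real K"
      using k unfolding K0_def K_def by linarith+
    have K3: "K \<ge> 3" "K \<ge> 2" using K by auto
    define r where "r = real K powr (1 - e)"
    have "real K powr (1 - \<epsilon>) \<le> r" unfolding r_def using e K by (intro powr_mono) auto
    hence near: "\<bar>real \<beta> - real_of_int m * real K\<bar> \<le> r" using near unfolding K_def by linarith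
    have r: "r < real K - 1" unfolding r_def by (rule x0(2)[OF K(5)])
    have \<beta>K: "K - 1 \<le> \<beta>" by (rule P_integer_bound_ge[OF K3(2) Pint _ \<gamma>]) (simp add: K_def)
    \<comment> \<open>Otherwise \<beta> \<le> K^(1-e) < K - 1, against
      \<open>P_integer_bound_ge\<close>.\<close>
    have "m > 0"
    proof (rule ccontr)
      assume "\<not> m > 0"
      hence "real_of_int m * real K \<le> 0" by (intro mult_nonpos_nonneg) auto
      hence "real \<beta> \<le> r" using near by linarith
      thus False using r \<beta>K K by linarith
    qed
    define n where "n = nat m"
    have n: "n \<ge> 1" "real n = real_of_int m" using \<open>m > 0\<close> by (auto simp: n_def)
    have nK: "\<bar>real \<beta> - real (n * K)\<bar> \<le> r" using near n(2) by simp
    have Kn: "K \<le> n * K" using n by simp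
    \<comment> \<open>The last integer before nK, so that exactly the blocks 0, ..., n - 1 are
      counted in full.\<close>
    define y where "y = n * K - 1"
    have yK: "K - 1 \<le> y" unfolding y_def using Kn by (rule diff_le_mono)
    have y: "real y = real (n * K) - 1" using Kn K by (simp add: y_def of_nat_diff)
    have X: "real \<beta> + real K \<le> B * real K * ln (real K) powr a"
      unfolding B_def by (rule add_le_mult_log_powr[OF K3(1) C a]) (use \<beta> in \<open>simp add: K_def\<close>)
    have X1: "real (n * K) \<le> B * real K * ln (real K) powr a" using X nK r by linarith
    define E where "E = c2 * real K powr \<delta> / ln (real K) powr (a + 3)"
    define F where "F = (B * real K * ln (real K) powr a) powr (\<delta> - 1) / ln 2"
    let ?G = "{p \<in> P. min \<beta> y < N p \<and> N p \<le> max \<beta> y}"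
    have "\<beta> \<ge> (K - 1) div 2" "y \<ge> (K - 1) div 2" using \<beta>K yK by linarith+
    moreover have "real \<beta> \<le> B * real K * ln (real K) powr a" "real y \<le> B * real K * ln (real K) powr a"
      using X X1 y by linarith+
    ultimately have pn: "\<bar>real (prime_count (min \<beta> y)) - li_sum \<delta> (min \<beta> y)\<bar> \<le> E"
        "\<bar>real (prime_count (max \<beta> y)) - li_sum \<delta> (max \<beta> y)\<bar> \<le> E"
      unfolding E_def using pnt[OF K(3), of \<beta>] pnt[OF K(3), of y] by (auto simp: min_def max_def)
    have max_le: "real (max \<beta> y) \<le> B * real K * ln (real K) powr a"
      using X X1 y by (auto simp: max_def)
    have F0: "F \<ge> 0" by (simp add: F_def)
    have "li_sum \<delta> (max \<beta> y) - li_sum \<delta> (min \<beta> y) = (\<Sum>i\<in>{min \<beta> y<..max \<beta> y}. li_weight \<delta> i)"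
      by (rule li_sum_diff) simp
    also have "\<dots> \<le> (\<Sum>i\<in>{min \<beta> y<..max \<beta> y}. F)"
    proof (rule sum_mono)
      fix i assume "i \<in> {min \<beta> y<..max \<beta> y}"
      hence "real i \<le> real (max \<beta> y)" by auto
      thus "li_weight \<delta> i \<le> F" unfolding F_def
        using \<delta> max_le X K by (intro li_weight_le) auto
    qed
    also have "\<dots> = real (max \<beta> y - min \<beta> y) * F" by simp
    also have "\<dots> \<le> (r + 1) * F"
    proof (rule mult_right_mono)
      show "real (max \<beta> y - min \<beta> y) \<le> r + 1" using nK y by (auto simp: max_def min_def of_nat_diff)
    qed (rule F0)
    finally have "real (card ?G) \<le> (r + 1) * F + 2 * E"
      using pn card_between[of "min \<beta> y" "max \<beta> y"] by (simp add: abs_le_iff)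
    moreover have "card (high K y) + card (low K \<beta>) \<le> card (high K \<beta>) + card (low K y) + 2 * card ?G"
      by (rule half_system_perturb)
    moreover have "card (high K \<beta>) \<le> card (low K \<beta>) + \<iota>"
      by (rule residue_balance[OF K3(1) Pint]) (simp add: K_def)
    moreover have "real hy - real ly \<le> real i + 2 * w"
      if "real g \<le> w" "hy + lb \<le> hb + ly + 2 * g" "hb \<le> lb + i" for g hy lb hb ly i :: nat and w
      using that by linarith
    ultimately have up: "real (card (high K y)) - real (card (low K y)) \<le> real \<iota> + 2 * ((r + 1) * F + 2 * E)"
      by blast
    have "{..<n} = insert 0 {1..<n}" using n by auto
    hence "(\<Sum>j<n. li_block \<delta> K j) = li_block \<delta> K 0 + (\<Sum>j=1..<n. li_block \<delta> K j)" by simp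
    moreover have "(\<Sum>j=1..<n. li_block \<delta> K j) \<le> 0"
      by (intro sum_nonpos li_block_nonpos \<delta> K) auto
    ultimately have blocks: "(\<Sum>j<n. li_block \<delta> K j) \<le> D - c * real K powr \<delta> / ln (real K)"
      using blk[OF K(4)] by linarith
    have d: "\<bar>(real (card (low K y)) - real (card (high K y))) - (\<Sum>j<n. li_block \<delta> K j)\<bar> \<le> c1 * real K powr \<delta> / ln (real K) powr 3"
      unfolding y_def by (rule diff[OF K(2) X1])
    have i: "real \<iota> \<le> C * ln (real K) powr b" using \<iota> by (simp add: K_def)
    show False
      using x0(1)[OF K(5), folded r_def E_def F_def] up blocks abs_le_D1[OF d] i by linarith
  qed
  thus ?thesis by blast
qed

end

theorem theorem1:
  fixes P :: "'a::comm_monoid_mult set"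
    and N :: "'a \<Rightarrow> nat"
    and \<delta> a b C \<epsilon> :: real
  assumes "arithmetical_semigroup P (\<lambda>g. real (N g))"
    and "\<And>g. N g > 0"
    and "\<delta> > 0"
    and "axiom_A (\<lambda>g. real (N g)) \<delta>"
    and "a > 0" and "b > 0" and "C > 0" and "\<epsilon> > 0"
  shows "finite {k. N k \<ge> 2 \<and>
    (\<exists>\<beta> \<gamma> \<iota>. \<beta> > 0 \<and> \<gamma> > 0 \<and> \<iota> > 0 \<and>
       real \<beta> \<le> C * real (N k) * ln (real (N k)) powr a \<and>
       real \<iota> \<le> C * ln (real (N k)) powr b \<and>
       (\<delta> > 1 \<longrightarrow>
          (\<exists>m::int. \<bar>real \<beta> - real_of_int m * real (N k)\<bar> \<le> real (N k) powr (1 - \<epsilon>))) \<and>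
       P_integer P N 1 \<beta> \<gamma> \<iota> k)}"
proof -
  interpret integral_semigroup P N
    by (intro integral_semigroup.intro integral_semigroup_axioms.intro assms)
  have "\<exists>K0. \<forall>k \<beta> \<gamma> \<iota>. N k \<ge> K0 \<longrightarrow> \<gamma> > 0 \<longrightarrow>
     real \<beta> \<le> C * real (N k) * ln (real (N k)) powr a \<longrightarrow> real \<iota> \<le> C * ln (real (N k)) powr b \<longrightarrow>
     (\<delta> > 1 \<longrightarrow> (\<exists>m::int. \<bar>real \<beta> - real_of_int m * real (N k)\<bar> \<le> real (N k) powr (1 - \<epsilon>))) \<longrightarrow>
     \<not> P_integer P N 1 \<beta> \<gamma> \<iota> k"
  proof (cases "\<delta> > 1")
    case True
    from finitely_many_convex[OF assms(4) this assms(5-8)] show ?thesis using True by blast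
  next
    case False
    hence "\<delta> \<le> 1" by simp
    from finitely_many_concave[OF assms(4,3) this assms(5-7)] show ?thesis by blast
  qed
  then obtain K0 where K0: "\<And>k \<beta> \<gamma> \<iota>. N k \<ge> K0 \<Longrightarrow> \<gamma> > 0 \<Longrightarrow>
     real \<beta> \<le> C * real (N k) * ln (real (N k)) powr a \<Longrightarrow> real \<iota> \<le> C * ln (real (N k)) powr b \<Longrightarrow>
     (\<delta> > 1 \<longrightarrow> (\<exists>m::int. \<bar>real \<beta> - real_of_int m * real (N k)\<bar> \<le> real (N k) powr (1 - \<epsilon>))) \<Longrightarrow>
     \<not> P_integer P N 1 \<beta> \<gamma> \<iota> k" by blast
  show ?thesis
  proof (rule finite_subset[OF _ finite_N_le[of K0]], clarify)
    fix k \<beta> \<gamma> \<iota>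
    assume "\<gamma> > 0" "real \<beta> \<le> C * real (N k) * ln (real (N k)) powr a" "real \<iota> \<le> C * ln (real (N k)) powr b"
      "\<delta> > 1 \<longrightarrow> (\<exists>m::int. \<bar>real \<beta> - real_of_int m * real (N k)\<bar> \<le> real (N k) powr (1 - \<epsilon>))"
      "P_integer P N 1 \<beta> \<gamma> \<iota> k"
    thus "N k \<le> K0" using K0[of k \<gamma> \<beta> \<iota>] by (meson le_cases)
  qed
qed

end
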